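(* Let $X$ be a finite biquandle, let $S_\ast:\ \emptyset=S_0\subseteq S_1\subseteq\cdots\subseteq S_m$ be a filtration of $\mathrm{End}(X)$, and let $N\ge1$. Then the stillborn matrix $\mathcal M^{(N)}(L;X,S_\ast)$ is an invariant of links; that is, if $L_1$ and $L_2$ are virtually equivalent oriented virtual link diagrams, then $\mathcal M^{(N)}(L_1;X,S_\ast)=\mathcal M^{(N)}(L_2;X,S_\ast)$.
   Context: **Links.** A virtual link diagram is an immersion of finitely many circles in the plane with finitely many transversal double points, each being either a classical crossing (with over/under information) or a virtual crossing (no over/under information). Diagrams are oriented. "Link" means oriented virtual link: an equivalence class of oriented virtual link diagrams under virtual equivalence, i.e. planar isotopy and the generalized Reidemeister moves: the classical Reidemeister moves R1, R2, R3 (on classical crossings), the virtual Reidemeister moves (the analogues of R1, R2, R3 with all crossings virtual), and the mixed move (an arc having two consecutive virtual crossings is moved across a classical crossing). A semi-arc is a segment of the diagram between two consecutive classical crossings (it may pass through virtual crossings; a component with no classical crossing is one semi-arc). **Biquandles.** A biquandle is a set $X$ with operations $\underline{\triangleright},\overline{\triangleright}:X\times X\to X$ such that for all $x,y,z\in X$: (1) $x\,\underline{\triangleright}\,x=x\,\overline{\triangleright}\,x$; (2) the maps $\alpha_y(x)=x\,\overline{\triangleright}\,y$, $\beta_y(x)=x\,\underline{\triangleright}\,y$ on $X$ and $S(x,y)=(y\,\overline{\triangleright}\,x,\;x\,\underline{\triangleright}\,y)$ on $X\times X$ are invertible; (3) $(x\underline{\triangleright}y)\underline{\triangleright}(z\underline{\triangleright}y)=(x\underline{\triangleright}z)\underline{\triangleright}(y\overline{\triangleright}z)$,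 $(x\underline{\triangleright}y)\overline{\triangleright}(z\underline{\triangleright}y)=(x\overline{\triangleright}z)\underline{\triangleright}(y\overline{\triangleright}z)$, $(x\overline{\triangleright}y)\overline{\triangleright}(z\overline{\triangleright}y)=(x\overline{\triangleright}z)\overline{\triangleright}(y\underline{\triangleright}z)$. $\mathrm{End}(X)$ is the set of maps $X\to X$ preserving both operations. **Colorings.** An $X$-coloring of a diagram $L$ is a labeling $f$ of the semi-arcs of $L$ by elements of $X$ such that at each classical crossing: if $x$ is the label of the semi-arc of the under-strand lying to the right of the (oriented) over-strand, and $y$ is the label of the semi-arc of the over-strand lying to the right of the (oriented) under-strand, then the other semi-arc of the under-strand (to the left of the over-strand) is labeled $x\,\underline{\triangleright}\,y$ and the other semi-arc of the over-strand (to the left of the under-strand) is labeled $y\,\overline{\triangleright}\,x$. Labels do not change at virtual crossings. $\mathrm{Col}_X(L)$ is the set of $X$-colorings. For $\alpha\in\mathrm{End}(X)$ and $f\in\mathrm{Col}_X(L)$, $\alpha\circ f\in \mathrm{Col}_X(L)$. **Coloring quiver.** A quiver is a directed graph, possibly with loops and multiple edges; $e_{\mathcal Q}(u,v)$ is the number of edges from $u$ to $v$ in $\mathcal Q$. For $S\subseteq\mathrm{End}(X)$, the $X$-coloring quiver $\mathcal Q_X^S(L)$ has vertex set $\{v_f: f\in\mathrm{Col}_X(L)\}$ and, for each $f$ and each $\alpha\in S$, one edge $v_f\to v_{\alpha\circ f}$; thus $e(v_f,v_g)=|\{\alpha\in S:\alpha\circ f=g\}|$. **$N$-directed clique complex.**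 For a finite quiver $\mathcal Q$ with vertex set $V$ and $N\ge1$, the $N$-directed clique complex $\mathcal K^{(N)}(\mathcal Q)$ is the abstract ordered simplicial complex (collection of finite lists of distinct vertices closed under taking sublists) with $K_0^{(N)}(\mathcal Q)=\{(v):v\in V\}$ and, for $n>0$, $K_n^{(N)}(\mathcal Q)=\{(v_0,\dots,v_n): v_i\ne v_j \text{ and } e_{\mathcal Q}(v_i,v_j)\ge N\text{ for all } i<j\}$. Its chain group $C_n$ is the free abelian group on $K_n^{(N)}(\mathcal Q)$, with $\partial_n(v_0,\dots,v_n)=\sum_{i=0}^n(-1)^i(v_0,\dots,\widehat{v_i},\dots,v_n)$ (and $\partial_0=0$). **Stillborn matrix.** A filtration $S_\ast$ of $\mathrm{End}(X)$ is a nested sequence of subsets $S_0\subseteq\cdots\subseteq S_m$ of $\mathrm{End}(X)$; it is not required that $S_m=\mathrm{End}(X)$. Write $\mathcal K_j=\mathcal K^{(N)}(\mathcal Q_X^{S_j}(L))$, so $\mathcal K_0\subseteq\cdots\subseteq\mathcal K_m$. A stillborn homology class of dimension $i$ at stage $j$ is a homology class that is born at stage $j$ but is already trivial at that stage, i.e. a new $i$-cycle appearing in $\mathcal K_j$ (not already in $\mathcal K_{j-1}$) that is already a boundary in $\mathcal K_j$. The stillborn matrix is $\mathcal M^{(N)}(L;X,S_\ast)=(a_{ij})$, indexed by dimensions $i\ge0$ and stages $0\le j\le m$, where $a_{ij}$ is the number of (independent) stillborn homology classes of dimension $i$ at stage $j$. Explicitly, with $Z_i(\mathcal K_j)=\ker\partial_i$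 and $B_i(\mathcal K_j)=\operatorname{im}\partial_{i+1}$ in $C_i(\mathcal K_j)$, and $Z_i(\mathcal K_{-1})=0$, $$a_{ij}=\operatorname{rank}\Big(B_i(\mathcal K_j)\big/\big(B_i(\mathcal K_j)\cap Z_i(\mathcal K_{j-1})\big)\Big).$$ *)

theory Defs
  imports
    "HOL-Analysis.Analysis"
    "HOL-Algebra.Coset"
    "HOL-Algebra.Free_Abelian_Groups"
    "Graph_Theory.Digraph"
begin

section \<open>Plane vectors and diffeomorphisms of the plane\<close>

text \<open>The plane is \<^typ>\<open>complex\<close>. The vector \<open>v\<close> points to the left of the vector \<open>u\<close> iff
  \<open>cross u v > 0\<close>.\<close>

definition cross :: "complex \<Rightarrow> complex \<Rightarrow> real" where
  "cross u v = Re u * Im v - Im u * Re v"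

definition jacobian :: "(complex \<Rightarrow> complex) \<Rightarrow> complex \<Rightarrow> real" where
  "jacobian \<phi> z = cross (frechet_derivative \<phi> (at z) 1) (frechet_derivative \<phi> (at z) \<i>)"

definition plane_diffeo :: "(complex \<Rightarrow> complex) \<Rightarrow> bool" where
  "plane_diffeo \<phi> \<longleftrightarrow>
     bij \<phi> \<and> (\<forall>z. \<phi> differentiable (at z)) \<and>
     (\<forall>v. continuous_on UNIV (\<lambda>z. frechet_derivative \<phi> (at z) v)) \<and>
     (\<forall>z. jacobian \<phi> z \<noteq> 0)"

definition plane_isotopy :: "(real \<Rightarrow> complex \<Rightarrow> complex) \<Rightarrow> bool" where
  "plane_isotopy \<Phi> \<longleftrightarrow>
     \<Phi> 0 = id \<and> (\<forall>t\<in>{0..1}. plane_diffeo (\<Phi> t)) \<and>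
     continuous_on ({0..1} \<times> UNIV) (\<lambda>(t, z). \<Phi> t z) \<and>
     (\<forall>v. continuous_on ({0..1} \<times> UNIV) (\<lambda>(t, z). frechet_derivative (\<Phi> t) (at z) v))"


section \<open>Virtual link diagrams\<close>

text \<open>
  A diagram consists of \<open>ncomp\<close> closed curves. Component \<open>k < ncomp\<close> is an immersion of the circle
  \<open>\<real>/\<int>\<close>, given as a 1-periodic map \<open>curve k\<close> on the reals and oriented by increasing parameter; a
  point of the domain is thus written \<open>(k, t)\<close> with \<open>t\<close> taken modulo 1. The set \<open>over\<close> contains those
  \<open>(k, t)\<close> at which component \<open>k\<close> runs through a classical crossing as the over-strand. A double
  point is a classical crossing if one of its two preimages lies in \<open>over\<close>, and a virtual crossing
  if none does.
\<close>

type_synonym param = "nat \<times> real"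

record diagram =
  ncomp :: nat
  curve :: "nat \<Rightarrow> real \<Rightarrow> complex"
  over :: "param set"

definition params :: "diagram \<Rightarrow> param set" where
  "params D = {..<ncomp D} \<times> UNIV"

definition point :: "diagram \<Rightarrow> param \<Rightarrow> complex" where
  "point D p = curve D (fst p) (snd p)"

definition velocity :: "diagram \<Rightarrow> param \<Rightarrow> complex" where
  "velocity D p = vector_derivative (curve D (fst p)) (at (snd p))"

definition same_param :: "param \<Rightarrow> param \<Rightarrow> bool" where
  "same_param p q \<longleftrightarrow> fst p = fst q \<and> snd p - snd q \<in> \<int>"

definition crossing :: "diagram \<Rightarrow> param \<Rightarrow> param \<Rightarrow> bool" where
  "crossing D p q \<longleftrightarrow>
     p \<in> params D \<and> q \<in> params D \<and> \<not> same_param p q \<and> point D p = point D q"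

definition virtual_link_diagram :: "diagram \<Rightarrow> bool" where
  "virtual_link_diagram D \<longleftrightarrow>
     (\<forall>k < ncomp D. (\<forall>t. curve D k (t + 1) = curve D k t) \<and> curve D k C1_differentiable_on UNIV) \<and>
     (\<forall>p \<in> params D. velocity D p \<noteq> 0) \<and>
     finite {point D p | p q. crossing D p q} \<and>
     (\<forall>p q r. crossing D p q \<longrightarrow> crossing D p r \<longrightarrow> same_param q r) \<and>
     (\<forall>p q. crossing D p q \<longrightarrow> cross (velocity D p) (velocity D q) \<noteq> 0) \<and>
     (\<forall>p \<in> over D. \<exists>q. crossing D p q) \<and>
     (\<forall>p q. p \<in> params D \<longrightarrow> same_param p q \<longrightarrow> p \<in> over D \<longrightarrow> q \<in> over D) \<and>
     (\<forall>p q. crossing D p q \<longrightarrow> p \<in> over D \<longrightarrow> q \<notin> over D)"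


section \<open>Virtual equivalence\<close>

subsection \<open>Reparametrization and planar isotopy\<close>

text \<open>Diagrams are considered up to relabelling of the components and orientation preserving
  reparametrization of each circle; \<open>\<rho> k\<close> is a lift to the reals of a diffeomorphism of the circle.\<close>

definition reparametrization :: "diagram \<Rightarrow> diagram \<Rightarrow> bool" where
  "reparametrization D E \<longleftrightarrow>
     ncomp E = ncomp D \<and>
     (\<exists>\<pi> \<rho>. bij_betw \<pi> {..<ncomp D} {..<ncomp D} \<and>
       (\<forall>k < ncomp D.
          \<rho> k C1_differentiable_on UNIV \<and>
          (\<forall>t. \<rho> k (t + 1) = \<rho> k t + 1 \<and> deriv (\<rho> k) t > 0 \<and>
               curve E k t = curve D (\<pi> k) (\<rho> k t) \<and>
               ((k, t) \<in> over E \<longleftrightarrow> (\<pi> k, \<rho> k t) \<in> over D))))"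

definition planar_isotopic :: "diagram \<Rightarrow> diagram \<Rightarrow> bool" where
  "planar_isotopic D E \<longleftrightarrow>
     ncomp E = ncomp D \<and> over E = over D \<and>
     (\<exists>\<Phi>. plane_isotopy \<Phi> \<and> (\<forall>k < ncomp D. \<forall>t. curve E k t = \<Phi> 1 (curve D k t)))"

subsection \<open>Local changes of a diagram\<close>

text \<open>
  A strand \<open>(k, c, r)\<close> is the part of component \<open>k\<close> with parameters \<open>c + r * u\<close>, \<open>-1 \<le> u \<le> 1\<close>. It
  is traversed in the direction of increasing \<open>u\<close> if \<open>r > 0\<close> and of decreasing \<open>u\<close> if \<open>r < 0\<close>.
\<close>

type_synonym strand = "nat \<times> real \<times> real"

definition strand_param :: "strand \<Rightarrow> real \<Rightarrow> param" where
  "strand_param = (\<lambda>(k, c, r) u. (k, c + r * u))"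

definition on_strand :: "strand \<Rightarrow> param set" where
  "on_strand s = {p. \<exists>u\<in>{-1..1}. same_param p (strand_param s u)}"

text \<open>
  \<open>local_change D E ss fs gs\<close>: the diagrams agree outside a disc, the image of the closed unit disc
  under an orientation preserving diffeomorphism \<open>\<phi>\<close> of the plane. In that disc \<open>D\<close> consists of the
  strands \<open>ss\<close> running along the arcs \<open>\<phi> \<circ> fs ! i\<close>, and \<open>E\<close> of the same strands running along the
  arcs \<open>\<phi> \<circ> gs ! i\<close>.
\<close>

definition local_change ::
  "diagram \<Rightarrow> diagram \<Rightarrow> strand list \<Rightarrow> (real \<Rightarrow> complex) list \<Rightarrow> (real \<Rightarrow> complex) list \<Rightarrow> bool" where
  "local_change D E ss fs gs \<longleftrightarrow>
     ncomp E = ncomp D \<and> length ss = length fs \<and> length gs = length fs \<and>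
     (\<forall>(k, c, r) \<in> set ss. k < ncomp D \<and> r \<noteq> 0 \<and> \<bar>r\<bar> < 1/2) \<and>
     (\<forall>i < length ss. \<forall>j < length ss. i \<noteq> j \<longrightarrow> on_strand (ss ! i) \<inter> on_strand (ss ! j) = {}) \<and>
     (\<exists>\<phi>. plane_diffeo \<phi> \<and> (\<forall>z. jacobian \<phi> z > 0) \<and>
        (\<forall>i < length ss. \<forall>u\<in>{-1..1}.
           point D (strand_param (ss ! i) u) = \<phi> ((fs ! i) u) \<and>
           point E (strand_param (ss ! i) u) = \<phi> ((gs ! i) u)) \<and>
        (\<forall>p \<in> params D. (\<forall>s \<in> set ss. p \<notin> on_strand s) \<longrightarrow>
           point E p = point D p \<and> point D p \<notin> \<phi> ` cball 0 1 \<and>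
           (p \<in> over E \<longleftrightarrow> p \<in> over D)))"

text \<open>In the disc, at each crossing of two different strands \<open>i\<close> and \<open>j\<close>, strand \<open>i\<close> is the
  over-strand of a classical crossing iff \<open>ov i j\<close>.\<close>

definition crossing_types :: "diagram \<Rightarrow> strand list \<Rightarrow> (nat \<Rightarrow> nat \<Rightarrow> bool) \<Rightarrow> bool" where
  "crossing_types D ss ov \<longleftrightarrow>
     (\<forall>i < length ss. \<forall>j < length ss. i \<noteq> j \<longrightarrow>
       (\<forall>p \<in> on_strand (ss ! i). \<forall>q \<in> on_strand (ss ! j).
          crossing D p q \<longrightarrow> (p \<in> over D \<longleftrightarrow> ov i j)))"

subsection \<open>Pictures of the moves\<close>

text \<open>
  All arcs below are proper arcs of the closed unit disc. Corresponding arcs before and after a move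
  agree to first order at \<open>u = -1\<close> and \<open>u = 1\<close>. Since the strands may be traversed in both directions
  and the over/under information is arbitrary, the families of moves are closed under reflection of
  the plane, so that orientation preserving \<open>\<phi>\<close> suffice.
\<close>

definition straight_arc :: "real \<Rightarrow> complex" where
  "straight_arc u = Complex u 0"

text \<open>A curl; its only double point is attained at \<open>u = -1/2\<close> and \<open>u = 1/2\<close>.\<close>

definition curl_arc :: "real \<Rightarrow> complex" where
  "curl_arc u = Complex (u * (1 - 16/9 * (1 - u\<^sup>2)\<^sup>2)) ((1 - u\<^sup>2)\<^sup>2 / 2)"

text \<open>\<open>high_arc\<close> is disjoint from \<open>straight_arc\<close>; \<open>dipping_arc\<close> meets it in two points, at
  \<open>u = -1/2\<close> and \<open>u = 1/2\<close>.\<close>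

definition high_arc :: "real \<Rightarrow> complex" where
  "high_arc u = Complex (4/5 * u) (3/5)"

definition dipping_arc :: "real \<Rightarrow> complex" where
  "dipping_arc u = Complex (4/5 * u) (3/5 - 16/15 * (1 - u\<^sup>2)\<^sup>2)"

text \<open>Two lines crossing at 0, and an arc passing above or below that crossing. The latter meets the
  two lines once each, at \<open>u = -1/2\<close> and \<open>u = 1/2\<close>.\<close>

definition rising_arc :: "real \<Rightarrow> complex" where
  "rising_arc u = Complex (4/5 * u) (3/5 * u)"

definition falling_arc :: "real \<Rightarrow> complex" where
  "falling_arc u = Complex (4/5 * u) (- 3/5 * u)"

definition above_arc :: "real \<Rightarrow> complex" where
  "above_arc u = Complex u (2/3 * (1 - u\<^sup>2)\<^sup>2)"

definition below_arc :: "real \<Rightarrow> complex" where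
  "below_arc u = Complex u (- 2/3 * (1 - u\<^sup>2)\<^sup>2)"

definition change1 :: "diagram \<Rightarrow> diagram \<Rightarrow> strand list \<Rightarrow> bool" where
  "change1 D E ss \<longleftrightarrow> local_change D E ss [straight_arc] [curl_arc]"

definition change2 :: "diagram \<Rightarrow> diagram \<Rightarrow> strand list \<Rightarrow> bool" where
  "change2 D E ss \<longleftrightarrow> local_change D E ss [straight_arc, high_arc] [straight_arc, dipping_arc]"

definition change3 :: "diagram \<Rightarrow> diagram \<Rightarrow> strand list \<Rightarrow> bool" where
  "change3 D E ss \<longleftrightarrow>
     local_change D E ss [rising_arc, falling_arc, above_arc] [rising_arc, falling_arc, below_arc]"

subsection \<open>The generalized Reidemeister moves\<close>

definition R1 :: "diagram \<Rightarrow> diagram \<Rightarrow> bool" where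
  "R1 D E \<longleftrightarrow> (\<exists>s. change1 D E [s] \<and>
     (strand_param s (-1/2) \<in> over E \<or> strand_param s (1/2) \<in> over E))"

text \<open>In R2 and R3 the strands lie at pairwise different heights \<open>h i\<close>.\<close>

definition R2 :: "diagram \<Rightarrow> diagram \<Rightarrow> bool" where
  "R2 D E \<longleftrightarrow> (\<exists>ss h. change2 D E ss \<and> inj_on (h :: nat \<Rightarrow> nat) {..<2} \<and>
     crossing_types E ss (\<lambda>i j. h i > h j))"

definition R3 :: "diagram \<Rightarrow> diagram \<Rightarrow> bool" where
  "R3 D E \<longleftrightarrow> (\<exists>ss h. change3 D E ss \<and> inj_on (h :: nat \<Rightarrow> nat) {..<3} \<and>
     crossing_types D ss (\<lambda>i j. h i > h j) \<and> crossing_types E ss (\<lambda>i j. h i > h j))"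

definition VR1 :: "diagram \<Rightarrow> diagram \<Rightarrow> bool" where
  "VR1 D E \<longleftrightarrow> (\<exists>s. change1 D E [s] \<and>
     strand_param s (-1/2) \<notin> over E \<and> strand_param s (1/2) \<notin> over E)"

definition VR2 :: "diagram \<Rightarrow> diagram \<Rightarrow> bool" where
  "VR2 D E \<longleftrightarrow> (\<exists>ss. change2 D E ss \<and> crossing_types E ss (\<lambda>i j. False))"

definition VR3 :: "diagram \<Rightarrow> diagram \<Rightarrow> bool" where
  "VR3 D E \<longleftrightarrow> (\<exists>ss. change3 D E ss \<and>
     crossing_types D ss (\<lambda>i j. False) \<and> crossing_types E ss (\<lambda>i j. False))"

text \<open>In the mixed move, strands 0 and 1 cross classically and strand 2 crosses both virtually.\<close>

definition mixed_move :: "diagram \<Rightarrow> diagram \<Rightarrow> bool" where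
  "mixed_move D E \<longleftrightarrow> (\<exists>ss h. change3 D E ss \<and> inj_on (h :: nat \<Rightarrow> nat) {..<2} \<and>
     crossing_types D ss (\<lambda>i j. i < 2 \<and> j < 2 \<and> h i > h j) \<and>
     crossing_types E ss (\<lambda>i j. i < 2 \<and> j < 2 \<and> h i > h j))"

definition elementary_step :: "diagram \<Rightarrow> diagram \<Rightarrow> bool" where
  "elementary_step D E \<longleftrightarrow>
     virtual_link_diagram D \<and> virtual_link_diagram E \<and>
     (reparametrization D E \<or> planar_isotopic D E \<or>
      R1 D E \<or> R2 D E \<or> R3 D E \<or> VR1 D E \<or> VR2 D E \<or> VR3 D E \<or> mixed_move D E)"

definition virtually_equivalent :: "diagram \<Rightarrow> diagram \<Rightarrow> bool" where
  "virtually_equivalent = equivclp elementary_step"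


section \<open>Semi-arcs\<close>

definition classical_params :: "diagram \<Rightarrow> param set" where
  "classical_params D = {p. \<exists>q. crossing D p q \<and> (p \<in> over D \<or> q \<in> over D)}"

text \<open>A semi-arc is represented by the set of its parameters, without the classical crossings at its
  ends. It is a connected component of the circles minus the preimages of the classical crossings.\<close>

definition semi_arc :: "diagram \<Rightarrow> param \<Rightarrow> param set" where
  "semi_arc D = (\<lambda>(k, t). {(k, s) | s.
     \<exists>m::int. \<forall>x \<in> closed_segment t (s + of_int m). (k, x) \<notin> classical_params D})"

definition semi_arcs :: "diagram \<Rightarrow> param set set" where
  "semi_arcs D = semi_arc D ` (params D - classical_params D)"

text \<open>The semi-arcs ending and starting, respectively, at a classical crossing parameter.\<close>

definition arc_before :: "diagram \<Rightarrow> param \<Rightarrow> param set" where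
  "arc_before D = (\<lambda>(k, t). {(k, s) | s.
     \<exists>m::int. s + of_int m < t \<and> (\<forall>x \<in> {s + of_int m..<t}. (k, x) \<notin> classical_params D)})"

definition arc_after :: "diagram \<Rightarrow> param \<Rightarrow> param set" where
  "arc_after D = (\<lambda>(k, t). {(k, s) | s.
     \<exists>m::int. t < s + of_int m \<and> (\<forall>x \<in> {t<..s + of_int m}. (k, x) \<notin> classical_params D)})"

text \<open>For a classical crossing of the strands through \<open>p\<close> and \<open>q\<close>: the semi-arc of the strand through
  \<open>p\<close> lying to the right, respectively left, of the oriented strand through \<open>q\<close>.\<close>

definition right_arc :: "diagram \<Rightarrow> param \<Rightarrow> param \<Rightarrow> param set" where
  "right_arc D p q =
     (if cross (velocity D q) (velocity D p) > 0 then arc_before D p else arc_after D p)"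

definition left_arc :: "diagram \<Rightarrow> param \<Rightarrow> param \<Rightarrow> param set" where
  "left_arc D p q =
     (if cross (velocity D q) (velocity D p) > 0 then arc_after D p else arc_before D p)"


section \<open>Biquandles, colorings and coloring quivers\<close>

text \<open>\<open>ut\<close> and \<open>ot\<close> are the operations written as an underlined and an overlined triangle.\<close>

definition biquandle :: "'x set \<Rightarrow> ('x \<Rightarrow> 'x \<Rightarrow> 'x) \<Rightarrow> ('x \<Rightarrow> 'x \<Rightarrow> 'x) \<Rightarrow> bool" where
  "biquandle X ut ot \<longleftrightarrow>
     (\<forall>x\<in>X. \<forall>y\<in>X. ut x y \<in> X \<and> ot x y \<in> X) \<and>
     (\<forall>x\<in>X. ut x x = ot x x) \<and>
     (\<forall>y\<in>X. bij_betw (\<lambda>x. ot x y) X X) \<and>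
     (\<forall>y\<in>X. bij_betw (\<lambda>x. ut x y) X X) \<and>
     bij_betw (\<lambda>(x, y). (ot y x, ut x y)) (X \<times> X) (X \<times> X) \<and>
     (\<forall>x\<in>X. \<forall>y\<in>X. \<forall>z\<in>X.
        ut (ut x y) (ut z y) = ut (ut x z) (ot y z) \<and>
        ot (ut x y) (ut z y) = ut (ot x z) (ot y z) \<and>
        ot (ot x y) (ot z y) = ot (ot x z) (ut y z))"

definition End :: "'x set \<Rightarrow> ('x \<Rightarrow> 'x \<Rightarrow> 'x) \<Rightarrow> ('x \<Rightarrow> 'x \<Rightarrow> 'x) \<Rightarrow> ('x \<Rightarrow> 'x) set" where
  "End X ut ot = {\<alpha> \<in> X \<rightarrow>\<^sub>E X.
     \<forall>x\<in>X. \<forall>y\<in>X. \<alpha> (ut x y) = ut (\<alpha> x) (\<alpha> y) \<and> \<alpha> (ot x y) = ot (\<alpha> x) (\<alpha> y)}"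

type_synonym 'x coloring = "param set \<Rightarrow> 'x"

definition Col :: "'x set \<Rightarrow> ('x \<Rightarrow> 'x \<Rightarrow> 'x) \<Rightarrow> ('x \<Rightarrow> 'x \<Rightarrow> 'x) \<Rightarrow> diagram \<Rightarrow> 'x coloring set" where
  "Col X ut ot D = {f \<in> semi_arcs D \<rightarrow>\<^sub>E X.
     \<forall>p q. crossing D p q \<longrightarrow> p \<in> over D \<longrightarrow>
       (let x = f (right_arc D q p); y = f (right_arc D p q)
        in f (left_arc D q p) = ut x y \<and> f (left_arc D p q) = ot y x)}"

definition coloring_quiver ::
  "'x set \<Rightarrow> ('x \<Rightarrow> 'x \<Rightarrow> 'x) \<Rightarrow> ('x \<Rightarrow> 'x \<Rightarrow> 'x) \<Rightarrow> ('x \<Rightarrow> 'x) set \<Rightarrow> diagram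
   \<Rightarrow> ('x coloring, 'x coloring \<times> ('x \<Rightarrow> 'x)) pre_digraph" where
  "coloring_quiver X ut ot S D =
     \<lparr>verts = Col X ut ot D, arcs = Col X ut ot D \<times> S,
      tail = fst, head = (\<lambda>(f, \<alpha>). compose (semi_arcs D) \<alpha> f)\<rparr>"

definition num_edges :: "('v, 'e) pre_digraph \<Rightarrow> 'v \<Rightarrow> 'v \<Rightarrow> nat" where
  "num_edges Q u v = card {e \<in> arcs Q. arc_to_ends Q e = (u, v)}"


section \<open>Directed clique complexes and their homology\<close>

text \<open>\<open>clique_simplices N Q n\<close> is the set of \<open>n\<close>-simplices, lists of length \<open>n + 1\<close>.\<close>

definition clique_simplices :: "nat \<Rightarrow> ('v, 'e) pre_digraph \<Rightarrow> nat \<Rightarrow> 'v list set" where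
  "clique_simplices N Q n = {vs. length vs = Suc n \<and> set vs \<subseteq> verts Q \<and>
     (\<forall>i j. i < j \<longrightarrow> j < length vs \<longrightarrow> vs ! i \<noteq> vs ! j \<and> num_edges Q (vs ! i) (vs ! j) \<ge> N)}"

definition chain_group :: "(nat \<Rightarrow> 'v list set) \<Rightarrow> nat \<Rightarrow> ('v list \<Rightarrow>\<^sub>0 int) monoid" where
  "chain_group K n = free_Abelian_group (K n)"

definition simplex_boundary :: "'v list \<Rightarrow> 'v list \<Rightarrow>\<^sub>0 int" where
  "simplex_boundary vs =
     (if length vs \<le> 1 then 0
      else \<Sum>i<length vs. frag_cmul ((-1) ^ i) (frag_of (take i vs @ drop (Suc i) vs)))"

definition boundary :: "('v list \<Rightarrow>\<^sub>0 int) \<Rightarrow> ('v list \<Rightarrow>\<^sub>0 int)" where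
  "boundary = frag_extend simplex_boundary"

definition cycles :: "(nat \<Rightarrow> 'v list set) \<Rightarrow> nat \<Rightarrow> ('v list \<Rightarrow>\<^sub>0 int) set" where
  "cycles K n = {c \<in> carrier (chain_group K n). boundary c = 0}"

definition boundaries :: "(nat \<Rightarrow> 'v list set) \<Rightarrow> nat \<Rightarrow> ('v list \<Rightarrow>\<^sub>0 int) set" where
  "boundaries K n = boundary ` carrier (chain_group K (Suc n))"

text \<open>The rank of an abelian group: the supremum of the sizes of its finite \<open>\<int>\<close>-linearly independent
  subsets. It is finite for all groups considered below.\<close>

definition independent_in :: "('a, 'b) monoid_scheme \<Rightarrow> 'a set \<Rightarrow> bool" where
  "independent_in G A \<longleftrightarrow> finite A \<and> A \<subseteq> carrier G \<and>
     (\<forall>c :: 'a \<Rightarrow> int. finprod G (\<lambda>a. a [^]\<^bsub>G\<^esub> c a) A = \<one>\<^bsub>G\<^esub> \<longrightarrow> (\<forall>a\<in>A. c a = 0))"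

definition group_rank :: "('a, 'b) monoid_scheme \<Rightarrow> enat" where
  "group_rank G = (SUP A \<in> {A. independent_in G A}. enat (card A))"


section \<open>The stillborn matrix\<close>

definition filtration_of :: "(nat \<Rightarrow> 'a set) \<Rightarrow> nat \<Rightarrow> 'a set \<Rightarrow> bool" where
  "filtration_of S m A \<longleftrightarrow> (\<forall>j<m. S j \<subseteq> S (Suc j)) \<and> S m \<subseteq> A"

definition stillborn_number :: "(nat \<Rightarrow> nat \<Rightarrow> 'v list set) \<Rightarrow> nat \<Rightarrow> nat \<Rightarrow> enat" where
  "stillborn_number K i j =
     (let B = boundaries (K j) i; Z = (if j = 0 then {0} else cycles (K (j - 1)) i)
      in group_rank (((chain_group (K j) i)\<lparr>carrier := B\<rparr>) Mod (B \<inter> Z)))"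

definition stillborn_matrix ::
  "nat \<Rightarrow> diagram \<Rightarrow> 'x set \<Rightarrow> ('x \<Rightarrow> 'x \<Rightarrow> 'x) \<Rightarrow> ('x \<Rightarrow> 'x \<Rightarrow> 'x) \<Rightarrow> (nat \<Rightarrow> ('x \<Rightarrow> 'x) set) \<Rightarrow> nat
   \<Rightarrow> nat \<times> nat \<Rightarrow> enat" where
  "stillborn_matrix N D X ut ot S m =
     (\<lambda>(i, j) \<in> UNIV \<times> {..m}.
        stillborn_number (\<lambda>l. clique_simplices N (coloring_quiver X ut ot (S l) D)) i j)"

end

theory Submission
  imports Defs
begin

text \<open>
  The stillborn matrix only depends on the coloring quivers up to simultaneous isomorphism, so it
  suffices to find, for every elementary step, a bijection between the sets of colorings that commutes
  with the action of the endomorphisms. A coloring is viewed as a locally constant function on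
  the circles minus the classical crossings. Two colorings correspond if they agree outside the disc of
  the move; this relation is equivariant, and it is a bijection as soon as the colors on the boundary
  of the disc can be extended over the disc in the same cases, and then uniquely, before and after the
  move. For R1 this is the bijectivity of the diagonal map, for R2 the invertibility of the maps of
  axiom (2), and for R3 the exchange laws, once all orientations are reduced to one by means of R2.
\<close>

section \<open>Ranks of isomorphic groups\<close>

text \<open>A move merges, splits or creates semi-arcs, so colorings before and after it are
  functions on different sets. As functions of the circle parameter they share one domain, which no
  move in a disc touches. An endomorphism acts on values only, so a correspondence defined by
  equality of values is equivariant at once. Inside the disc every strand is cut at two parameters;
  a coloring then amounts to three colors per strand, subject to one relation per classical
  crossing. A move becomes a comparison of two finite systems with the same outer colors. Since the
  Jacobian of \<phi> is positive, the signs in these systems can be computed once from the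
  polynomial model arcs, and the direction of each strand stays a Boolean parameter, so no list of
  oriented moves is needed. Going back to the whole diagram is a gluing problem: near the ends of
  the strands there must be a collar on which the old and the new coloring agree. Finiteness of
  \<open>X\<close> enters through the diagonal map: axiom (2) makes it injective, and finiteness
  turns this into bijectivity.\<close>

lemma hom_finprod_group:
  assumes "comm_group G" "comm_group H" "h \<in> hom G H" "finite A" "f \<in> A \<rightarrow> carrier G"
  shows "h (finprod G f A) = finprod H (\<lambda>a. h (f a)) A"
proof -
  interpret G: comm_group G by fact
  interpret H: comm_group H by fact
  interpret group_hom G H h
    using assms by (simp add: group_hom_def group_hom_axioms_def G.group_axioms H.group_axioms)
  show ?thesis using assms(4,5)
  proof (induction A rule: finite_induct)
    case (insert a A)
    then show ?case
      by (subst G.finprod_insert, (auto)[4], subst H.finprod_insert) (auto simp: Pi_iff)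
  qed simp
qed

lemma independent_in_image:
  assumes "comm_group G" "comm_group H" "h \<in> hom G H" "inj_on h (carrier G)" "independent_in G A"
  shows "independent_in H (h ` A)"
proof -
  interpret G: comm_group G by fact
  interpret H: comm_group H by fact
  interpret group_hom G H h
    using assms by (simp add: group_hom_def group_hom_axioms_def G.group_axioms H.group_axioms)
  have A: "finite A" "A \<subseteq> carrier G"
    using assms(5) by (auto simp: independent_in_def)
  have inj: "inj_on h A" using assms(4) A(2) by (rule inj_on_subset)
  show ?thesis unfolding independent_in_def
  proof (intro conjI allI impI)
    fix c :: "_ \<Rightarrow> int"
    assume c: "finprod H (\<lambda>a. a [^]\<^bsub>H\<^esub> c a) (h ` A) = \<one>\<^bsub>H\<^esub>"
    have "finprod H (\<lambda>a. a [^]\<^bsub>H\<^esub> c a) (h ` A) = finprod H (\<lambda>a. h a [^]\<^bsub>H\<^esub> c (h a)) A"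
      using A inj by (intro H.finprod_reindex) auto
    also have "\<dots> = finprod H (\<lambda>a. h (a [^]\<^bsub>G\<^esub> c (h a))) A"
      using A by (intro H.finprod_cong') (auto simp: hom_int_pow)
    also have "\<dots> = h (finprod G (\<lambda>a. a [^]\<^bsub>G\<^esub> c (h a)) A)"
      using A by (intro hom_finprod_group[symmetric] assms) auto
    finally have "h (finprod G (\<lambda>a. a [^]\<^bsub>G\<^esub> c (h a)) A) = h \<one>\<^bsub>G\<^esub>"
      using c by simp
    then have "finprod G (\<lambda>a. a [^]\<^bsub>G\<^esub> c (h a)) A = \<one>\<^bsub>G\<^esub>"
      by (rule inj_onD[OF assms(4)]) (use A in \<open>auto intro!: G.finprod_closed\<close>)
    then have "\<forall>a\<in>A. c (h a) = 0"
      using assms(5)[unfolded independent_in_def, THEN conjunct2, THEN conjunct2, rule_format, of "\<lambda>a. c (h a)"]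
      by blast
    then show "\<forall>a\<in>h ` A. c a = 0" by blast
  qed (use A in auto)
qed

text \<open>An embedding carries independent sets to independent sets of the same size. Used for an
  isomorphism and its inverse, this gives equality of ranks without bases and without knowing that
  the ranks are finite.\<close>

lemma group_rank_mono:
  assumes "comm_group G" "comm_group H" "h \<in> hom G H" "inj_on h (carrier G)"
  shows "group_rank G \<le> group_rank H"
  unfolding group_rank_def
proof (rule SUP_least)
  fix A assume "A \<in> {A. independent_in G A}"
  then have A: "independent_in G A" by simp
  have "card (h ` A) = card A"
    using A assms(4) by (intro card_image) (auto simp: independent_in_def intro: inj_on_subset)
  then show "enat (card A) \<le> (SUP A\<in>{A. independent_in H A}. enat (card A))"
    using independent_in_image[OF assms A] by (metis SUP_upper mem_Collect_eq)
qed

lemma group_rank_iso: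
  assumes "comm_group G" "comm_group H" "h \<in> iso G H"
  shows "group_rank G = group_rank H"
proof (rule antisym)
  have inv: "inv_into (carrier G) h \<in> iso H G"
    using assms by (simp add: group.iso_set_sym comm_group.axioms(2))
  show "group_rank G \<le> group_rank H"
    using assms by (intro group_rank_mono) (auto simp: iso_def bij_betw_def)
  show "group_rank H \<le> group_rank G"
    using assms inv by (intro group_rank_mono[of H G "inv_into (carrier G) h"]) (auto simp: iso_def bij_betw_def)
qed

section \<open>Stillborn numbers of isomorphic complexes\<close>

text \<open>All chain groups over one vertex type have the same addition; once the carrier is
  replaced, the complex and the degree no longer matter. Subgroups are therefore described as plain
  sets of chains.\<close>

definition additive_subgroup :: "('v \<Rightarrow>\<^sub>0 int) set \<Rightarrow> bool" where
  "additive_subgroup B \<longleftrightarrow> 0 \<in> B \<and> (\<forall>x\<in>B. \<forall>y\<in>B. x + y \<in> B) \<and> (\<forall>x\<in>B. - x \<in> B)"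

lemma comm_group_additive_subgroup:
  assumes "additive_subgroup B"
  shows "comm_group ((chain_group K n)\<lparr>carrier := B\<rparr>)"
proof (rule comm_groupI)
  fix x assume "x \<in> carrier ((chain_group K n)\<lparr>carrier := B\<rparr>)"
  with assms show "\<exists>y\<in>carrier ((chain_group K n)\<lparr>carrier := B\<rparr>).
      y \<otimes>\<^bsub>(chain_group K n)\<lparr>carrier := B\<rparr>\<^esub> x = \<one>\<^bsub>(chain_group K n)\<lparr>carrier := B\<rparr>\<^esub>"
    by (intro bexI[of _ "- x"]) (auto simp: additive_subgroup_def chain_group_def free_Abelian_group_def)
qed (use assms in \<open>auto simp: additive_subgroup_def chain_group_def free_Abelian_group_def add_ac\<close>)

lemma inv_additive_subgroup:
  assumes "additive_subgroup B" "x \<in> B"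
  shows "inv\<^bsub>(chain_group K n)\<lparr>carrier := B\<rparr>\<^esub> x = - x"
proof -
  interpret comm_group "(chain_group K n)\<lparr>carrier := B\<rparr>"
    by (rule comm_group_additive_subgroup) fact
  show ?thesis
    by (rule inv_equality)
      (use assms in \<open>auto simp: additive_subgroup_def chain_group_def free_Abelian_group_def\<close>)
qed

lemma subgroup_additive_subgroup:
  assumes "additive_subgroup B" "additive_subgroup N" "N \<subseteq> B"
  shows "subgroup N ((chain_group K n)\<lparr>carrier := B\<rparr>)"
  using assms(2,3) inv_additive_subgroup[OF assms(1)]
  by unfold_locales
    (auto simp: additive_subgroup_def subset_iff, auto simp: chain_group_def free_Abelian_group_def)

text \<open>First isomorphism theorem for \<Psi> followed by the projection modulo the image of
  \<open>N\<close>. Additivity is global, but injectivity is asked only on \<open>B\<close>, because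
  a map of vertices will be injective only on the vertices of the complexes.\<close>

lemma group_rank_Mod_image:
  assumes B: "additive_subgroup B" and N: "additive_subgroup N" "N \<subseteq> B"
    and \<Psi>: "\<And>x y. \<Psi> (x + y) = \<Psi> x + \<Psi> y" "inj_on \<Psi> B"
  shows "group_rank ((chain_group K n)\<lparr>carrier := B\<rparr> Mod N) =
         group_rank ((chain_group K' n)\<lparr>carrier := \<Psi> ` B\<rparr> Mod (\<Psi> ` N))"
proof -
  let ?G = "(chain_group K n)\<lparr>carrier := B\<rparr>" and ?H = "(chain_group K' n)\<lparr>carrier := \<Psi> ` B\<rparr>"
  have \<Psi>0: "\<Psi> 0 = 0" using \<Psi>(1)[of 0 0] by simp
  have \<Psi>m: "\<Psi> (- x) = - \<Psi> x" for x
    using \<Psi>(1)[of x "- x"] \<Psi>0 by (simp add: eq_neg_iff_add_eq_0 add.commute)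
  have img: "additive_subgroup (\<Psi> ` C)" if "additive_subgroup C" for C
    unfolding additive_subgroup_def
  proof (intro conjI ballI)
    show "0 \<in> \<Psi> ` C" using that \<Psi>0 by (auto simp: additive_subgroup_def image_iff intro!: bexI[of _ 0])
  next
    fix x y assume "x \<in> \<Psi> ` C" "y \<in> \<Psi> ` C"
    then show "x + y \<in> \<Psi> ` C" using that \<Psi>(1) by (auto simp: additive_subgroup_def simp flip: \<Psi>(1))
  next
    fix x assume "x \<in> \<Psi> ` C"
    then show "- x \<in> \<Psi> ` C" using that by (auto simp: additive_subgroup_def simp flip: \<Psi>m)
  qed
  interpret G: comm_group ?G by (rule comm_group_additive_subgroup) fact
  interpret H: comm_group ?H by (rule comm_group_additive_subgroup) (rule img[OF B])
  have N': "subgroup (\<Psi> ` N) ?H"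
    using img B N by (intro subgroup_additive_subgroup) auto
  interpret nH: normal "\<Psi> ` N" ?H using N' by (rule H.subgroup_imp_normal)
  have NG: "subgroup N ?G" using B N by (intro subgroup_additive_subgroup) auto
  define h where "h x = \<Psi> ` N #>\<^bsub>?H\<^esub> \<Psi> x" for x
  have hom\<Psi>: "\<Psi> \<in> hom ?G ?H"
    using \<Psi>(1) by (auto simp: hom_def chain_group_def free_Abelian_group_def)
  have h: "h \<in> hom ?G (?H Mod \<Psi> ` N)"
    using hom_compose[OF hom\<Psi> nH.r_coset_hom_Mod] by (simp add: h_def[abs_def] comp_def)
  interpret gh: group_hom ?G "?H Mod \<Psi> ` N" h
    using h by (simp add: group_hom_def group_hom_axioms_def G.group_axioms nH.factorgroup_is_group)
  have "kernel ?G (?H Mod \<Psi> ` N) h = N"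
  proof -
    have "h x = \<Psi> ` N \<longleftrightarrow> x \<in> N" if "x \<in> B" for x
    proof -
      have "h x = \<Psi> ` N \<longleftrightarrow> \<Psi> x \<in> \<Psi> ` N"
        unfolding h_def using N' that
        using H.coset_join1[OF _ _ N', of "\<Psi> x"] H.coset_join2[OF _ N', of "\<Psi> x"] by auto
      also have "\<dots> \<longleftrightarrow> x \<in> N"
        using \<Psi>(2) that N(2) by (auto simp: inj_on_def)
      finally show ?thesis .
    qed
    then show ?thesis using N by (auto simp: kernel_def)
  qed
  moreover have "h ` carrier ?G = carrier (?H Mod \<Psi> ` N)"
    by (auto simp: carrier_FactGroup h_def)
  ultimately have "(\<lambda>X. the_elem (h ` X)) \<in> iso (?G Mod N) (?H Mod \<Psi> ` N)"
    using gh.FactGroup_iso_set by simp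
  then show ?thesis
    by (intro group_rank_iso G.abelian_FactGroup H.abelian_FactGroup N' NG)
qed

section \<open>Chains, cycles and boundaries under a map of vertices\<close>

definition chain_map :: "('v \<Rightarrow> 'w) \<Rightarrow> ('v list \<Rightarrow>\<^sub>0 int) \<Rightarrow> ('w list \<Rightarrow>\<^sub>0 int)" where
  "chain_map \<psi> = frag_extend (\<lambda>vs. frag_of (map \<psi> vs))"

lemma chain_map_add: "chain_map \<psi> (x + y) = chain_map \<psi> x + chain_map \<psi> y"
  by (simp add: chain_map_def frag_extend_add)

lemma chain_map_0: "chain_map \<psi> 0 = 0"
  by (simp add: chain_map_def)

text \<open>Stated relative to a vertex set \<open>V\<close> so that
  \<open>inv_into V \<psi>\<close> can serve as \<phi>: this yields injectivity on chains over
  \<open>V\<close>, and, with the roles exchanged, surjectivity onto the chains of the image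
  complex.\<close>

lemma chain_map_comp:
  assumes "Poly_Mapping.keys c \<subseteq> lists V" "\<And>v. v \<in> V \<Longrightarrow> \<phi> (\<psi> v) = v"
  shows "chain_map \<phi> (chain_map \<psi> c) = c"
proof -
  show ?thesis using assms(1)
  proof (induction c rule: frag_induction)
    case (one vs)
    then have "map (\<phi> \<circ> \<psi>) vs = vs" using assms(2) by (auto intro!: map_idI)
    then show ?case by (simp add: chain_map_def)
  next
    case (diff a b)
    then show ?case by (simp add: chain_map_def frag_extend_diff)
  qed (simp add: chain_map_0)
qed

lemma inj_on_chain_map:
  assumes "inj_on \<psi> V"
  shows "inj_on (chain_map \<psi>) {c. Poly_Mapping.keys c \<subseteq> lists V}"
  by (rule inj_on_inverseI[of _ "chain_map (inv_into V \<psi>)"])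
    (use assms in \<open>auto intro!: chain_map_comp[where V = V] simp: inv_into_f_f\<close>)

text \<open>Deleting the i-th entry commutes with \<open>map \<psi>\<close>. This is an identity of
  lists, so it holds for every \<psi>; the induction runs over all finite combinations of
  lists.\<close>

lemma boundary_chain_map: "boundary (chain_map \<psi> c) = chain_map \<psi> (boundary c)"
proof -
  have sb: "simplex_boundary (map \<psi> vs) = chain_map \<psi> (simplex_boundary vs)" for vs
    by (auto simp: simplex_boundary_def chain_map_def frag_extend_sum o_def frag_extend_cmul
        take_map drop_map)
  have "Poly_Mapping.keys c \<subseteq> UNIV \<Longrightarrow> ?thesis"
  proof (induction c rule: frag_induction)
    case (one vs)
    then show ?case by (simp add: boundary_def sb[unfolded chain_map_def] chain_map_def)
  next
    case (diff a b)
    then show ?case by (simp add: boundary_def chain_map_def frag_extend_diff)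
  qed (simp add: chain_map_def boundary_def)
  then show ?thesis by simp
qed

lemma chain_map_carrier:
  assumes "inj_on \<psi> V" "K n \<subseteq> lists V" "K' n = map \<psi> ` K n"
  shows "chain_map \<psi> ` carrier (chain_group K n) = carrier (chain_group K' n)"
proof
  have keys: "Poly_Mapping.keys (chain_map \<phi> c) \<subseteq> map \<phi> ` Poly_Mapping.keys c" 
    for \<phi> :: "'c \<Rightarrow> 'd" and c
    unfolding chain_map_def using keys_frag_extend[of "\<lambda>vs. frag_of (map \<phi> vs)" c] by auto
  show "chain_map \<psi> ` carrier (chain_group K n) \<subseteq> carrier (chain_group K' n)"
  proof
    fix d assume "d \<in> chain_map \<psi> ` carrier (chain_group K n)"
    then obtain c where c: "d = chain_map \<psi> c" "Poly_Mapping.keys c \<subseteq> K n"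
      by (auto simp: chain_group_def)
    have "Poly_Mapping.keys d \<subseteq> map \<psi> ` K n"
      unfolding c(1) using keys[of \<psi> c] image_mono[OF c(2)] by (rule order_trans)
    then show "d \<in> carrier (chain_group K' n)" by (simp add: chain_group_def assms(3))
  qed
  show "carrier (chain_group K' n) \<subseteq> chain_map \<psi> ` carrier (chain_group K n)"
  proof
    fix c assume "c \<in> carrier (chain_group K' n)"
    then have c: "Poly_Mapping.keys c \<subseteq> map \<psi> ` K n" using assms by (simp add: chain_group_def)
    let ?\<phi> = "inv_into V \<psi>"
    have "map ?\<phi> (map \<psi> vs) = vs" if "vs \<in> K n" for vs
      using that assms(1,2) by (auto intro!: map_idI)
    then have "map ?\<phi> ` map \<psi> ` K n = K n" by (force simp del: map_map)
    then have 1: "Poly_Mapping.keys (chain_map ?\<phi> c) \<subseteq> K n"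
      using keys[of ?\<phi> c] c by blast
    have "Poly_Mapping.keys c \<subseteq> lists (\<psi> ` V)" using c assms(2) by fastforce
    then have "chain_map \<psi> (chain_map ?\<phi> c) = c"
      by (rule chain_map_comp) (simp add: f_inv_into_f)
    with 1 show "c \<in> chain_map \<psi> ` carrier (chain_group K n)"
      by (metis carrier_free_Abelian_group_iff chain_group_def imageI)
  qed
qed

lemma chain_map_boundaries:
  assumes "inj_on \<psi> V" "K (Suc n) \<subseteq> lists V" "K' (Suc n) = map \<psi> ` K (Suc n)"
  shows "chain_map \<psi> ` boundaries K n = boundaries K' n"
  unfolding boundaries_def chain_map_carrier[of \<psi> V K "Suc n" K', OF assms, symmetric]
  by (simp add: image_image boundary_chain_map)

text \<open>Tracks only that the entries stay in \<open>V\<close>, which is what injectivity of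
  \<open>chain_map\<close> on boundaries requires.\<close>

lemma keys_boundary:
  assumes "Poly_Mapping.keys c \<subseteq> lists V"
  shows "Poly_Mapping.keys (boundary c) \<subseteq> lists V"
proof -
  have "Poly_Mapping.keys (simplex_boundary vs) \<subseteq> lists V" if "vs \<in> lists V" for vs
  proof -
    have "Poly_Mapping.keys (frag_cmul ((-1) ^ i) (frag_of (take i vs @ drop (Suc i) vs))) \<subseteq> lists V" for i :: nat
      using that keys_cmul[of "(-1) ^ i" "frag_of (take i vs @ drop (Suc i) vs)"]
      by (fastforce dest: in_set_takeD in_set_dropD)
    then show ?thesis unfolding simplex_boundary_def
      using keys_sum[of "\<lambda>i. frag_cmul ((-1) ^ i) (frag_of (take i vs @ drop (Suc i) vs))" "{..<length vs}"]
      by (auto split: if_splits) blast+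
  qed
  then show ?thesis
    unfolding boundary_def using keys_frag_extend[of simplex_boundary c] assms by blast
qed

lemma chain_map_cycles:
  assumes "inj_on \<psi> V" "K n \<subseteq> lists V" "K' n = map \<psi> ` K n"
  shows "chain_map \<psi> ` cycles K n = cycles K' n"
proof -
  have "boundary (chain_map \<psi> c) = 0 \<longleftrightarrow> boundary c = 0" if "c \<in> carrier (chain_group K n)" for c
  proof
    assume "boundary (chain_map \<psi> c) = 0"
    then have "chain_map \<psi> (boundary c) = chain_map \<psi> 0"
      by (simp add: boundary_chain_map chain_map_0)
    moreover have "Poly_Mapping.keys (boundary c) \<subseteq> lists V"
      using that assms(2) by (intro keys_boundary) (auto simp: chain_group_def)
    ultimately show "boundary c = 0"
      using inj_on_chain_map[OF assms(1)] by (auto simp: inj_on_def)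
  qed (simp add: boundary_chain_map chain_map_0)
  then show ?thesis
    unfolding cycles_def chain_map_carrier[of \<psi> V K n K', OF assms, symmetric] by auto
qed

lemma additive_subgroup_chains:
  "additive_subgroup (boundaries K n)" "additive_subgroup (cycles K n)"
proof -
  have car: "additive_subgroup (carrier (chain_group K n))" for n
    unfolding additive_subgroup_def chain_group_def carrier_free_Abelian_group_iff
    by (auto dest!: subsetD[OF keys_add])
  have b: "boundary (x + y) = boundary x + boundary y" "boundary (- x) = - boundary x" "boundary 0 = 0" for x y :: "'a list \<Rightarrow>\<^sub>0 int"
    by (simp_all add: boundary_def frag_extend_add frag_extend_minus)
  show "additive_subgroup (cycles K n)"
    using car[of n] by (auto simp: additive_subgroup_def cycles_def b)
  show "additive_subgroup (boundaries K n)"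
    using car[of "Suc n"] unfolding additive_subgroup_def boundaries_def
    by (auto simp flip: b(1,2)) (metis b(3) imageI)
qed

text \<open>One and the same \<psi> must serve stages \<open>j\<close> and \<open>j - 1\<close>,
  since the number compares boundaries at one stage with cycles at the other.\<close>

lemma stillborn_number_map:
  assumes \<psi>: "inj_on \<psi> V" and K: "\<And>l n. l \<le> j \<Longrightarrow> K l n \<subseteq> lists V"
    and K': "\<And>l n. l \<le> j \<Longrightarrow> K' l n = map \<psi> ` K l n"
  shows "stillborn_number K i j = stillborn_number K' i j"
proof -
  define Z where "Z = (if j = 0 then {0} else cycles (K (j - 1)) i)"
  define Z' where "Z' = (if j = 0 then {0} else cycles (K' (j - 1)) i)"
  let ?B = "boundaries (K j) i"
  have keysB: "?B \<subseteq> {c. Poly_Mapping.keys c \<subseteq> lists V}"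
    unfolding boundaries_def chain_group_def
  proof (rule image_subsetI)
    fix c assume "c \<in> carrier (free_Abelian_group (K j (Suc i)))"
    then have "Poly_Mapping.keys c \<subseteq> lists V" using K[of j "Suc i"] by simp
    then show "boundary c \<in> {c. Poly_Mapping.keys c \<subseteq> lists V}" by (simp add: keys_boundary)
  qed
  have keysZ: "Z \<subseteq> {c. Poly_Mapping.keys c \<subseteq> lists V}"
    using K[of "j - 1" i] by (auto simp: Z_def cycles_def chain_group_def)
  \<comment> \<open>Injectivity on the union, not just on each of the two sets, makes the image
    commute with the intersection.\<close>
  have inj: "inj_on (chain_map \<psi>) (?B \<union> Z)"
    by (rule inj_on_subset[OF inj_on_chain_map[OF \<psi>]]) (use keysB keysZ in blast)
  have imB: "chain_map \<psi> ` ?B = boundaries (K' j) i"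
    using assms by (intro chain_map_boundaries) auto
  have imZ: "chain_map \<psi> ` Z = Z'"
    using chain_map_cycles[of \<psi> V "K (j - 1)" i "K' (j - 1)"] assms
    by (simp add: Z_def Z'_def chain_map_0)
  have imBZ: "chain_map \<psi> ` (?B \<inter> Z) = boundaries (K' j) i \<inter> Z'"
    using inj_on_image_Int[OF inj, of ?B Z] imB imZ by auto
  have Z: "additive_subgroup Z"
    using additive_subgroup_chains(2)[of "K (j - 1)" i] by (simp add: Z_def) (simp add: additive_subgroup_def)
  have "additive_subgroup (?B \<inter> Z)"
    using Z additive_subgroup_chains(1)[of "K j" i] by (auto simp: additive_subgroup_def)
  then have "group_rank ((chain_group (K j) i)\<lparr>carrier := ?B\<rparr> Mod (?B \<inter> Z)) =
      group_rank ((chain_group (K' j) i)\<lparr>carrier := chain_map \<psi> ` ?B\<rparr> Mod (chain_map \<psi> ` (?B \<inter> Z)))"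
    using inj by (intro group_rank_Mod_image additive_subgroup_chains chain_map_add)
      (auto intro: inj_on_subset)
  then show ?thesis
    unfolding stillborn_number_def Let_def imB imBZ Z_def[symmetric] Z'_def[symmetric] .
qed

section \<open>Equivariant bijections between sets of colorings\<close>

text \<open>The bijection commutes with all of \<open>End\<close>, not just with one set of
  endomorphisms, so that it identifies the quivers of all stages at the same time.\<close>

definition coloring_equivalent ::
  "'x set \<Rightarrow> ('x \<Rightarrow> 'x \<Rightarrow> 'x) \<Rightarrow> ('x \<Rightarrow> 'x \<Rightarrow> 'x) \<Rightarrow> diagram \<Rightarrow> diagram \<Rightarrow> bool" where
  "coloring_equivalent X ut ot D E \<longleftrightarrow>
     (\<exists>\<psi>. bij_betw \<psi> (Col X ut ot D) (Col X ut ot E) \<and>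
       (\<forall>f\<in>Col X ut ot D. \<forall>\<alpha>\<in>End X ut ot.
          \<psi> (compose (semi_arcs D) \<alpha> f) = compose (semi_arcs E) \<alpha> (\<psi> f)))"

text \<open>A move naturally gives a relation \<open>T\<close> between colorings (agreement away
  from the move). If \<open>T\<close> is total and single-valued in both directions it is the graph
  of a bijection, and equivariance of the relation passes to that bijection.\<close>

lemma coloring_equivalentI:
  assumes "\<And>f. f \<in> Col X ut ot D \<Longrightarrow> \<exists>g\<in>Col X ut ot E. T f g"
    and "\<And>g. g \<in> Col X ut ot E \<Longrightarrow> \<exists>f\<in>Col X ut ot D. T f g"
    and "\<And>f g g'. f \<in> Col X ut ot D \<Longrightarrow> g \<in> Col X ut ot E \<Longrightarrow> g' \<in> Col X ut ot E \<Longrightarrow>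
      T f g \<Longrightarrow> T f g' \<Longrightarrow> g = g'"
    and "\<And>f f' g. f \<in> Col X ut ot D \<Longrightarrow> f' \<in> Col X ut ot D \<Longrightarrow> g \<in> Col X ut ot E \<Longrightarrow>
      T f g \<Longrightarrow> T f' g \<Longrightarrow> f = f'"
    and "\<And>f g \<alpha>. f \<in> Col X ut ot D \<Longrightarrow> g \<in> Col X ut ot E \<Longrightarrow> \<alpha> \<in> End X ut ot \<Longrightarrow> T f g \<Longrightarrow>
      T (compose (semi_arcs D) \<alpha> f) (compose (semi_arcs E) \<alpha> g)"
    and D: "\<And>f \<alpha>. f \<in> Col X ut ot D \<Longrightarrow> \<alpha> \<in> End X ut ot \<Longrightarrow> compose (semi_arcs D) \<alpha> f \<in> Col X ut ot D"
    and E: "\<And>f \<alpha>. f \<in> Col X ut ot E \<Longrightarrow> \<alpha> \<in> End X ut ot \<Longrightarrow> compose (semi_arcs E) \<alpha> f \<in> Col X ut ot E"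
  shows "coloring_equivalent X ut ot D E"
proof -
  define \<psi> where "\<psi> f = (SOME g. g \<in> Col X ut ot E \<and> T f g)" for f
  have \<psi>: "\<psi> f \<in> Col X ut ot E" "T f (\<psi> f)" if "f \<in> Col X ut ot D" for f
    using someI_ex[OF assms(1)[OF that, unfolded Bex_def]] by (auto simp: \<psi>_def)
  have eq: "\<psi> f = g" if "f \<in> Col X ut ot D" "g \<in> Col X ut ot E" "T f g" for f g
    using that \<psi> assms(3) by blast
  have "bij_betw \<psi> (Col X ut ot D) (Col X ut ot E)"
  proof (rule bij_betw_imageI)
    show "inj_on \<psi> (Col X ut ot D)" using \<psi> assms(4) unfolding inj_on_def by metis
    show "\<psi> ` Col X ut ot D = Col X ut ot E" using \<psi>(1) assms(2) eq by blast
  qed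
  moreover have "\<psi> (compose (semi_arcs D) \<alpha> f) = compose (semi_arcs E) \<alpha> (\<psi> f)"
    if "f \<in> Col X ut ot D" "\<alpha> \<in> End X ut ot" for f \<alpha>
    using that by (intro eq assms(5) \<psi> D E)
  ultimately show ?thesis unfolding coloring_equivalent_def by blast
qed

lemma coloring_equivalent_refl: "coloring_equivalent X ut ot D D"
  unfolding coloring_equivalent_def by (intro exI[of _ id]) auto

lemma coloring_equivalent_trans:
  assumes "coloring_equivalent X ut ot D E" "coloring_equivalent X ut ot E F"
  shows "coloring_equivalent X ut ot D F"
proof -
  obtain \<psi> \<phi> where \<psi>: "bij_betw \<psi> (Col X ut ot D) (Col X ut ot E)"
      "\<And>f \<alpha>. f\<in>Col X ut ot D \<Longrightarrow> \<alpha>\<in>End X ut ot \<Longrightarrow>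
          \<psi> (compose (semi_arcs D) \<alpha> f) = compose (semi_arcs E) \<alpha> (\<psi> f)"
    and \<phi>: "bij_betw \<phi> (Col X ut ot E) (Col X ut ot F)"
      "\<And>f \<alpha>. f\<in>Col X ut ot E \<Longrightarrow> \<alpha>\<in>End X ut ot \<Longrightarrow>
          \<phi> (compose (semi_arcs E) \<alpha> f) = compose (semi_arcs F) \<alpha> (\<phi> f)"
    using assms unfolding coloring_equivalent_def by metis
  show ?thesis unfolding coloring_equivalent_def
    by (intro exI[of _ "\<phi> \<circ> \<psi>"] conjI bij_betw_trans[OF \<psi>(1) \<phi>(1)])
      (use \<psi>(2) \<phi>(2) bij_betwE[OF \<psi>(1)] in auto)
qed

section \<open>From colorings to quivers and clique complexes\<close>

lemma num_edges_coloring_quiver: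
  assumes \<psi>: "bij_betw \<psi> (Col X ut ot D) (Col X ut ot E)"
      "\<And>f \<alpha>. f\<in>Col X ut ot D \<Longrightarrow> \<alpha>\<in>S \<Longrightarrow>
          \<psi> (compose (semi_arcs D) \<alpha> f) = compose (semi_arcs E) \<alpha> (\<psi> f)"
    and D: "\<And>f \<alpha>. f \<in> Col X ut ot D \<Longrightarrow> \<alpha> \<in> S \<Longrightarrow> compose (semi_arcs D) \<alpha> f \<in> Col X ut ot D"
    and fg: "f \<in> Col X ut ot D" "g \<in> Col X ut ot D"
  shows "num_edges (coloring_quiver X ut ot S E) (\<psi> f) (\<psi> g) = num_edges (coloring_quiver X ut ot S D) f g"
proof -
  have 1: "{e \<in> arcs (coloring_quiver X ut ot S D). arc_to_ends (coloring_quiver X ut ot S D) e = (f, g)}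
      = {f} \<times> {\<alpha> \<in> S. compose (semi_arcs D) \<alpha> f = g}"
    using fg by (auto simp: coloring_quiver_def arc_to_ends_def)
  have 2: "{e \<in> arcs (coloring_quiver X ut ot S E). arc_to_ends (coloring_quiver X ut ot S E) e = (\<psi> f, \<psi> g)}
      = {\<psi> f} \<times> {\<alpha> \<in> S. compose (semi_arcs E) \<alpha> (\<psi> f) = \<psi> g}"
    using fg \<psi>(1) by (auto simp: coloring_quiver_def arc_to_ends_def bij_betw_def)
  \<comment> \<open>With the source fixed an edge is the same as its label \<alpha>. Cancelling
    \<psi> requires the composite on the right to be a coloring of \<open>D\<close>, which is the
    closure assumption.\<close>
  have "compose (semi_arcs E) \<alpha> (\<psi> f) = \<psi> g \<longleftrightarrow> compose (semi_arcs D) \<alpha> f = g" if "\<alpha> \<in> S" for \<alpha>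
    using inj_on_eq_iff[OF bij_betw_imp_inj_on[OF \<psi>(1)] D[OF fg(1) that] fg(2)] \<psi>(2)[OF fg(1) that] by simp
  then show ?thesis
    unfolding num_edges_def 1 2 by (auto simp: card_cartesian_product cong: conj_cong)
qed

lemma clique_simplices_map:
  assumes \<psi>: "bij_betw \<psi> (verts Q) (verts Q')"
    and e: "\<And>u v. u \<in> verts Q \<Longrightarrow> v \<in> verts Q \<Longrightarrow> num_edges Q' (\<psi> u) (\<psi> v) = num_edges Q u v"
  shows "clique_simplices N Q' n = map \<psi> ` clique_simplices N Q n"
proof -
  have *: "map \<psi> vs \<in> clique_simplices N Q' n \<longleftrightarrow> vs \<in> clique_simplices N Q n"
    if "set vs \<subseteq> verts Q" for vs
  proof -
    have "\<psi> (vs ! i) = \<psi> (vs ! j) \<longleftrightarrow> vs ! i = vs ! j"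
      "num_edges Q' (\<psi> (vs ! i)) (\<psi> (vs ! j)) = num_edges Q (vs ! i) (vs ! j)"
      if "i < length vs" "j < length vs" for i j
    proof -
      have "vs ! i \<in> verts Q" "vs ! j \<in> verts Q" using that \<open>set vs \<subseteq> verts Q\<close> by auto
      then show "\<psi> (vs ! i) = \<psi> (vs ! j) \<longleftrightarrow> vs ! i = vs ! j"
        "num_edges Q' (\<psi> (vs ! i)) (\<psi> (vs ! j)) = num_edges Q (vs ! i) (vs ! j)"
        using e bij_betw_imp_inj_on[OF \<psi>] by (auto dest: inj_onD)
    qed
    moreover have "set (map \<psi> vs) \<subseteq> verts Q'" using that \<psi> by (auto simp: bij_betw_def)
    ultimately show ?thesis using that by (auto simp: clique_simplices_def)
  qed
  show ?thesis
  proof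
    show "clique_simplices N Q' n \<subseteq> map \<psi> ` clique_simplices N Q n"
    proof
      fix ws assume ws: "ws \<in> clique_simplices N Q' n"
      then have "ws \<in> lists (\<psi> ` verts Q)" using \<psi> by (auto simp: clique_simplices_def bij_betw_def)
      then obtain vs where vs: "vs \<in> lists (verts Q)" "ws = map \<psi> vs" by (auto simp: lists_image)
      then show "ws \<in> map \<psi> ` clique_simplices N Q n" using ws * by auto
    qed
    show "map \<psi> ` clique_simplices N Q n \<subseteq> clique_simplices N Q' n"
      using * by (auto simp: clique_simplices_def[of N Q])
  qed
qed

section \<open>Colorings as locally constant functions\<close>

lemma same_param_refl [simp]: "same_param p p"
  by (simp add: same_param_def)

lemma same_param_sym: "same_param p q \<Longrightarrow> same_param q p"
  unfolding same_param_def using Ints_minus[of "snd p - snd q"] by simp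

lemma same_param_trans: "same_param p q \<Longrightarrow> same_param q r \<Longrightarrow> same_param p r"
  unfolding same_param_def using Ints_add[of "snd p - snd q" "snd q - snd r"] by simp

lemma same_param_shift [simp]: "same_param (k, t) (k, t + of_int m)" "same_param (k, t + of_int m) (k, t)"
  by (simp_all add: same_param_def)

lemma same_paramE:
  assumes "same_param p q"
  obtains m :: int where "q = (fst p, snd p + of_int m)"
proof -
  from same_param_sym[OF assms] obtain m :: int where "snd q - snd p = of_int m" "fst p = fst q"
    by (auto simp: same_param_def elim: Ints_cases)
  then show ?thesis by (intro that[of m]) (auto simp: prod_eq_iff)
qed

text \<open>A point of the circle has finitely many lifts in a bounded interval; this makes the
  classical parameters locally finite.\<close>

lemma finite_shifts: "finite {s \<in> {a..b}. s - c \<in> \<int>}" for a b c :: real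
proof (rule finite_subset)
  show "{s \<in> {a..b}. s - c \<in> \<int>} \<subseteq> (\<lambda>m. c + of_int m) ` {\<lceil>a - c\<rceil>..\<lfloor>b - c\<rfloor>}"
  proof
    fix s assume "s \<in> {s \<in> {a..b}. s - c \<in> \<int>}"
    then obtain m where "s - c = of_int m" "a \<le> s" "s \<le> b" by (auto elim: Ints_cases)
    then show "s \<in> (\<lambda>m. c + of_int m) ` {\<lceil>a - c\<rceil>..\<lfloor>b - c\<rfloor>}"
      by (intro image_eqI[of _ _ m]) (auto simp: ceiling_le_iff le_floor_iff)
  qed
qed simp

definition over_at :: "diagram \<Rightarrow> param \<Rightarrow> param \<Rightarrow> bool" where
  "over_at D p q \<longleftrightarrow> crossing D p q \<and> p \<in> over D"

definition positive_at :: "diagram \<Rightarrow> param \<Rightarrow> param \<Rightarrow> bool" where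
  "positive_at D p q \<longleftrightarrow> cross (velocity D p) (velocity D q) > 0"

definition classical_of :: "(param \<Rightarrow> param \<Rightarrow> bool) \<Rightarrow> param set" where
  "classical_of Ov = {p. \<exists>q. Ov p q \<or> Ov q p}"

text \<open>The one-sided color at a crossing, phrased with filters so that it does not name the
  adjacent semi-arc, which a move may change.\<close>

definition before :: "(param \<Rightarrow> 'x) \<Rightarrow> param \<Rightarrow> 'x \<Rightarrow> bool" where
  "before F p x \<longleftrightarrow> (\<forall>\<^sub>F s in at_left (snd p). F (fst p, s) = x)"

definition after :: "(param \<Rightarrow> 'x) \<Rightarrow> param \<Rightarrow> 'x \<Rightarrow> bool" where
  "after F p x \<longleftrightarrow> (\<forall>\<^sub>F s in at_right (snd p). F (fst p, s) = x)"

lemma before_unique: "before F p x \<Longrightarrow> before F p y \<Longrightarrow> x = y"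
  unfolding before_def
  by (drule (1) eventually_conj) (auto dest!: eventually_happens'[rotated] simp: trivial_limit_at_left_real)

lemma after_unique: "after F p x \<Longrightarrow> after F p y \<Longrightarrow> x = y"
  unfolding after_def
  by (drule (1) eventually_conj) (auto dest!: eventually_happens'[rotated] simp: trivial_limit_at_right_real)

text \<open>The coloring rule in terms of incoming (\<open>ob\<close>, \<open>ub\<close>) and
  outgoing (\<open>oa\<close>, \<open>ua\<close>) colors. At a positive crossing the two right-hand
  semi-arcs are the incoming under one and the outgoing over one; at a negative crossing they are
  the other two.\<close>

definition crossing_relation ::
  "('x \<Rightarrow> 'x \<Rightarrow> 'x) \<Rightarrow> ('x \<Rightarrow> 'x \<Rightarrow> 'x) \<Rightarrow> bool \<Rightarrow> 'x \<Rightarrow> 'x \<Rightarrow> 'x \<Rightarrow> 'x \<Rightarrow> bool" where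
  "crossing_relation ut ot pos ob oa ub ua \<longleftrightarrow>
     (if pos then ua = ut ub oa \<and> ob = ot oa ub else ub = ut ua ob \<and> oa = ot ob ua)"

text \<open>A coloring seen as a function of the parameter; only the values outside the classical
  crossings, i.e. outside \<open>classical_of Ov\<close>, matter.\<close>

definition param_coloring ::
  "'x set \<Rightarrow> ('x \<Rightarrow> 'x \<Rightarrow> 'x) \<Rightarrow> ('x \<Rightarrow> 'x \<Rightarrow> 'x) \<Rightarrow> nat \<Rightarrow> (param \<Rightarrow> param \<Rightarrow> bool) \<Rightarrow>
   (param \<Rightarrow> param \<Rightarrow> bool) \<Rightarrow> (param \<Rightarrow> 'x) \<Rightarrow> bool" where
  "param_coloring X ut ot n Ov pos F \<longleftrightarrow>
     (\<forall>p. fst p < n \<longrightarrow> p \<notin> classical_of Ov \<longrightarrow> F p \<in> X) \<and>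
     (\<forall>p q. same_param p q \<longrightarrow> F p = F q) \<and>
     (\<forall>p. fst p < n \<longrightarrow> p \<notin> classical_of Ov \<longrightarrow> (\<forall>\<^sub>F s in nhds (snd p). F (fst p, s) = F p)) \<and>
     (\<forall>p q. Ov p q \<longrightarrow> (\<exists>ob oa ub ua. before F p ob \<and> after F p oa \<and> before F q ub \<and> after F q ua \<and>
        crossing_relation ut ot (pos p q) ob oa ub ua))"

lemma param_coloring_in:
  "param_coloring X ut ot n Ov pos F \<Longrightarrow> fst p < n \<Longrightarrow> p \<notin> classical_of Ov \<Longrightarrow> F p \<in> X"
  unfolding param_coloring_def by blast

lemma param_coloring_same: "param_coloring X ut ot n Ov pos F \<Longrightarrow> same_param p q \<Longrightarrow> F p = F q"
  unfolding param_coloring_def by blast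

lemma param_coloring_local:
  "param_coloring X ut ot n Ov pos F \<Longrightarrow> fst p < n \<Longrightarrow> p \<notin> classical_of Ov \<Longrightarrow>
    \<forall>\<^sub>F s in nhds (snd p). F (fst p, s) = F p"
  unfolding param_coloring_def by blast

lemma param_coloring_crossing:
  "param_coloring X ut ot n Ov pos F \<Longrightarrow> Ov p q \<Longrightarrow>
    \<exists>ob oa ub ua. before F p ob \<and> after F p oa \<and> before F q ub \<and> after F q ua \<and>
        crossing_relation ut ot (pos p q) ob oa ub ua"
  unfolding param_coloring_def by blast

abbreviation diagram_coloring ::
  "'x set \<Rightarrow> ('x \<Rightarrow> 'x \<Rightarrow> 'x) \<Rightarrow> ('x \<Rightarrow> 'x \<Rightarrow> 'x) \<Rightarrow> diagram \<Rightarrow> (param \<Rightarrow> 'x) \<Rightarrow> bool" where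
  "diagram_coloring X ut ot D F \<equiv> param_coloring X ut ot (ncomp D) (over_at D) (positive_at D) F"

lemma cross_antisym: "cross u v = - cross v u"
  by (simp add: cross_def)

lemma crossing_sym: "crossing D p q \<longleftrightarrow> crossing D q p"
  unfolding crossing_def using same_param_sym by metis

lemma classical_params_eq: "classical_params D = classical_of (over_at D)"
  unfolding classical_params_def classical_of_def over_at_def using crossing_sym by blast

lemma over_at_classical: "over_at D p q \<Longrightarrow> p \<in> classical_params D \<and> q \<in> classical_params D"
  unfolding classical_params_eq classical_of_def by blast

section \<open>Semi-arcs of one diagram and the two descriptions of its colorings\<close>

locale link_diagram =
  fixes D :: diagram
  assumes vld: "virtual_link_diagram D"
begin

lemma params_iff: "p \<in> params D \<longleftrightarrow> fst p < ncomp D"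
  by (cases p) (auto simp: params_def)

lemma curve_shift_nat: "k < ncomp D \<Longrightarrow> curve D k (t + of_nat m) = curve D k t"
proof (induction m)
  case (Suc m)
  have "curve D k (t + of_nat (Suc m)) = curve D k ((t + of_nat m) + 1)" by (simp add: algebra_simps)
  also have "\<dots> = curve D k t" using Suc vld by (simp add: virtual_link_diagram_def)
  finally show ?case .
qed simp

lemma curve_shift: "k < ncomp D \<Longrightarrow> curve D k (t + of_int m) = curve D k t"
proof (cases m)
  case (nonneg n)
  then show "k < ncomp D \<Longrightarrow> ?thesis" using curve_shift_nat[of k t n] by simp
next
  case (neg n)
  then show "k < ncomp D \<Longrightarrow> ?thesis"
    using curve_shift_nat[of k "t + of_int m" "Suc n"] by simp
qed

lemma point_same: "p \<in> params D \<Longrightarrow> same_param p q \<Longrightarrow> point D q = point D p"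
  by (auto elim!: same_paramE simp: point_def params_iff curve_shift)

lemma params_same: "same_param p q \<Longrightarrow> p \<in> params D \<longleftrightarrow> q \<in> params D"
  by (auto simp: params_iff same_param_def)

lemma differentiable: "k < ncomp D \<Longrightarrow> curve D k differentiable at t"
  using vld by (auto simp: virtual_link_diagram_def C1_differentiable_on_eq)

lemma velocity_same: "p \<in> params D \<Longrightarrow> same_param p q \<Longrightarrow> velocity D q = velocity D p"
proof (elim same_paramE)
  fix m assume p: "p \<in> params D" and q: "q = (fst p, snd p + of_int m)"
  let ?k = "fst p" and ?t = "snd p"
  have k: "?k < ncomp D" using p by (simp add: params_iff)
  have "(curve D ?k has_vector_derivative velocity D q) (at (?t + of_int m))"
    using differentiable[OF k] by (simp add: velocity_def q vector_derivative_works[symmetric])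
  then have "((\<lambda>t. curve D ?k (t + of_int m)) has_vector_derivative velocity D q) (at ?t)"
    using vector_diff_chain_at[of "\<lambda>t. t + of_int m" 1 ?t "curve D ?k" "velocity D q"]
      has_vector_derivative_add[OF has_vector_derivative_id has_vector_derivative_const[of "of_int m"]]
    by (simp add: o_def)
  then show "velocity D q = velocity D p"
    using k by (simp add: curve_shift velocity_def vector_derivative_at)
qed

lemma crossing_same:
  assumes "same_param p p'" "same_param q q'" "crossing D p q"
  shows "crossing D p' q'"
  using assms point_same[of p p'] point_same[of q q'] params_same[of p p'] params_same[of q q']
    same_param_trans[of p p' q'] same_param_trans[of p q' q] same_param_sym
  unfolding crossing_def by metis

lemma over_same: "p \<in> params D \<Longrightarrow> same_param p q \<Longrightarrow> p \<in> over D \<longleftrightarrow> q \<in> over D"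
  using vld params_same same_param_sym unfolding virtual_link_diagram_def by metis

lemma over_at_same:
  assumes "same_param p p'" "same_param q q'" "over_at D p q"
  shows "over_at D p' q'"
  using assms crossing_same over_same unfolding over_at_def by (metis crossing_def)

lemma over_at_params: "over_at D p q \<Longrightarrow> p \<in> params D \<and> q \<in> params D"
  by (auto simp: over_at_def crossing_def)

lemma classical_params: "classical_params D \<subseteq> params D"
  using over_at_params by (auto simp: classical_params_eq classical_of_def)

lemma classical_same: "same_param p q \<Longrightarrow> p \<in> classical_params D \<longleftrightarrow> q \<in> classical_params D"
  unfolding classical_params_eq classical_of_def
  using over_at_same same_param_refl same_param_sym mem_Collect_eq by (smt (verit))

lemma classical_shift [simp]: "(k, t + of_int m) \<in> classical_params D \<longleftrightarrow> (k, t) \<in> classical_params D"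
  by (rule classical_same) simp

lemma cross_nonzero: "crossing D p q \<Longrightarrow> cross (velocity D p) (velocity D q) \<noteq> 0"
  using vld unfolding virtual_link_diagram_def by blast

lemma crossing_same_right: "crossing D p q \<Longrightarrow> crossing D p r \<Longrightarrow> same_param q r"
  using vld unfolding virtual_link_diagram_def by blast

text \<open>There are finitely many double points, each is reached from at most two points of the
  circles, and each of these has finitely many lifts near \<open>t\<close>. So the classical
  parameters near \<open>t\<close> form a finite set, which has no limit point.\<close>

lemma eventually_not_classical:
  fixes k :: nat and t :: real
  shows "\<forall>\<^sub>F s in at t. (k, s) \<notin> classical_params D"
proof -
  define P where "P = {point D p | p q. crossing D p q}"
  define fib where "fib z = {s \<in> {t-1..t+1}. \<exists>q. crossing D (k, s) q \<and> point D (k, s) = z}" for z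
  have "finite P" using vld by (simp add: virtual_link_diagram_def P_def)
  moreover have "finite (fib z)" for z
  proof (cases "fib z = {}")
    case False
    then obtain s0 q where s0: "crossing D (k, s0) q" "point D (k, s0) = z" by (auto simp: fib_def)
    \<comment> \<open>A parameter over the same double point is either a lift of \<open>s0\<close>
      or crosses \<open>s0\<close>, and a crossing partner of \<open>s0\<close> is unique up to
      integer shifts.\<close>
    have "fib z \<subseteq> {s \<in> {t-1..t+1}. s - s0 \<in> \<int>} \<union> {s \<in> {t-1..t+1}. s - snd q \<in> \<int>}"
    proof
      fix s assume s: "s \<in> fib z"
      show "s \<in> {s \<in> {t-1..t+1}. s - s0 \<in> \<int>} \<union> {s \<in> {t-1..t+1}. s - snd q \<in> \<int>}"
      proof (cases "same_param (k, s) (k, s0)")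
        case True
        then show ?thesis using s by (auto simp: fib_def same_param_def)
      next
        case False
        then have "crossing D (k, s0) (k, s)"
          using s s0 same_param_sym unfolding crossing_def fib_def by (auto simp: crossing_def)
        then have "same_param (k, s) q" using crossing_same_right[OF _ s0(1)] by blast
        then show ?thesis using s by (auto simp: fib_def same_param_def)
      qed
    qed
    then show ?thesis by (rule finite_subset) (intro finite_UnI finite_shifts)
  qed simp
  ultimately have "finite (\<Union>z\<in>P. fib z)" by blast
  moreover have "{s \<in> {t-1..t+1}. (k, s) \<in> classical_params D} \<subseteq> (\<Union>z\<in>P. fib z)"
    unfolding classical_params_def P_def fib_def by blast
  ultimately have "finite {s \<in> {t-1..t+1}. (k, s) \<in> classical_params D}" by (rule finite_subset[rotated])
  then have "\<forall>\<^sub>F s in at t. s \<notin> {s \<in> {t-1..t+1}. (k, s) \<in> classical_params D}"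
    using islimpt_finite[of "{s \<in> {t-1..t+1}. (k, s) \<in> classical_params D}" t]
    unfolding islimpt_iff_eventually by simp
  moreover have "\<forall>\<^sub>F s in at t. s \<in> {t-1<..<t+1}"
    by (intro eventually_at_in_open') auto
  ultimately show ?thesis by eventually_elim auto
qed

text \<open>Lives on the real line, the universal cover of the circle. A semi-arc is an orbit of
  this relation up to integer shifts, which also covers a component without classical
  crossings.\<close>

definition arc_free :: "nat \<Rightarrow> real \<Rightarrow> real \<Rightarrow> bool" where
  "arc_free k a b \<longleftrightarrow> (\<forall>x\<in>{min a b..max a b}. (k, x) \<notin> classical_params D)"

lemma arc_free_sym: "arc_free k a b \<longleftrightarrow> arc_free k b a"
  by (simp add: arc_free_def min.commute max.commute)

lemma arc_free_trans: "arc_free k a b \<Longrightarrow> arc_free k b c \<Longrightarrow> arc_free k a c"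
  unfolding arc_free_def by (auto simp: min_def max_def split: if_splits)

lemma arc_free_shift: "arc_free k a b \<Longrightarrow> arc_free k (a + of_int m) (b + of_int m)"
  unfolding arc_free_def
proof
  fix x assume "\<forall>x\<in>{min a b..max a b}. (k, x) \<notin> classical_params D"
    "x \<in> {min (a + of_int m) (b + of_int m)..max (a + of_int m) (b + of_int m)}"
  then have "(k, x + of_int (- m)) \<notin> classical_params D" by (auto simp: min_def max_def split: if_splits)
  then show "(k, x) \<notin> classical_params D" unfolding classical_shift .
qed

lemma semi_arc_alt: "semi_arc D (k, t) = {(k, s) | s. \<exists>m::int. arc_free k t (s + of_int m)}"
proof -
  have "closed_segment a b = {min a b..max a b}" for a b :: real
    by (auto simp: closed_segment_eq_real_ivl)
  then show ?thesis by (simp add: semi_arc_def arc_free_def)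
qed

lemma semi_arc_eqI:
  assumes "arc_free k t (s + of_int m)"
  shows "semi_arc D (k, t) = semi_arc D (k, s)"
proof -
  have "(\<exists>m::int. arc_free k t (s' + of_int m)) \<longleftrightarrow> (\<exists>m::int. arc_free k s (s' + of_int m))" for s'
  proof
    assume "\<exists>m::int. arc_free k t (s' + of_int m)"
    then obtain m' :: int where "arc_free k t (s' + of_int m')" ..
    then have "arc_free k (s + of_int m) (s' + of_int m')"
      using assms arc_free_trans arc_free_sym by blast
    from arc_free_shift[OF this, of "- m"] have "arc_free k s (s' + of_int (m' - m))"
      by (simp add: algebra_simps)
    then show "\<exists>m::int. arc_free k s (s' + of_int m)" ..
  next
    assume "\<exists>m::int. arc_free k s (s' + of_int m)"
    then obtain m' :: int where "arc_free k s (s' + of_int m')" ..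
    from arc_free_shift[OF this, of m] have "arc_free k (s + of_int m) (s' + of_int (m' + m))"
      by (simp add: add_ac)
    then show "\<exists>m::int. arc_free k t (s' + of_int m)" using assms arc_free_trans by blast
  qed
  then show ?thesis by (auto simp: semi_arc_alt)
qed

lemma semi_arc_same: "same_param p q \<Longrightarrow> semi_arc D p = semi_arc D q"
proof (elim same_paramE)
  fix m :: int assume q: "q = (fst p, snd p + of_int m)"
  obtain k t where p: "p = (k, t)" by force
  have "(\<exists>m::int. arc_free k t (s + of_int m)) \<longleftrightarrow> (\<exists>m'::int. arc_free k (t + of_int m) (s + of_int m'))" for s
  proof
    assume "\<exists>m::int. arc_free k t (s + of_int m)"
    then obtain m' :: int where "arc_free k t (s + of_int m')" ..
    from arc_free_shift[OF this, of m] have "arc_free k (t + of_int m) (s + of_int (m' + m))"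
      by (simp add: add_ac)
    then show "\<exists>m'::int. arc_free k (t + of_int m) (s + of_int m')" ..
  next
    assume "\<exists>m'::int. arc_free k (t + of_int m) (s + of_int m')"
    then obtain m' :: int where "arc_free k (t + of_int m) (s + of_int m')" ..
    from arc_free_shift[OF this, of "- m"] have "arc_free k t (s + of_int (m' - m))"
      by (simp add: algebra_simps)
    then show "\<exists>m'::int. arc_free k t (s + of_int m')" ..
  qed
  then show ?thesis by (auto simp: semi_arc_alt p q)
qed

lemma semi_arc_self: "p \<notin> classical_params D \<Longrightarrow> p \<in> semi_arc D p"
  by (cases p) (auto simp: semi_arc_alt arc_free_def intro!: exI[of _ 0])

text \<open>Connects the germ of the curve at a crossing with a semi-arc: the classical parameters
  are isolated, so all points just before \<open>t\<close> lie on the semi-arc that ends at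
  \<open>t\<close>.\<close>

lemma eventually_arc_before:
  assumes "(k, t) \<in> classical_params D"
  shows "\<forall>\<^sub>F s in at_left t. (k, s) \<notin> classical_params D \<and> semi_arc D (k, s) = arc_before D (k, t)"
proof -
  from eventually_not_classical[of k t] obtain d where d: "d > 0"
      "\<And>s. s \<noteq> t \<Longrightarrow> dist s t < d \<Longrightarrow> (k, s) \<notin> classical_params D"
    by (auto simp: eventually_at)
  have eq: "semi_arc D (k, s) = arc_before D (k, t)" if s: "t - d < s" "s < t" for s
  proof -
    have free: "(k, x) \<notin> classical_params D" if "x \<in> {s..<t}" for x
      using d(2)[of x] that s by (auto simp: dist_real_def)
    have "(\<exists>m::int. s' + of_int m < t \<and> (\<forall>x\<in>{s' + of_int m..<t}. (k, x) \<notin> classical_params D))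
        \<longleftrightarrow> (\<exists>m::int. arc_free k s (s' + of_int m))" for s'
    proof (intro ex_cong1 iffI)
      fix m :: int assume a: "s' + of_int m < t \<and> (\<forall>x\<in>{s' + of_int m..<t}. (k, x) \<notin> classical_params D)"
      then show "arc_free k s (s' + of_int m)" using s free
        by (auto simp: arc_free_def min_def max_def)
    next
      fix m :: int assume a: "arc_free k s (s' + of_int m)"
      \<comment> \<open>Here it matters that \<open>t\<close> itself is classical: an arc-free
        interval starting at \<open>s < t\<close> cannot run past \<open>t\<close>.\<close>
      then have "\<not> t \<in> {min s (s' + of_int m)..max s (s' + of_int m)}"
        using assms by (auto simp: arc_free_def)
      then have "s' + of_int m < t" using s by (auto simp: min_def max_def split: if_splits)
      moreover have "(k, x) \<notin> classical_params D" if "x \<in> {s' + of_int m..<t}" for x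
        using a free that by (cases "x < s") (auto simp: arc_free_def min_def max_def split: if_splits)
      ultimately show "s' + of_int m < t \<and> (\<forall>x\<in>{s' + of_int m..<t}. (k, x) \<notin> classical_params D)" by blast
    qed
    then show ?thesis by (auto simp: semi_arc_alt arc_before_def)
  qed
  have "\<forall>\<^sub>F s in at_left t. s \<in> {t - d<..<t}"
    using d(1) by (intro eventually_at_left_real) simp
  then show ?thesis
    by eventually_elim (use eq d(2) in \<open>auto simp: dist_real_def\<close>)
qed

lemma eventually_arc_after:
  assumes "(k, t) \<in> classical_params D"
  shows "\<forall>\<^sub>F s in at_right t. (k, s) \<notin> classical_params D \<and> semi_arc D (k, s) = arc_after D (k, t)"
proof -
  from eventually_not_classical[of k t] obtain d where d: "d > 0"
      "\<And>s. s \<noteq> t \<Longrightarrow> dist s t < d \<Longrightarrow> (k, s) \<notin> classical_params D"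
    by (auto simp: eventually_at)
  have eq: "semi_arc D (k, s) = arc_after D (k, t)" if s: "t < s" "s < t + d" for s
  proof -
    have free: "(k, x) \<notin> classical_params D" if "x \<in> {t<..s}" for x
      using d(2)[of x] that s by (auto simp: dist_real_def)
    have "(\<exists>m::int. t < s' + of_int m \<and> (\<forall>x\<in>{t<..s' + of_int m}. (k, x) \<notin> classical_params D))
        \<longleftrightarrow> (\<exists>m::int. arc_free k s (s' + of_int m))" for s'
    proof (intro ex_cong1 iffI)
      fix m :: int assume a: "t < s' + of_int m \<and> (\<forall>x\<in>{t<..s' + of_int m}. (k, x) \<notin> classical_params D)"
      then show "arc_free k s (s' + of_int m)" using s free
        by (auto simp: arc_free_def min_def max_def)
    next
      fix m :: int assume a: "arc_free k s (s' + of_int m)"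
      then have "\<not> t \<in> {min s (s' + of_int m)..max s (s' + of_int m)}"
        using assms by (auto simp: arc_free_def)
      then have "t < s' + of_int m" using s by (auto simp: min_def max_def split: if_splits)
      moreover have "(k, x) \<notin> classical_params D" if "x \<in> {t<..s' + of_int m}" for x
        using a free that by (cases "x > s") (auto simp: arc_free_def min_def max_def split: if_splits)
      ultimately show "t < s' + of_int m \<and> (\<forall>x\<in>{t<..s' + of_int m}. (k, x) \<notin> classical_params D)" by blast
    qed
    then show ?thesis by (auto simp: semi_arc_alt arc_after_def)
  qed
  have "\<forall>\<^sub>F s in at_right t. s \<in> {t<..<t + d}"
    using d(1) by (intro eventually_at_right_real) simp
  then show ?thesis
    by eventually_elim (use eq d(2) in \<open>auto simp: dist_real_def\<close>)
qed

lemma semi_arcsI: "p \<in> params D \<Longrightarrow> p \<notin> classical_params D \<Longrightarrow> semi_arc D p \<in> semi_arcs D"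
  by (simp add: semi_arcs_def)

lemma arc_before_semi_arcs:
  assumes "p \<in> classical_params D"
  shows "arc_before D p \<in> semi_arcs D"
proof -
  obtain k t where p: "p = (k, t)" by force
  from eventually_happens'[OF _ eventually_arc_before[OF assms[unfolded p]]] obtain s where
    "(k, s) \<notin> classical_params D" "semi_arc D (k, s) = arc_before D (k, t)"
    by (auto simp: trivial_limit_at_left_real)
  moreover have "(k, s) \<in> params D" using assms classical_params by (auto simp: params_iff p)
  ultimately show ?thesis using semi_arcsI p by metis
qed

lemma arc_after_semi_arcs:
  assumes "p \<in> classical_params D"
  shows "arc_after D p \<in> semi_arcs D"
proof -
  obtain k t where p: "p = (k, t)" by force
  from eventually_happens'[OF _ eventually_arc_after[OF assms[unfolded p]]] obtain s where
    "(k, s) \<notin> classical_params D" "semi_arc D (k, s) = arc_after D (k, t)"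
    by (auto simp: trivial_limit_at_right_real)
  moreover have "(k, s) \<in> params D" using assms classical_params by (auto simp: params_iff p)
  ultimately show ?thesis using semi_arcsI p by metis
qed

text \<open>Transversality gives the cross product a strict sign, and exchanging the strands negates
  it. So one Boolean decides for both strands which of the semi-arcs before and after the crossing
  is the right-hand one.\<close>

lemma Col_crossing_iff:
  assumes "over_at D p q"
  shows "(let x = f (right_arc D q p); y = f (right_arc D p q)
        in f (left_arc D q p) = ut x y \<and> f (left_arc D p q) = ot y x) \<longleftrightarrow>
    crossing_relation ut ot (positive_at D p q) (f (arc_before D p)) (f (arc_after D p))
      (f (arc_before D q)) (f (arc_after D q))"
  using cross_nonzero[of p q] cross_antisym[of "velocity D p" "velocity D q"] assms
  by (auto simp: over_at_def crossing_relation_def positive_at_def right_arc_def left_arc_def Let_def)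

lemma Col_iff:
  "f \<in> Col X ut ot D \<longleftrightarrow> f \<in> semi_arcs D \<rightarrow>\<^sub>E X \<and> (\<forall>p q. over_at D p q \<longrightarrow>
    crossing_relation ut ot (positive_at D p q) (f (arc_before D p)) (f (arc_after D p))
      (f (arc_before D q)) (f (arc_after D q)))"
  unfolding Col_def using Col_crossing_iff[of _ _ f ut ot] by (auto simp: over_at_def)

lemma Col_compose:
  assumes f: "f \<in> Col X ut ot D" and \<alpha>: "\<alpha> \<in> End X ut ot"
  shows "compose (semi_arcs D) \<alpha> f \<in> Col X ut ot D"
  unfolding Col_iff
proof (intro conjI allI impI)
  have fX: "f \<in> semi_arcs D \<rightarrow>\<^sub>E X" using f by (simp add: Col_iff)
  have \<alpha>X: "\<alpha> \<in> X \<rightarrow> X" using \<alpha> by (auto simp: End_def)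
  show "compose (semi_arcs D) \<alpha> f \<in> semi_arcs D \<rightarrow>\<^sub>E X"
    using fX \<alpha>X by (auto simp: compose_def PiE_iff)
  fix p q assume pq: "over_at D p q"
  then have cl: "p \<in> classical_params D" "q \<in> classical_params D"
    by (auto dest: over_at_classical)
  note arcs = arc_before_semi_arcs arc_after_semi_arcs
  have "f (arc_before D p) \<in> X" "f (arc_after D p) \<in> X" "f (arc_before D q) \<in> X" "f (arc_after D q) \<in> X"
    using fX cl arcs by blast+
  moreover have "crossing_relation ut ot (positive_at D p q) (f (arc_before D p)) (f (arc_after D p))
      (f (arc_before D q)) (f (arc_after D q))"
    using f pq unfolding Col_iff by blast
  ultimately show "crossing_relation ut ot (positive_at D p q) (compose (semi_arcs D) \<alpha> f (arc_before D p))
      (compose (semi_arcs D) \<alpha> f (arc_after D p)) (compose (semi_arcs D) \<alpha> f (arc_before D q))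
      (compose (semi_arcs D) \<alpha> f (arc_after D q))"
    using \<alpha> cl by (auto simp: compose_eq arcs crossing_relation_def End_def split: if_splits)
qed

lemma Col_diagram_coloring:
  assumes f: "f \<in> Col X ut ot D"
  shows "diagram_coloring X ut ot D (\<lambda>p. f (semi_arc D p))"
  unfolding param_coloring_def classical_params_eq[symmetric]
proof (intro conjI allI impI)
  fix p :: param assume p: "fst p < ncomp D" "p \<notin> classical_params D"
  then show "f (semi_arc D p) \<in> X" using f by (auto simp: Col_iff params_iff intro!: semi_arcsI)
  obtain k t where kt: "p = (k, t)" by force
  have "\<forall>\<^sub>F s in nhds t. (k, s) \<notin> classical_params D"
    using eventually_not_classical[of k t] p kt by (simp add: eventually_nhds_conv_at)
  then obtain d where d: "d > 0" "\<And>s. dist s t < d \<Longrightarrow> (k, s) \<notin> classical_params D"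
    by (auto simp: eventually_nhds_metric)
  have "semi_arc D (k, s) = semi_arc D (k, t)" if "dist s t < d" for s
  proof -
    have "arc_free k s (t + of_int 0)"
      unfolding arc_free_def using that by (auto intro!: d(2) simp: dist_real_def)
    then show ?thesis by (rule semi_arc_eqI)
  qed
  then show "\<forall>\<^sub>F s in nhds (snd p). f (semi_arc D (fst p, s)) = f (semi_arc D p)"
    using d(1) unfolding eventually_nhds_metric kt fst_conv snd_conv by (intro exI[of _ d]) metis
next
  fix p q assume "same_param p q"
  then show "f (semi_arc D p) = f (semi_arc D q)" by (simp add: semi_arc_same)
next
  fix p q assume pq: "over_at D p q"
  then have cl: "p \<in> classical_params D" "q \<in> classical_params D"
    by (auto dest: over_at_classical)
  have "before (\<lambda>p. f (semi_arc D p)) p (f (arc_before D p)) \<and> after (\<lambda>p. f (semi_arc D p)) p (f (arc_after D p))"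
    if "p \<in> classical_params D" for p
  proof -
    obtain k t where kt: "p = (k, t)" by force
    show ?thesis unfolding before_def after_def kt fst_conv snd_conv
      using eventually_arc_before[OF that[unfolded kt]] eventually_arc_after[OF that[unfolded kt]]
      by (auto elim!: eventually_mono)
  qed
  then show "\<exists>ob oa ub ua. before (\<lambda>p. f (semi_arc D p)) p ob \<and> after (\<lambda>p. f (semi_arc D p)) p oa \<and>
      before (\<lambda>p. f (semi_arc D p)) q ub \<and> after (\<lambda>p. f (semi_arc D p)) q ua \<and>
        crossing_relation ut ot (positive_at D p q) ob oa ub ua"
    using f pq cl unfolding Col_iff by blast
qed

text \<open>A locally constant function on a connected interval is constant. This is how a condition
  on germs yields a function on semi-arcs.\<close>

lemma diagram_coloring_const:
  assumes F: "diagram_coloring X ut ot D F" and k: "k < ncomp D" and "arc_free k a b"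
  shows "F (k, a) = F (k, b)"
proof -
  let ?S = "{min a b..max a b}"
  have "connected ?S" by simp
  moreover have "\<forall>\<^sub>F s in at x within ?S. F (k, x) = F (k, s)" if "x \<in> ?S" for x
  proof -
    have "\<forall>\<^sub>F s in nhds x. F (k, s) = F (k, x)"
    proof -
      have "\<forall>\<^sub>F s in nhds (snd (k, x)). F (fst (k, x), s) = F (k, x)"
        using k \<open>arc_free k a b\<close> that
        by (intro param_coloring_local[OF F]) (auto simp: arc_free_def classical_params_eq)
      then show ?thesis by simp
    qed
    then show ?thesis unfolding eventually_at_filter by (rule eventually_mono) simp
  qed
  ultimately show ?thesis
    by (intro connected_local_const[where A = ?S]) auto
qed

lemma diagram_coloring_Col:
  assumes F: "diagram_coloring X ut ot D F"
  obtains f where "f \<in> Col X ut ot D" "\<And>p. p \<in> params D \<Longrightarrow> p \<notin> classical_params D \<Longrightarrow> f (semi_arc D p) = F p"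
proof -
  \<comment> \<open>Any representative gives the same value, since two parameters of a semi-arc are
    joined by an arc-free interval up to a period. The value \<open>undefined\<close> elsewhere is
    forced by the extensional function space in \<open>Col\<close>.\<close>
  define f where "f A = (if A \<in> semi_arcs D then F (SOME p. p \<in> A) else undefined)" for A
  have f: "f (semi_arc D p) = F p" if p: "p \<in> params D" "p \<notin> classical_params D" for p
  proof -
    obtain k t where kt: "p = (k, t)" by force
    define q where "q = (SOME p'. p' \<in> semi_arc D p)"
    have "q \<in> semi_arc D p" unfolding q_def using semi_arc_self[OF p(2)] by (rule someI)
    then obtain s and m :: int where q: "q = (k, s)" "arc_free k t (s + of_int m)"
      by (auto simp: kt semi_arc_alt)
    have "F p = F (k, s + of_int m)"
      using diagram_coloring_const[OF F _ q(2)] p kt by (simp add: params_iff)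
    also have "\<dots> = F q"
      using F same_param_shift(2)[of k s m] unfolding param_coloring_def q(1) by blast
    finally show ?thesis using semi_arcsI[OF p] by (simp add: f_def q_def)
  qed
  have bef: "before F p x \<Longrightarrow> f (arc_before D p) = x" and aft: "after F p x \<Longrightarrow> f (arc_after D p) = x"
    if "p \<in> classical_params D" for p x
  proof -
    obtain k t where kt: "p = (k, t)" by force
    have k: "(k, s) \<in> params D" for s using that classical_params kt by (auto simp: params_iff)
    { assume "before F p x"
      then have "\<forall>\<^sub>F s in at_left t. F (k, s) = x" by (simp add: before_def kt)
      with eventually_arc_before[OF that[unfolded kt]] have
        "\<forall>\<^sub>F s in at_left t. ((k, s) \<notin> classical_params D \<and> semi_arc D (k, s) = arc_before D (k, t)) \<and> F (k, s) = x"
        by (rule eventually_conj)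
      from eventually_happens'[OF _ this] obtain s where "(k, s) \<notin> classical_params D"
        "semi_arc D (k, s) = arc_before D (k, t)" "F (k, s) = x" by (auto simp: trivial_limit_at_left_real)
      then show "f (arc_before D p) = x" using f[OF k] kt by metis }
    { assume "after F p x"
      then have "\<forall>\<^sub>F s in at_right t. F (k, s) = x" by (simp add: after_def kt)
      with eventually_arc_after[OF that[unfolded kt]] have
        "\<forall>\<^sub>F s in at_right t. ((k, s) \<notin> classical_params D \<and> semi_arc D (k, s) = arc_after D (k, t)) \<and> F (k, s) = x"
        by (rule eventually_conj)
      from eventually_happens'[OF _ this] obtain s where "(k, s) \<notin> classical_params D"
        "semi_arc D (k, s) = arc_after D (k, t)" "F (k, s) = x" by (auto simp: trivial_limit_at_right_real)
      then show "f (arc_after D p) = x" using f[OF k] kt by metis }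
  qed
  have "f \<in> Col X ut ot D"
    unfolding Col_iff
  proof (intro conjI allI impI)
    have "f (semi_arc D p) \<in> X" if "p \<in> params D" "p \<notin> classical_params D" for p
      using param_coloring_in[OF F] that f[OF that] by (simp add: classical_params_eq params_iff)
    then show "f \<in> semi_arcs D \<rightarrow>\<^sub>E X"
      by (intro PiE_I) (auto simp: semi_arcs_def f_def)
    fix p q assume pq: "over_at D p q"
    then have cl: "p \<in> classical_params D" "q \<in> classical_params D"
      by (auto dest: over_at_classical)
    have "\<exists>ob oa ub ua. before F p ob \<and> after F p oa \<and> before F q ub \<and> after F q ua \<and>
        crossing_relation ut ot (positive_at D p q) ob oa ub ua"
      using param_coloring_crossing[OF F pq] .
    then show "crossing_relation ut ot (positive_at D p q) (f (arc_before D p)) (f (arc_after D p))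
      (f (arc_before D q)) (f (arc_after D q))"
      using bef aft cl by blast
  qed
  then show thesis using f by (rule that)
qed

lemma Col_eqI:
  assumes "f \<in> Col X ut ot D" "g \<in> Col X ut ot D"
    "\<And>p. p \<in> params D \<Longrightarrow> p \<notin> classical_params D \<Longrightarrow> f (semi_arc D p) = g (semi_arc D p)"
  shows "f = g"
  using assms by (intro PiE_ext[of f "semi_arcs D" "\<lambda>_. X"]) (auto simp: Col_iff semi_arcs_def)

end

text \<open>The relation \<open>A\<close> pairs the parameters at which corresponding colorings of the two diagrams
  have the same value.\<close>

lemma coloring_equivalent_transfer:
  assumes "virtual_link_diagram D" "virtual_link_diagram E"
    and A: "A \<subseteq> (params D - classical_params D) \<times> (params E - classical_params E)"
    and 1: "\<And>F. diagram_coloring X ut ot D F \<Longrightarrow> \<exists>G. diagram_coloring X ut ot E G \<and> (\<forall>(p, q)\<in>A. F p = G q)"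
    and 2: "\<And>G. diagram_coloring X ut ot E G \<Longrightarrow> \<exists>F. diagram_coloring X ut ot D F \<and> (\<forall>(p, q)\<in>A. F p = G q)"
    and 3: "\<And>F F' p. diagram_coloring X ut ot D F \<Longrightarrow> diagram_coloring X ut ot D F' \<Longrightarrow>
      (\<forall>(p, q)\<in>A. F p = F' p) \<Longrightarrow> p \<in> params D \<Longrightarrow> p \<notin> classical_params D \<Longrightarrow> F p = F' p"
    and 4: "\<And>F F' p. diagram_coloring X ut ot E F \<Longrightarrow> diagram_coloring X ut ot E F' \<Longrightarrow>
      (\<forall>(p, q)\<in>A. F q = F' q) \<Longrightarrow> p \<in> params E \<Longrightarrow> p \<notin> classical_params E \<Longrightarrow> F p = F' p"
  shows "coloring_equivalent X ut ot D E"
proof -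
  interpret D: link_diagram D by unfold_locales fact
  interpret E: link_diagram E by unfold_locales fact
  define T :: "'a coloring \<Rightarrow> 'a coloring \<Rightarrow> bool"
    where "T f g \<longleftrightarrow> (\<forall>(p, q)\<in>A. f (semi_arc D p) = g (semi_arc E q))" for f g
  show ?thesis
  proof (rule coloring_equivalentI[where T = T])
    fix f assume f: "f \<in> Col X ut ot D"
    from 1[OF D.Col_diagram_coloring[OF f]] obtain G where
      G: "diagram_coloring X ut ot E G" "\<And>p q. (p, q) \<in> A \<Longrightarrow> f (semi_arc D p) = G q" by auto
    obtain g where "g \<in> Col X ut ot E" "\<And>p. p \<in> params E \<Longrightarrow> p \<notin> classical_params E \<Longrightarrow> g (semi_arc E p) = G p"
      using E.diagram_coloring_Col[OF G(1)] by metis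
    then show "\<exists>g\<in>Col X ut ot E. T f g" using A G(2) by (intro bexI[of _ g]) (auto simp: T_def)
  next
    fix g assume g: "g \<in> Col X ut ot E"
    from 2[OF E.Col_diagram_coloring[OF g]] obtain F where
      F: "diagram_coloring X ut ot D F" "\<And>p q. (p, q) \<in> A \<Longrightarrow> F p = g (semi_arc E q)" by auto
    obtain f where "f \<in> Col X ut ot D" "\<And>p. p \<in> params D \<Longrightarrow> p \<notin> classical_params D \<Longrightarrow> f (semi_arc D p) = F p"
      using D.diagram_coloring_Col[OF F(1)] by metis
    then show "\<exists>f\<in>Col X ut ot D. T f g" using A F(2) by (intro bexI[of _ f]) (auto simp: T_def)
  next
    fix f g g' assume "g \<in> Col X ut ot E" "g' \<in> Col X ut ot E" "T f g" "T f g'"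
    then show "g = g'"
      by (intro E.Col_eqI[of g X ut ot g'] 4[OF E.Col_diagram_coloring E.Col_diagram_coloring])
        (fastforce simp: T_def)+
  next
    fix f f' g assume "f \<in> Col X ut ot D" "f' \<in> Col X ut ot D" "T f g" "T f' g"
    then show "f = f'"
      by (intro D.Col_eqI[of f X ut ot f'] 3[OF D.Col_diagram_coloring D.Col_diagram_coloring])
        (fastforce simp: T_def)+
  next
    \<comment> \<open>Equivariance is automatic: \<open>T\<close> compares values at paired
      parameters, and \<alpha> is applied to both of them.\<close>
    fix f g \<alpha> assume "T f g"
    moreover have "semi_arc D p \<in> semi_arcs D" "semi_arc E q \<in> semi_arcs E" if "(p, q) \<in> A" for p q
      using A that by (auto intro!: D.semi_arcsI E.semi_arcsI)
    ultimately show "T (compose (semi_arcs D) \<alpha> f) (compose (semi_arcs E) \<alpha> g)"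
      unfolding T_def by (auto simp: compose_eq)
  qed (fact D.Col_compose E.Col_compose)+
qed

lemma coloring_equivalent_sym:
  assumes "virtual_link_diagram D" "coloring_equivalent X ut ot D E"
  shows "coloring_equivalent X ut ot E D"
proof -
  interpret D: link_diagram D by unfold_locales fact
  obtain \<psi> where \<psi>: "bij_betw \<psi> (Col X ut ot D) (Col X ut ot E)"
      "\<And>f \<alpha>. f\<in>Col X ut ot D \<Longrightarrow> \<alpha>\<in>End X ut ot \<Longrightarrow>
          \<psi> (compose (semi_arcs D) \<alpha> f) = compose (semi_arcs E) \<alpha> (\<psi> f)"
    using assms(2) unfolding coloring_equivalent_def by metis
  let ?\<phi> = "inv_into (Col X ut ot D) \<psi>"
  have \<phi>: "bij_betw ?\<phi> (Col X ut ot E) (Col X ut ot D)" using \<psi>(1) by (rule bij_betw_inv_into)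
  have "?\<phi> (compose (semi_arcs E) \<alpha> g) = compose (semi_arcs D) \<alpha> (?\<phi> g)"
    if "g \<in> Col X ut ot E" "\<alpha> \<in> End X ut ot" for g \<alpha>
  proof -
    have g: "?\<phi> g \<in> Col X ut ot D" "\<psi> (?\<phi> g) = g"
      using \<phi> \<psi>(1) that by (auto simp: bij_betw_def f_inv_into_f)
    then have "compose (semi_arcs E) \<alpha> g = \<psi> (compose (semi_arcs D) \<alpha> (?\<phi> g))"
      using \<psi>(2)[OF g(1) that(2)] by simp
    then show ?thesis
      using D.Col_compose[OF g(1) that(2)] bij_betw_imp_inj_on[OF \<psi>(1)] by simp
  qed
  with \<phi> show ?thesis unfolding coloring_equivalent_def by blast
qed

lemma stillborn_matrix_coloring_equivalent:
  assumes D: "virtual_link_diagram D" and eq: "coloring_equivalent X ut ot D E"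
    and S: "filtration_of S m (End X ut ot)"
  shows "stillborn_matrix N D X ut ot S m = stillborn_matrix N E X ut ot S m"
proof -
  interpret D: link_diagram D by unfold_locales fact
  obtain \<psi> where \<psi>: "bij_betw \<psi> (Col X ut ot D) (Col X ut ot E)"
      "\<And>f \<alpha>. f\<in>Col X ut ot D \<Longrightarrow> \<alpha>\<in>End X ut ot \<Longrightarrow>
          \<psi> (compose (semi_arcs D) \<alpha> f) = compose (semi_arcs E) \<alpha> (\<psi> f)"
    using eq unfolding coloring_equivalent_def by metis
  \<comment> \<open>Only the last stage is assumed to lie in \<open>End\<close>, so the induction
    goes down from \<open>m\<close>.\<close>
  have End: "S l \<subseteq> End X ut ot" if "l \<le> m" for l
    using that
  proof (induction rule: inc_induct)
    case base
    then show ?case using S by (simp add: filtration_of_def)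
  next
    case (step n)
    then show ?case using S by (auto simp: filtration_of_def)
  qed
  have K: "clique_simplices N (coloring_quiver X ut ot (S l) E) n =
      map \<psi> ` clique_simplices N (coloring_quiver X ut ot (S l) D) n" if "l \<le> m" for l n
  proof (rule clique_simplices_map)
    show "bij_betw \<psi> (verts (coloring_quiver X ut ot (S l) D)) (verts (coloring_quiver X ut ot (S l) E))"
      using \<psi>(1) by (simp add: coloring_quiver_def)
    fix f g assume "f \<in> verts (coloring_quiver X ut ot (S l) D)" "g \<in> verts (coloring_quiver X ut ot (S l) D)"
    then show "num_edges (coloring_quiver X ut ot (S l) E) (\<psi> f) (\<psi> g) = num_edges (coloring_quiver X ut ot (S l) D) f g"
      using End[OF that] by (intro num_edges_coloring_quiver \<psi> D.Col_compose) (auto simp: coloring_quiver_def)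
  qed
  have "stillborn_number (\<lambda>l. clique_simplices N (coloring_quiver X ut ot (S l) D)) i j =
      stillborn_number (\<lambda>l. clique_simplices N (coloring_quiver X ut ot (S l) E)) i j" if "j \<le> m" for i j
  proof (rule stillborn_number_map[of \<psi> "Col X ut ot D"])
    show "inj_on \<psi> (Col X ut ot D)" using \<psi>(1) by (rule bij_betw_imp_inj_on)
    show "clique_simplices N (coloring_quiver X ut ot (S l) D) n \<subseteq> lists (Col X ut ot D)" for l n
      by (auto simp: clique_simplices_def coloring_quiver_def)
  qed (use K that in auto)
  then show ?thesis by (auto simp: stillborn_matrix_def fun_eq_iff)
qed

section \<open>Moves that do not change the classical crossings\<close>

text \<open>\<open>param_coloring\<close> sees a diagram only through its number of components, the
  relation \<open>over_at\<close> and the crossing signs. If these agree, both diagrams have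
  literally the same colorings as functions of the parameter.\<close>

lemma coloring_equivalent_same_crossings:
  assumes vld: "virtual_link_diagram D" "virtual_link_diagram E" and n: "ncomp E = ncomp D"
    and ov: "\<And>p q. over_at E p q \<longleftrightarrow> over_at D p q"
    and pos: "\<And>p q. over_at D p q \<Longrightarrow> positive_at E p q \<longleftrightarrow> positive_at D p q"
  shows "coloring_equivalent X ut ot D E"
proof -
  have ov': "over_at E = over_at D" using ov by (simp add: fun_eq_iff)
  have dc: "diagram_coloring X ut ot E F \<longleftrightarrow> diagram_coloring X ut ot D F" for F
    unfolding param_coloring_def ov' n using pos by (auto cong: conj_cong)
  have pE: "params E = params D" "classical_params E = classical_params D"
    by (simp_all add: params_def n classical_params_eq ov')
  show ?thesis
    by (rule coloring_equivalent_transfer[OF vld, where A = "Id_on (params D - classical_params D)"])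
      (auto simp: dc pE Id_on_def)
qed

text \<open>Multiplicativity of the determinant in dimension two:
  \<open>cross (L 1) (L \<i>)\<close> is the determinant of \<open>L\<close>.\<close>

lemma cross_linear:
  assumes "linear L"
  shows "cross (L u) (L v) = cross (L 1) (L \<i>) * cross u v"
proof -
  have L: "L w = Re w *\<^sub>R L 1 + Im w *\<^sub>R L \<i>" for w
  proof -
    have "w = Re w *\<^sub>R 1 + Im w *\<^sub>R \<i>" by (simp add: complex_eq_iff)
    then have "L w = L (Re w *\<^sub>R 1 + Im w *\<^sub>R \<i>)" by simp
    also have "\<dots> = Re w *\<^sub>R L 1 + Im w *\<^sub>R L \<i>"
      by (simp only: linear_add[OF assms] linear_scale[OF assms])
    finally show ?thesis .
  qed
  show ?thesis
    by (subst L[of u], subst L[of v]) (simp add: cross_def algebra_simps)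
qed

lemma cross_frechet:
  assumes "\<phi> differentiable (at z)"
  shows "cross (frechet_derivative \<phi> (at z) u) (frechet_derivative \<phi> (at z) v) = jacobian \<phi> z * cross u v"
  unfolding jacobian_def by (rule cross_linear[OF linear_frechet_derivative[OF assms]])

lemma has_vector_derivative_diffeo:
  assumes "(g has_vector_derivative w) (at t)" "\<phi> differentiable (at (g t))"
  shows "((\<lambda>t. \<phi> (g t)) has_vector_derivative frechet_derivative \<phi> (at (g t)) w) (at t)"
proof -
  have "((\<phi> \<circ> g) has_derivative frechet_derivative \<phi> (at (g t)) \<circ> (\<lambda>h. h *\<^sub>R w)) (at t)"
    using assms by (intro diff_chain_at) (auto simp: has_vector_derivative_def frechet_derivative_works)
  moreover have "frechet_derivative \<phi> (at (g t)) \<circ> (\<lambda>h. h *\<^sub>R w) = (\<lambda>h. h *\<^sub>R frechet_derivative \<phi> (at (g t)) w)"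
    using linear_scale[OF linear_frechet_derivative[OF assms(2)]] by (simp add: fun_eq_iff)
  ultimately show ?thesis by (simp add: has_vector_derivative_def o_def)
qed

text \<open>The Jacobian at \<open>z\<close> depends continuously on the time, equals 1 at time 0
  and never vanishes; so it stays positive by the intermediate value theorem. Hence isotopies
  preserve crossing signs.\<close>

lemma plane_isotopy_jacobian_pos:
  assumes "plane_isotopy \<Phi>"
  shows "jacobian (\<Phi> 1) z > 0"
proof (rule ccontr)
  assume neg: "\<not> jacobian (\<Phi> 1) z > 0"
  have cont: "continuous_on {0..1} (\<lambda>t. frechet_derivative (\<Phi> t) (at z) v)" for v
  proof -
    have "continuous_on ({0..1} \<times> UNIV) (\<lambda>(t, z). frechet_derivative (\<Phi> t) (at z) v)"
      using assms by (simp add: plane_isotopy_def)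
    then have "continuous_on {0..1} ((\<lambda>(t, z). frechet_derivative (\<Phi> t) (at z) v) \<circ> (\<lambda>t. (t, z)))"
      by (intro continuous_on_compose continuous_intros) (auto elim: continuous_on_subset)
    then show ?thesis by (simp add: o_def)
  qed
  then have "continuous_on {0..1} (\<lambda>t. jacobian (\<Phi> t) z)"
    unfolding jacobian_def cross_def by (intro continuous_intros cont)
  moreover have "jacobian (\<Phi> 0) z = 1"
    using assms by (simp add: plane_isotopy_def jacobian_def cross_def id_def)
  ultimately obtain t where "t \<in> {0..1}" "jacobian (\<Phi> t) z = 0"
    using neg IVT2'[of "\<lambda>t. jacobian (\<Phi> t) z" 1 0 0] by auto
  then show False using assms by (auto simp: plane_isotopy_def plane_diffeo_def)
qed

lemma planar_isotopic_coloring_equivalent: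
  assumes vld: "virtual_link_diagram D" "virtual_link_diagram E" and iso: "planar_isotopic D E"
  shows "coloring_equivalent X ut ot D E"
proof -
  interpret D: link_diagram D by unfold_locales fact
  interpret E: link_diagram E by unfold_locales fact
  obtain \<Phi> where n: "ncomp E = ncomp D" and ov: "over E = over D" and \<Phi>: "plane_isotopy \<Phi>"
    and c: "\<And>k t. k < ncomp D \<Longrightarrow> curve E k t = \<Phi> 1 (curve D k t)"
    using iso by (auto simp: planar_isotopic_def)
  have dif: "plane_diffeo (\<Phi> 1)" using \<Phi> by (simp add: plane_isotopy_def)
  then have inj: "inj (\<Phi> 1)" by (simp add: plane_diffeo_def bij_def)
  have params: "params E = params D" by (simp add: params_def n)
  have pt: "point E p = \<Phi> 1 (point D p)" if "p \<in> params D" for p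
    using that by (simp add: point_def c D.params_iff)
  have cr: "crossing E p q \<longleftrightarrow> crossing D p q" for p q
    using inj by (auto simp: crossing_def params pt inj_eq)
  have vel: "velocity E p = frechet_derivative (\<Phi> 1) (at (point D p)) (velocity D p)" if "p \<in> params D" for p
  proof -
    have k: "fst p < ncomp D" using that by (simp add: D.params_iff)
    have "(curve D (fst p) has_vector_derivative velocity D p) (at (snd p))"
      using D.differentiable[OF k] by (simp add: velocity_def vector_derivative_works[symmetric])
    from has_vector_derivative_diffeo[OF this, of "\<Phi> 1"] dif
    have "((\<lambda>t. \<Phi> 1 (curve D (fst p) t)) has_vector_derivative
        frechet_derivative (\<Phi> 1) (at (point D p)) (velocity D p)) (at (snd p))"
      by (simp add: plane_diffeo_def point_def)
    moreover have "(\<lambda>t. \<Phi> 1 (curve D (fst p) t)) = curve E (fst p)"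
      using k c by auto
    ultimately show ?thesis by (simp add: velocity_def vector_derivative_at)
  qed
  show ?thesis
  proof (rule coloring_equivalent_same_crossings[OF vld n])
    show "over_at E p q \<longleftrightarrow> over_at D p q" for p q by (simp add: over_at_def cr ov)
    fix p q assume "over_at D p q"
    then have pq: "p \<in> params D" "q \<in> params D" "point D p = point D q"
      by (auto simp: over_at_def crossing_def)
    have "cross (velocity E p) (velocity E q) = jacobian (\<Phi> 1) (point D p) * cross (velocity D p) (velocity D q)"
      unfolding vel[OF pq(1)] vel[OF pq(2)] pq(3)
      using dif by (intro cross_frechet) (simp add: plane_diffeo_def)
    then show "positive_at E p q \<longleftrightarrow> positive_at D p q"
      using plane_isotopy_jacobian_pos[OF \<Phi>, of "point D p"]
      by (simp add: positive_at_def zero_less_mult_iff)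
  qed
qed

section \<open>Reparametrization\<close>

text \<open>Surjectivity provides a preimage of the left bound, and monotonicity then carries left
  neighbourhoods to left neighbourhoods.\<close>

lemma eventually_at_left_strict_mono:
  fixes \<rho> :: "real \<Rightarrow> real"
  assumes "strict_mono \<rho>" "surj \<rho>" "\<forall>\<^sub>F y in at_left (\<rho> t). P y"
  shows "\<forall>\<^sub>F s in at_left t. P (\<rho> s)"
proof -
  from assms(3) obtain b where b: "b < \<rho> t" "\<And>y. b < y \<Longrightarrow> y < \<rho> t \<Longrightarrow> P y"
    by (auto simp: eventually_at_left[of "\<rho> t - 1" "\<rho> t"])
  obtain b' where b': "b = \<rho> b'" using assms(2) by (metis surjD)
  have "b' < t" using b(1) strict_mono_less[OF assms(1)] unfolding b' by simp
  moreover have "P (\<rho> s)" if "b' < s" "s < t" for s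
    using that b(2) strict_mono_less[OF assms(1)] unfolding b' by simp
  ultimately show ?thesis by (auto simp: eventually_at_left[of "t - 1" t])
qed

lemma eventually_at_right_strict_mono:
  fixes \<rho> :: "real \<Rightarrow> real"
  assumes "strict_mono \<rho>" "surj \<rho>" "\<forall>\<^sub>F y in at_right (\<rho> t). P y"
  shows "\<forall>\<^sub>F s in at_right t. P (\<rho> s)"
proof -
  from assms(3) obtain b where b: "\<rho> t < b" "\<And>y. \<rho> t < y \<Longrightarrow> y < b \<Longrightarrow> P y"
    by (auto simp: eventually_at_right[of "\<rho> t" "\<rho> t + 1"])
  obtain b' where b': "b = \<rho> b'" using assms(2) by (metis surjD)
  have "t < b'" using b(1) strict_mono_less[OF assms(1)] unfolding b' by simp
  moreover have "P (\<rho> s)" if "t < s" "s < b'" for s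
    using that b(2) strict_mono_less[OF assms(1)] unfolding b' by simp
  ultimately show ?thesis by (auto simp: eventually_at_right[of t "t + 1"])
qed

lemma eventually_nhds_real_split:
  fixes t :: real
  shows "eventually P (nhds t) \<longleftrightarrow> P t \<and> eventually P (at_left t) \<and> eventually P (at_right t)"
  by (auto simp: eventually_nhds_conv_at eventually_at_split)

text \<open>Being the identity on component numbers from \<open>n\<close> on, it becomes a bijection
  of all parameters, whose inverse laws need no side conditions.\<close>

definition reparam :: "nat \<Rightarrow> (nat \<Rightarrow> nat) \<Rightarrow> (nat \<Rightarrow> real \<Rightarrow> real) \<Rightarrow> param \<Rightarrow> param" where
  "reparam n \<pi> \<rho> p = (if fst p < n then (\<pi> (fst p), \<rho> (fst p) (snd p)) else p)"

text \<open>Pulls colorings back. Only monotonicity, surjectivity and periodicity of the maps and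
  abstract crossing relations appear, so that the lemma applies to a reparametrization and equally
  to its inverse.\<close>

lemma param_coloring_reparam:
  assumes F: "param_coloring X ut ot n Ov pos F"
    and \<pi>: "\<And>k. k < n \<Longrightarrow> \<pi> k < n" and \<rho>: "\<And>k. k < n \<Longrightarrow> strict_mono (\<rho> k) \<and> surj (\<rho> k)"
    and shift: "\<And>k t m. k < n \<Longrightarrow> \<rho> k (t + of_int m) = \<rho> k t + of_int m"
    and Ov': "\<And>p q. Ov' p q \<Longrightarrow> fst p < n \<and> fst q < n \<and> Ov (reparam n \<pi> \<rho> p) (reparam n \<pi> \<rho> q) \<and>
        (pos (reparam n \<pi> \<rho> p) (reparam n \<pi> \<rho> q) \<longleftrightarrow> pos' p q)"
    and cl: "\<And>p. fst p < n \<Longrightarrow> reparam n \<pi> \<rho> p \<in> classical_of Ov \<Longrightarrow> p \<in> classical_of Ov'"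
  shows "param_coloring X ut ot n Ov' pos' (\<lambda>p. F (reparam n \<pi> \<rho> p))"
  unfolding param_coloring_def
proof (intro conjI allI impI)
  fix p :: param assume p: "fst p < n" "p \<notin> classical_of Ov'"
  have R: "fst (reparam n \<pi> \<rho> p) < n" "reparam n \<pi> \<rho> p \<notin> classical_of Ov"
    using p(1) \<pi>[OF p(1)] cl[OF p(1)] p(2) by (simp_all add: reparam_def) blast
  show "F (reparam n \<pi> \<rho> p) \<in> X" using param_coloring_in[OF F R] .
  have "\<forall>\<^sub>F y in nhds (\<rho> (fst p) (snd p)). F (\<pi> (fst p), y) = F (reparam n \<pi> \<rho> p)"
    using param_coloring_local[OF F R] p(1) by (simp add: reparam_def)
  then show "\<forall>\<^sub>F s in nhds (snd p). F (reparam n \<pi> \<rho> (fst p, s)) = F (reparam n \<pi> \<rho> p)"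
    using \<rho>[OF p(1)] p(1) unfolding eventually_nhds_real_split
    by (auto simp: reparam_def intro: eventually_at_left_strict_mono[where P = "\<lambda>y. F (\<pi> (fst p), y) = _"]
        eventually_at_right_strict_mono[where P = "\<lambda>y. F (\<pi> (fst p), y) = _"])
next
  fix p q assume pq: "same_param p q"
  then obtain m where "q = (fst p, snd p + of_int m)" by (rule same_paramE)
  then have "same_param (reparam n \<pi> \<rho> p) (reparam n \<pi> \<rho> q)"
    by (cases p) (simp add: reparam_def shift)
  then show "F (reparam n \<pi> \<rho> p) = F (reparam n \<pi> \<rho> q)" by (rule param_coloring_same[OF F])
next
  fix p q assume pq: "Ov' p q"
  have b: "before (\<lambda>p. F (reparam n \<pi> \<rho> p)) p x" if "before F (reparam n \<pi> \<rho> p) x" "fst p < n" for p x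
    using that \<rho>[OF that(2)] unfolding before_def
    by (auto simp: reparam_def intro: eventually_at_left_strict_mono[where P = "\<lambda>y. F (\<pi> (fst p), y) = _"])
  have a: "after (\<lambda>p. F (reparam n \<pi> \<rho> p)) p x" if "after F (reparam n \<pi> \<rho> p) x" "fst p < n" for p x
    using that \<rho>[OF that(2)] unfolding after_def
    by (auto simp: reparam_def intro: eventually_at_right_strict_mono[where P = "\<lambda>y. F (\<pi> (fst p), y) = _"])
  show "\<exists>ob oa ub ua. before (\<lambda>p. F (reparam n \<pi> \<rho> p)) p ob \<and> after (\<lambda>p. F (reparam n \<pi> \<rho> p)) p oa \<and>
      before (\<lambda>p. F (reparam n \<pi> \<rho> p)) q ub \<and> after (\<lambda>p. F (reparam n \<pi> \<rho> p)) q ua \<and>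
      crossing_relation ut ot (pos' p q) ob oa ub ua"
  proof -
    note o = Ov'[OF pq]
    obtain ob oa ub ua where "before F (reparam n \<pi> \<rho> p) ob" "after F (reparam n \<pi> \<rho> p) oa"
      "before F (reparam n \<pi> \<rho> q) ub" "after F (reparam n \<pi> \<rho> q) ua"
      "crossing_relation ut ot (pos (reparam n \<pi> \<rho> p) (reparam n \<pi> \<rho> q)) ob oa ub ua"
      using param_coloring_crossing[OF F] o by blast
    then show ?thesis using o a b by (intro exI[of _ ob] exI[of _ oa] exI[of _ ub] exI[of _ ua]) simp
  qed
qed

lemma reparametrization_coloring_equivalent:
  assumes vld: "virtual_link_diagram D" "virtual_link_diagram E" and re: "reparametrization D E"
  shows "coloring_equivalent X ut ot D E"
proof -
  interpret D: link_diagram D by unfold_locales fact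
  interpret E: link_diagram E by unfold_locales fact
  define n where "n = ncomp D"
  obtain \<pi> \<rho> where n: "ncomp E = n" and \<pi>: "bij_betw \<pi> {..<n} {..<n}"
    and C1: "\<And>k. k < n \<Longrightarrow> \<rho> k C1_differentiable_on UNIV"
    and step: "\<And>k t. k < n \<Longrightarrow> \<rho> k (t + 1) = \<rho> k t + 1"
    and der: "\<And>k t. k < n \<Longrightarrow> deriv (\<rho> k) t > 0"
    and curve: "\<And>k t. k < n \<Longrightarrow> curve E k t = curve D (\<pi> k) (\<rho> k t)"
    and over: "\<And>k t. k < n \<Longrightarrow> (k, t) \<in> over E \<longleftrightarrow> (\<pi> k, \<rho> k t) \<in> over D"
    using re unfolding reparametrization_def n_def[symmetric] by (elim conjE exE) (rule that; simp)
  have \<pi>n: "\<pi> k < n" if "k < n" for k using \<pi> that by (auto simp: bij_betw_def)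
  have DERIV: "(\<rho> k has_real_derivative deriv (\<rho> k) t) (at t)" if "k < n" for k t
    using C1[OF that] by (auto simp: C1_differentiable_on_eq DERIV_deriv_iff_real_differentiable)
  have mono: "strict_mono (\<rho> k)" if "k < n" for k
    unfolding strict_mono_def using DERIV_pos_imp_increasing[of _ _ "\<rho> k"] DERIV[OF that] der[OF that] by blast
  have shift_nat: "\<rho> k (t + of_nat m) = \<rho> k t + of_nat m" if "k < n" for k t m
  proof (induction m)
    case (Suc m)
    have "\<rho> k (t + of_nat (Suc m)) = \<rho> k ((t + of_nat m) + 1)" by (simp add: algebra_simps)
    then show ?case using Suc step[OF that] by simp
  qed simp
  have shift: "\<rho> k (t + of_int m) = \<rho> k t + of_int m" if "k < n" for k t m
  proof (cases m)
    case (nonneg i)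
    then show ?thesis using shift_nat[OF that] by simp
  next
    case (neg i)
    then show ?thesis using shift_nat[OF that, of "t + of_int m" "Suc i"] by simp
  qed
  have surj: "surj (\<rho> k)" if "k < n" for k
  proof (rule surjI[of _ "\<lambda>y. SOME t. \<rho> k t = y"])
    fix y
    \<comment> \<open>On integers \<rho> is the shift by its value at 0, so the values at
      \<open>a\<close> and \<open>b\<close> enclose \<open>y\<close>.\<close>
    define a b where "a = \<lfloor>y - \<rho> k 0\<rfloor>" and "b = \<lceil>y - \<rho> k 0\<rceil>"
    have "\<rho> k (of_int a) \<le> y" "y \<le> \<rho> k (of_int b)"
      using shift[OF that, of 0 a] shift[OF that, of 0 b] by (simp_all add: a_def b_def) linarith+
    moreover have "continuous_on {of_int a..of_int b} (\<rho> k)"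
      using DERIV[OF that] by (intro continuous_at_imp_continuous_on) (auto intro: DERIV_isCont)
    ultimately have "\<exists>t. \<rho> k t = y"
      using IVT'[of "\<rho> k" "of_int a" y "of_int b"] by (force simp: a_def b_def)
    then show "\<rho> k (SOME t. \<rho> k t = y) = y" by (rule someI_ex)
  qed
  define R where "R = reparam n \<pi> \<rho>"
  define \<pi>' where "\<pi>' = inv_into {..<n} \<pi>"
  define \<rho>' where "\<rho>' k = inv_into UNIV (\<rho> (\<pi>' k))" for k
  define R' where "R' = reparam n \<pi>' \<rho>'"
  have \<pi>'n: "\<pi>' k < n" if "k < n" for k
    using bij_betw_inv_into[OF \<pi>] that by (auto simp: \<pi>'_def bij_betw_def)
  have \<pi>\<pi>': "\<pi> (\<pi>' k) = k" "\<pi>' (\<pi> k) = k" if "k < n" for k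
    using \<pi> that by (auto simp: \<pi>'_def bij_betw_def f_inv_into_f)
  have inj: "inj (\<rho> k)" if "k < n" for k using mono[OF that] by (rule strict_mono_imp_inj_on)
  have \<rho>\<rho>': "\<rho> (\<pi>' k) (\<rho>' k y) = y" if "k < n" for k y
    using surj[OF \<pi>'n[OF that]] by (simp add: \<rho>'_def surj_f_inv_f)
  have \<rho>'\<rho>: "\<rho>' (\<pi> k) (\<rho> k t) = t" if "k < n" for k t
    using inj[OF that] that by (simp add: \<rho>'_def \<pi>\<pi>')
  have RR': "R (R' p) = p" and R'R: "R' (R p) = p" for p
    by (auto simp: R_def R'_def reparam_def \<pi>n \<pi>'n \<pi>\<pi>' \<rho>\<rho>' \<rho>'\<rho>)
  have fstR: "fst (R p) < n \<longleftrightarrow> fst p < n" and fstR': "fst (R' p) < n \<longleftrightarrow> fst p < n" for p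
    by (auto simp: R_def R'_def reparam_def \<pi>n \<pi>'n)
  have pD: "p \<in> params D \<longleftrightarrow> fst p < n" and pE: "p \<in> params E \<longleftrightarrow> fst p < n" for p
    by (auto simp: D.params_iff E.params_iff n n_def)
  have pt: "point E p = point D (R p)" if "fst p < n" for p
    using that by (simp add: point_def R_def reparam_def curve)
  have ovr: "p \<in> over E \<longleftrightarrow> R p \<in> over D" if "fst p < n" for p
    using that over[OF that, of "snd p"] by (simp add: R_def reparam_def)
  have "same_param (R p) (R q)" if "same_param p q" "fst p < n" for p q
    using that by (auto elim!: same_paramE simp: R_def reparam_def shift)
  moreover have "same_param p q" if "same_param (R p) (R q)" "fst p < n" "fst q < n" for p q
  proof -
    from that(1) obtain m where m: "R q = (fst (R p), snd (R p) + of_int m)" by (rule same_paramE)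
    then have "\<pi> (fst q) = \<pi> (fst p)" using that(2,3) by (simp add: R_def reparam_def)
    then have k: "fst q = fst p" using \<pi>\<pi>'(2) that(2,3) by metis
    then have "\<rho> (fst p) (snd q) = \<rho> (fst p) (snd p + of_int m)"
      using m that(2,3) by (simp add: R_def reparam_def shift)
    then have "snd q = snd p + of_int m" using inj[OF that(2)] by (simp add: inj_eq)
    then show ?thesis using k by (simp add: same_param_def)
  qed
  ultimately have same: "same_param (R p) (R q) \<longleftrightarrow> same_param p q" if "fst p < n" "fst q < n" for p q
    using that by blast
  have ov: "over_at E p q \<longleftrightarrow> over_at D (R p) (R q)" for p q
  proof (cases "fst p < n \<and> fst q < n")
    case True
    then show ?thesis by (auto simp: over_at_def crossing_def pD pE fstR pt ovr same)
  next
    case False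
    then show ?thesis by (auto simp: over_at_def crossing_def pD pE fstR)
  qed
  have vel: "velocity E p = deriv (\<rho> (fst p)) (snd p) *\<^sub>R velocity D (R p)" if "fst p < n" for p
  proof -
    obtain k t where kt: "p = (k, t)" by force
    then have k: "k < n" using that by simp
    have "(curve D (\<pi> k) has_vector_derivative velocity D (R p)) (at (\<rho> k t))"
      using D.differentiable[of "\<pi> k"] \<pi>n[OF k] k
      by (simp add: velocity_def R_def reparam_def kt n_def vector_derivative_works[symmetric])
    from vector_diff_chain_at[of "\<rho> k" "deriv (\<rho> k) t" t, OF _ this] DERIV[OF k, of t]
    have "(curve D (\<pi> k) \<circ> \<rho> k has_vector_derivative deriv (\<rho> k) t *\<^sub>R velocity D (R p)) (at t)"
      by (simp add: has_real_derivative_iff_has_vector_derivative)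
    moreover have "curve D (\<pi> k) \<circ> \<rho> k = curve E k" using curve[OF k] by (simp add: fun_eq_iff)
    ultimately show ?thesis by (simp add: velocity_def kt vector_derivative_at)
  qed
  have pos: "positive_at E p q \<longleftrightarrow> positive_at D (R p) (R q)" if "fst p < n" "fst q < n" for p q
  proof -
    have "cross (velocity E p) (velocity E q) = deriv (\<rho> (fst p)) (snd p) * deriv (\<rho> (fst q)) (snd q) *
        cross (velocity D (R p)) (velocity D (R q))"
      by (simp add: vel that cross_def algebra_simps)
    then show ?thesis
      using mult_pos_pos[OF der[OF that(1), of "snd p"] der[OF that(2), of "snd q"]]
      unfolding positive_at_def by (metis mult_pos_pos zero_less_mult_pos)
  qed
  have clE: "p \<in> classical_of (over_at E) \<longleftrightarrow> R p \<in> classical_of (over_at D)" for p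
    unfolding classical_of_def mem_Collect_eq ov using RR' by metis
  have ovn: "over_at E p q \<Longrightarrow> fst p < n \<and> fst q < n" "over_at D p q \<Longrightarrow> fst p < n \<and> fst q < n" for p q
    by (auto simp: over_at_def crossing_def pD pE)
  show ?thesis
  proof (rule coloring_equivalent_transfer[OF vld, where A = "{(R q, q) | q. q \<in> params E - classical_params E}"])
    show "{(R q, q) |q. q \<in> params E - classical_params E}
        \<subseteq> (params D - classical_params D) \<times> (params E - classical_params E)"
      unfolding classical_params_eq using clE by (auto simp: pD pE fstR)
  next
    fix F assume F: "diagram_coloring X ut ot D F"
    have "param_coloring X ut ot n (over_at E) (positive_at E) (\<lambda>p. F (R p))"
      unfolding R_def
      by (rule param_coloring_reparam[OF F[folded n_def]])
        (use \<pi>n mono surj shift ovn ov pos clE in \<open>auto simp: R_def[symmetric]\<close>)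
    then show "\<exists>G. diagram_coloring X ut ot E G \<and> (\<forall>(p, q)\<in>{(R q, q) |q. q \<in> params E - classical_params E}. F p = G q)"
      unfolding n by (intro exI[of _ "\<lambda>p. F (R p)"]) auto
  next
    fix G assume G: "diagram_coloring X ut ot E G"
    have ov': "over_at D p q \<longleftrightarrow> over_at E (R' p) (R' q)" for p q by (simp add: ov RR')
    have pos': "positive_at E (R' p) (R' q) \<longleftrightarrow> positive_at D p q" if "fst p < n" "fst q < n" for p q
      using pos[of "R' p" "R' q"] that by (simp add: fstR' RR')
    have \<rho>': "strict_mono (\<rho>' k) \<and> surj (\<rho>' k)" if "k < n" for k
    proof
      have k: "\<pi>' k < n" using \<pi>'n[OF that] .
      show "strict_mono (\<rho>' k)"
        unfolding strict_mono_def using strict_mono_less[OF mono[OF k]] \<rho>\<rho>'[OF that] by metis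
      show "surj (\<rho>' k)" using inj[OF k] by (simp add: \<rho>'_def inj_imp_surj_inv)
    qed
    have shift': "\<rho>' k (y + of_int m) = \<rho>' k y + of_int m" if "k < n" for k y m
    proof -
      have "\<rho> (\<pi>' k) (\<rho>' k y + of_int m) = y + of_int m"
        using shift[OF \<pi>'n[OF that]] \<rho>\<rho>'[OF that] by simp
      then show ?thesis using \<rho>\<rho>'[OF that] inj[OF \<pi>'n[OF that]] by (metis injD)
    qed
    have "param_coloring X ut ot n (over_at D) (positive_at D) (\<lambda>p. G (R' p))"
      unfolding R'_def
    proof (rule param_coloring_reparam[OF G[unfolded n]])
      fix p q assume "over_at D p q"
      then show "fst p < n \<and> fst q < n \<and> over_at E (reparam n \<pi>' \<rho>' p) (reparam n \<pi>' \<rho>' q) \<and>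
        (positive_at E (reparam n \<pi>' \<rho>' p) (reparam n \<pi>' \<rho>' q) \<longleftrightarrow> positive_at D p q)"
        using ovn(2) ov' pos' unfolding R'_def[symmetric] by blast
    next
      fix p assume "reparam n \<pi>' \<rho>' p \<in> classical_of (over_at E)"
      then show "p \<in> classical_of (over_at D)" by (simp add: clE RR' R'_def[symmetric])
    qed (use \<pi>'n \<rho>' shift' in auto)
    then show "\<exists>F. diagram_coloring X ut ot D F \<and> (\<forall>(p, q)\<in>{(R q, q) |q. q \<in> params E - classical_params E}. F p = G q)"
      unfolding n_def[symmetric] by (intro exI[of _ "\<lambda>p. G (R' p)"]) (auto simp: R'R)
  next
    fix F F' p assume "\<forall>(p, q)\<in>{(R q, q) |q. q \<in> params E - classical_params E}. F p = F' p"
      and p: "p \<in> params D" "p \<notin> classical_params D"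
    then have "F (R q) = F' (R q)" if "q \<in> params E" "q \<notin> classical_params E" for q using that by blast
    from this[of "R' p"] show "F p = F' p"
      using p unfolding classical_params_eq clE RR' by (simp add: pD pE fstR')
  qed blast
qed

section \<open>Crossings as relations\<close>

text \<open>In strand coordinates both strands of a crossing are traversed by increasing \<open>u\<close>: \<open>l\<close> and \<open>r\<close>
  are the colors for smaller and larger \<open>u\<close>, \<open>ei\<close> and \<open>ej\<close> tell whether the orientation agrees with
  that direction, and \<open>c\<close> is the sign of the crossing with respect to it. Strand \<open>i\<close> is on top.\<close>

definition strand_crossing ::
  "('x \<Rightarrow> 'x \<Rightarrow> 'x) \<Rightarrow> ('x \<Rightarrow> 'x \<Rightarrow> 'x) \<Rightarrow> bool \<Rightarrow> bool \<Rightarrow> bool \<Rightarrow> 'x \<Rightarrow> 'x \<Rightarrow> 'x \<Rightarrow> 'x \<Rightarrow> bool" where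
  "strand_crossing ut ot c ei ej li ri lj rj \<longleftrightarrow>
     crossing_relation ut ot (c = (ei = ej)) (if ei then li else ri) (if ei then ri else li)
       (if ej then lj else rj) (if ej then rj else lj)"

text \<open>Reversing the over-strand exchanges its two sides, hence the roles of the two under
  colors. The over colors are sorted by the sides of the under-strand, which stay as they
  are.\<close>

lemma strand_crossing_flip_over:
  "strand_crossing ut ot c (\<not> ei) ej li ri lj rj = strand_crossing ut ot c ei ej li ri rj lj"
  by (auto simp: strand_crossing_def crossing_relation_def)

lemma strand_crossing_flip_under:
  "strand_crossing ut ot c ei (\<not> ej) li ri lj rj = strand_crossing ut ot c ei ej ri li lj rj"
  by (auto simp: strand_crossing_def crossing_relation_def)

text \<open>Changing the sign alone mirrors the picture, which exchanges the sides of both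
  strands.\<close>

lemma strand_crossing_flip_sign:
  "strand_crossing ut ot (\<not> c) ei ej li ri lj rj = strand_crossing ut ot c ei ej ri li rj lj"
  by (auto simp: strand_crossing_def crossing_relation_def)

text \<open>The colors of any two semi-arcs of a crossing that belong to different strands determine the
  other two.\<close>

definition determined_by_neighbours :: "'x set \<Rightarrow> ('x \<Rightarrow> 'x \<Rightarrow> 'x \<Rightarrow> 'x \<Rightarrow> bool) \<Rightarrow> bool" where
  "determined_by_neighbours X R \<longleftrightarrow>
     (\<forall>p\<in>X. \<forall>q\<in>X. (\<exists>s\<in>X. \<exists>t\<in>X. R p s q t) \<and> (\<exists>s\<in>X. \<exists>t\<in>X. R p s t q) \<and>
       (\<exists>s\<in>X. \<exists>t\<in>X. R s p q t) \<and> (\<exists>s\<in>X. \<exists>t\<in>X. R s p t q)) \<and>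
     (\<forall>a\<in>X. \<forall>b\<in>X. \<forall>c\<in>X. \<forall>d\<in>X. \<forall>a'\<in>X. \<forall>b'\<in>X. \<forall>c'\<in>X. \<forall>d'\<in>X.
       R a b c d \<longrightarrow> R a' b' c' d' \<longrightarrow> (a = a' \<or> b = b') \<longrightarrow> (c = c' \<or> d = d') \<longrightarrow>
       a = a' \<and> b = b' \<and> c = c' \<and> d = d')"

lemma neighbours_exist:
  assumes "determined_by_neighbours X R" "p \<in> X" "q \<in> X"
  shows "\<exists>s\<in>X. \<exists>t\<in>X. R p s q t" "\<exists>s\<in>X. \<exists>t\<in>X. R p s t q" "\<exists>s\<in>X. \<exists>t\<in>X. R s p q t" "\<exists>s\<in>X. \<exists>t\<in>X. R s p t q"
  using assms unfolding determined_by_neighbours_def by simp_all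

lemma neighbours_unique:
  assumes "determined_by_neighbours X R" "R a b c d" "R a' b' c' d'" "a = a' \<or> b = b'" "c = c' \<or> d = d'"
    "{a, b, c, d, a', b', c', d'} \<subseteq> X"
  shows "a = a' \<and> b = b' \<and> c = c' \<and> d = d'"
  using assms(1)[unfolded determined_by_neighbours_def, THEN conjunct2, rule_format, of a b c d a' b' c' d'] assms(2-6)
  by simp

lemma determined_by_neighboursI:
  assumes "\<And>p q. p \<in> X \<Longrightarrow> q \<in> X \<Longrightarrow> \<exists>s\<in>X. \<exists>t\<in>X. R p s q t" "\<And>p q. p \<in> X \<Longrightarrow> q \<in> X \<Longrightarrow> \<exists>s\<in>X. \<exists>t\<in>X. R p s t q"
    "\<And>p q. p \<in> X \<Longrightarrow> q \<in> X \<Longrightarrow> \<exists>s\<in>X. \<exists>t\<in>X. R s p q t" "\<And>p q. p \<in> X \<Longrightarrow> q \<in> X \<Longrightarrow> \<exists>s\<in>X. \<exists>t\<in>X. R s p t q"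
    "\<And>a b c d a' b' c' d'. {a, b, c, d, a', b', c', d'} \<subseteq> X \<Longrightarrow> R a b c d \<Longrightarrow> R a' b' c' d' \<Longrightarrow>
      a = a' \<or> b = b' \<Longrightarrow> c = c' \<or> d = d' \<Longrightarrow> a = a' \<and> b = b' \<and> c = c' \<and> d = d'"
  shows "determined_by_neighbours X R"
  unfolding determined_by_neighbours_def
proof (rule conjI)
  show "\<forall>p\<in>X. \<forall>q\<in>X. (\<exists>s\<in>X. \<exists>t\<in>X. R p s q t) \<and> (\<exists>s\<in>X. \<exists>t\<in>X. R p s t q) \<and>
       (\<exists>s\<in>X. \<exists>t\<in>X. R s p q t) \<and> (\<exists>s\<in>X. \<exists>t\<in>X. R s p t q)"
    by (intro ballI conjI) (rule assms; assumption)+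
qed (intro ballI impI, rule assms(5), simp_all)

lemma determined_by_neighbours_swap:
  assumes det: "determined_by_neighbours X R"
  shows "determined_by_neighbours X (\<lambda>a b c d. R b a c d)" (is ?A)
    and "determined_by_neighbours X (\<lambda>a b c d. R a b d c)" (is ?B)
    and "determined_by_neighbours X (\<lambda>a b c d. R c d a b)" (is ?C)
proof -
  note ex = neighbours_exist[OF det]
  show ?A
  proof (rule determined_by_neighboursI)
    fix a b c d a' b' c' d'
    assume X: "{a, b, c, d, a', b', c', d'} \<subseteq> X" and r: "R b a c d" "R b' a' c' d'" and eq: "a = a' \<or> b = b'" "c = c' \<or> d = d'"
    have "b = b' \<and> a = a' \<and> c = c' \<and> d = d'"
      by (rule neighbours_unique[OF det r]) (use X eq in blast)+
    then show "a = a' \<and> b = b' \<and> c = c' \<and> d = d'" by blast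
  qed (rule ex; assumption)+
  show ?B
  proof (rule determined_by_neighboursI)
    fix a b c d a' b' c' d'
    assume X: "{a, b, c, d, a', b', c', d'} \<subseteq> X" and r: "R a b d c" "R a' b' d' c'" and eq: "a = a' \<or> b = b'" "c = c' \<or> d = d'"
    have "a = a' \<and> b = b' \<and> d = d' \<and> c = c'"
      by (rule neighbours_unique[OF det r]) (use X eq in blast)+
    then show "a = a' \<and> b = b' \<and> c = c' \<and> d = d'" by blast
  qed (rule ex; assumption)+
  show ?C
  proof (rule determined_by_neighboursI)
    fix a b c d a' b' c' d'
    assume X: "{a, b, c, d, a', b', c', d'} \<subseteq> X" and r: "R c d a b" "R c' d' a' b'" and eq: "a = a' \<or> b = b'" "c = c' \<or> d = d'"
    have "c = c' \<and> d = d' \<and> a = a' \<and> b = b'"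
      by (rule neighbours_unique[OF det r]) (use X eq in blast)+
    then show "a = a' \<and> b = b' \<and> c = c' \<and> d = d'" by blast
  next
    fix p q assume pq: "p \<in> X" "q \<in> X"
    show "\<exists>s\<in>X. \<exists>t\<in>X. R q t p s" using ex(1)[OF pq(2,1)] by blast
    show "\<exists>s\<in>X. \<exists>t\<in>X. R t q p s" using ex(3)[OF pq(2,1)] by blast
    show "\<exists>s\<in>X. \<exists>t\<in>X. R q t s p" using ex(2)[OF pq(2,1)] by blast
    show "\<exists>s\<in>X. \<exists>t\<in>X. R t q s p" using ex(4)[OF pq(2,1)] by blast
  qed
qed

lemma bij_betw_ex1:
  assumes "bij_betw f A B" "b \<in> B"
  shows "\<exists>!a. a \<in> A \<and> f a = b"
proof -
  obtain a where "a \<in> A" "f a = b" using assms bij_betw_imp_surj_on by blast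
  then show ?thesis using inj_onD[OF bij_betw_imp_inj_on[OF assms(1)]] by (intro ex1I[of _ a]) auto
qed

section \<open>Consequences of the biquandle axioms for a single crossing\<close>

locale finite_biquandle =
  fixes X :: "'x set" and ut ot :: "'x \<Rightarrow> 'x \<Rightarrow> 'x"
  assumes fin: "finite X" and bq: "biquandle X ut ot"
begin

lemma closed: "x \<in> X \<Longrightarrow> y \<in> X \<Longrightarrow> ut x y \<in> X" "x \<in> X \<Longrightarrow> y \<in> X \<Longrightarrow> ot x y \<in> X"
  using bq by (auto simp: biquandle_def)

lemma diagonal: "x \<in> X \<Longrightarrow> ut x x = ot x x"
  using bq by (simp add: biquandle_def)

lemma bij_ot: "y \<in> X \<Longrightarrow> bij_betw (\<lambda>x. ot x y) X X"
  and bij_ut: "y \<in> X \<Longrightarrow> bij_betw (\<lambda>x. ut x y) X X"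
  and bij_S: "bij_betw (\<lambda>(x, y). (ot y x, ut x y)) (X \<times> X) (X \<times> X)"
  using bq by (simp_all add: biquandle_def)

lemma exchange:
  assumes "x \<in> X" "y \<in> X" "z \<in> X"
  shows "ut (ut x y) (ut z y) = ut (ut x z) (ot y z)"
    "ot (ut x y) (ut z y) = ut (ot x z) (ot y z)"
    "ot (ot x y) (ot z y) = ot (ot x z) (ut y z)"
  using bq assms by (auto simp: biquandle_def)

lemma ex1_ut: "y \<in> X \<Longrightarrow> w \<in> X \<Longrightarrow> \<exists>!x. x \<in> X \<and> ut x y = w"
  by (rule bij_betw_ex1[OF bij_ut])

lemma ex1_ot: "x \<in> X \<Longrightarrow> z \<in> X \<Longrightarrow> \<exists>!y. y \<in> X \<and> ot y x = z"
  by (rule bij_betw_ex1[OF bij_ot])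

lemma S_inject:
  assumes "x \<in> X" "y \<in> X" "x' \<in> X" "y' \<in> X" "ot y x = ot y' x'" "ut x y = ut x' y'"
  shows "x = x'" "y = y'"
  using bij_betw_imp_inj_on[OF bij_S] assms by (auto simp: inj_on_def)

lemma S_surj:
  assumes "z \<in> X" "w \<in> X"
  obtains x y where "x \<in> X" "y \<in> X" "ot y x = z" "ut x y = w"
proof -
  have "(z, w) \<in> (\<lambda>(x, y). (ot y x, ut x y)) ` (X \<times> X)"
    using bij_betw_imp_surj_on[OF bij_S] assms by simp
  then show thesis using that by auto
qed

text \<open>The four pairs of neighbours match the parts of the biquandle structure: from
  \<open>y\<close>, \<open>x\<close> one computes with the operations; \<open>y\<close>,
  \<open>w\<close> needs invertibility of \<open>ut\<close>, and \<open>z\<close>, \<open>x\<close>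
  that of \<open>ot\<close>; for \<open>z\<close>, \<open>w\<close> the map \<open>S\<close> is
  inverted.\<close>

lemma determined_by_neighbours_base:
  "determined_by_neighbours X (\<lambda>y z x w. w = ut x y \<and> z = ot y x)"
proof (rule determined_by_neighboursI)
  fix p q assume pq: "p \<in> X" "q \<in> X"
  show "\<exists>s\<in>X. \<exists>t\<in>X. t = ut q p \<and> s = ot p q" using pq closed by auto
  obtain x where "x \<in> X" "ut x p = q" using ex1_ut[OF pq] by blast
  then show "\<exists>s\<in>X. \<exists>t\<in>X. q = ut t p \<and> s = ot p t" using closed(2)[OF pq(1)] by blast
  obtain y where "y \<in> X" "ot y q = p" using ex1_ot[OF pq(2,1)] by blast
  then show "\<exists>s\<in>X. \<exists>t\<in>X. t = ut q s \<and> p = ot s q" using closed(1)[OF pq(2)] by blast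
  obtain x y where "x \<in> X" "y \<in> X" "ot y x = p" "ut x y = q" using S_surj[OF pq] .
  then show "\<exists>s\<in>X. \<exists>t\<in>X. q = ut t s \<and> p = ot s t" by blast
next
  fix y z x w y' z' x' w'
  assume X: "{y, z, x, w, y', z', x', w'} \<subseteq> X" and rel: "w = ut x y \<and> z = ot y x" "w' = ut x' y' \<and> z' = ot y' x'"
    and eq: "y = y' \<or> z = z'" "x = x' \<or> w = w'"
  have X': "x \<in> X" "y \<in> X" "x' \<in> X" "y' \<in> X" using X by auto
  have 1: "x = x'" if "y = y'" "w = w'"
  proof (rule inj_onD[OF bij_betw_imp_inj_on[OF bij_ut[OF X'(2)]] _ X'(1,3)])
    show "ut x y = ut x' y" using rel that by metis
  qed
  have 2: "y = y'" if "x = x'" "z = z'"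
  proof (rule inj_onD[OF bij_betw_imp_inj_on[OF bij_ot[OF X'(1)]] _ X'(2,4)])
    show "ot y x = ot y' x" using rel that by metis
  qed
  have 3: "x = x'" "y = y'" if "z = z'" "w = w'"
    using S_inject[OF X'] rel that by metis+
  have "y = y' \<and> x = x'" using 1 2 3 eq by blast
  then show "y = y' \<and> z = z' \<and> x = x' \<and> w = w'" using rel by simp
qed

lemma determined_by_neighbours_crossing:
  "determined_by_neighbours X (strand_crossing ut ot c ei ej)"
proof -
  \<comment> \<open>Sign and orientations only decide, for each strand, whether its two colors trade
    places in the basic relation.\<close>
  have eq: "strand_crossing ut ot c ei ej =
    (\<lambda>a b c' d. (\<lambda>y z x w. w = ut x y \<and> z = ot y x) (if c = ej then b else a) (if c = ej then a else b) 
       (if c = ei then c' else d) (if c = ei then d else c'))"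
    by (auto simp: fun_eq_iff strand_crossing_def crossing_relation_def)
  note base = determined_by_neighbours_base
  note sw = determined_by_neighbours_swap
  show ?thesis
    unfolding eq
    using base sw(1)[OF base] sw(2)[OF base] sw(2)[OF sw(1)[OF base]]
    by (cases "c = ej"; cases "c = ei") simp_all
qed

text \<open>By axiom (1) the map \<open>S\<close> sends the diagonal into the diagonal, acting there
  as \<open>\<lambda>b. ut b b\<close>. This map inherits injectivity from \<open>S\<close>, and an
  injective self-map of a finite set is onto.\<close>

lemma kink:
  assumes "a \<in> X"
  shows "\<exists>!b. b \<in> X \<and> ut b b = a"
proof -
  have "inj_on (\<lambda>b. ut b b) X"
    by (rule inj_onI) (use S_inject diagonal in metis)
  moreover have "(\<lambda>b. ut b b) ` X \<subseteq> X" using closed by auto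
  ultimately have "bij_betw (\<lambda>b. ut b b) X X" using fin by (simp add: bij_betw_def endo_inj_surj)
  then show ?thesis using assms by (rule bij_betw_ex1)
qed

text \<open>If \<open>S\<close> sends \<open>(x, y)\<close> to the diagonal, then by
  \<open>kink\<close> some \<open>(b, b)\<close> has the same image, and injectivity of
  \<open>S\<close> gives \<open>x = b = y\<close>. For the curl this shows that the two outer colors
  are equal.\<close>

lemma ut_eq_ot_iff:
  assumes "x \<in> X" "y \<in> X"
  shows "ut x y = ot y x \<longleftrightarrow> x = y"
proof
  assume eq: "ut x y = ot y x"
  obtain b where b: "b \<in> X" "ut b b = ut x y" using kink closed assms by metis
  have "ot y x = ot b b" "ut x y = ut b b" using eq b(2) diagonal[OF b(1)] by metis+
  then show "x = y" using S_inject[OF assms b(1) b(1)] by metis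
qed (use diagonal assms in auto)

end

subsection \<open>The third Reidemeister move\<close>

text \<open>\<open>A\<close>, \<open>B\<close> and \<open>C\<close> are the relations at the crossings of the strands 0 and 1, 1 and 2, and 0
  and 2. Strand \<open>i\<close> enters with color \<open>ai\<close>, leaves with color \<open>bi\<close> and has color \<open>mi\<close> in between.\<close>

definition triangle_move :: "'x set \<Rightarrow> ('x \<Rightarrow> 'x \<Rightarrow> 'x \<Rightarrow> 'x \<Rightarrow> bool) \<Rightarrow> ('x \<Rightarrow> 'x \<Rightarrow> 'x \<Rightarrow> 'x \<Rightarrow> bool) \<Rightarrow>
    ('x \<Rightarrow> 'x \<Rightarrow> 'x \<Rightarrow> 'x \<Rightarrow> bool) \<Rightarrow> bool" where
  "triangle_move X A B C \<longleftrightarrow>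
     (\<forall>a0\<in>X. \<forall>b0\<in>X. \<forall>a1\<in>X. \<forall>b1\<in>X. \<forall>a2\<in>X. \<forall>b2\<in>X. \<forall>m0\<in>X. \<forall>m1\<in>X. \<forall>m2\<in>X.
        A a0 m0 m1 b1 \<longrightarrow> B a1 m1 a2 m2 \<longrightarrow> C m0 b0 m2 b2 \<longrightarrow>
        (\<exists>m0'\<in>X. \<exists>m1'\<in>X. \<exists>m2'\<in>X. C a0 m0' a2 m2' \<and> A m0' b0 a1 m1' \<and> B m1' b1 m2' b2))"

lemma triangle_moveD:
  assumes "triangle_move X A B C" "{a0, b0, a1, b1, a2, b2, m0, m1, m2} \<subseteq> X"
    "A a0 m0 m1 b1" "B a1 m1 a2 m2" "C m0 b0 m2 b2"
  shows "\<exists>m0'\<in>X. \<exists>m1'\<in>X. \<exists>m2'\<in>X. C a0 m0' a2 m2' \<and> A m0' b0 a1 m1' \<and> B m1' b1 m2' b2"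
  using assms(1)[unfolded triangle_move_def, rule_format, of a0 b0 a1 b1 a2 b2 m0 m1 m2] assms(2-5) by auto

text \<open>The classical trick that derives one version of the move from another, whose strand \<open>i\<close> is
  reversed, by means of the second Reidemeister move: reversing strand \<open>i\<close> exchanges the two colors of
  the other strand at each of its crossings, and the auxiliary crossing is one of the two others.\<close>

lemma triangle_move_flip2:
  assumes tm: "triangle_move X A B C" and A: "determined_by_neighbours X A"
  shows "triangle_move X A (\<lambda>a b c d. B b a c d) (\<lambda>a b c d. C b a c d)"
  unfolding triangle_move_def
proof (intro ballI impI)
  fix a0 b0 a1 b1 a2 b2 m0 m1 m2
  assume X: "a0 \<in> X" "b0 \<in> X" "a1 \<in> X" "b1 \<in> X" "a2 \<in> X" "b2 \<in> X" "m0 \<in> X" "m1 \<in> X" "m2 \<in> X"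
    and rel: "A a0 m0 m1 b1" "B m1 a1 a2 m2" "C b0 m0 m2 b2"
  \<comment> \<open>Half of an inserted bigon between the strands 0 and 1: an \<open>A\<close>
    crossing next to the given colors \<open>b0\<close> and \<open>a1\<close>. With it the known
    version of the move becomes applicable.\<close>
  obtain p q where pq: "p \<in> X" "q \<in> X" "A p b0 a1 q"
    using neighbours_exist(3)[OF A X(2,3)] by blast
  obtain m0' m1' m2' where m': "m0' \<in> X" "m1' \<in> X" "m2' \<in> X" "C p m0' a2 m2'" "A m0' m0 m1 m1'" "B m1' q m2' b2"
    using triangle_moveD[OF tm, OF _ pq(3) rel(2,3)] X pq by (simp, blast)
  \<comment> \<open>The crossing produced by the known move and the original one share
    \<open>m0\<close> and \<open>m1\<close>, hence agree: the bigon cancels.\<close>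
  have "m0' = a0 \<and> m1' = b1"
    using neighbours_unique[OF A m'(5) rel(1)] X m' by simp
  note eqs = this
  show "\<exists>m0'\<in>X. \<exists>m1'\<in>X. \<exists>m2'\<in>X. C m0' a0 a2 m2' \<and> A m0' b0 a1 m1' \<and> B b1 m1' m2' b2"
    by (rule bexI[of _ p], rule bexI[of _ q], rule bexI[of _ m2']) (use m' pq eqs in auto)
qed

text \<open>The same trick with a bigon of the strands 0 and 2 at the ends where they enter.\<close>

lemma triangle_move_flip1:
  assumes tm: "triangle_move X A B C" and C: "determined_by_neighbours X C"
  shows "triangle_move X (\<lambda>a b c d. A b a c d) (\<lambda>a b c d. B a b d c) C"
  unfolding triangle_move_def
proof (intro ballI impI)
  fix a0 b0 a1 b1 a2 b2 m0 m1 m2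
  assume X: "a0 \<in> X" "b0 \<in> X" "a1 \<in> X" "b1 \<in> X" "a2 \<in> X" "b2 \<in> X" "m0 \<in> X" "m1 \<in> X" "m2 \<in> X"
    and rel: "A m0 a0 m1 b1" "B a1 m1 m2 a2" "C m0 b0 m2 b2"
  obtain p q where pq: "p \<in> X" "q \<in> X" "C a0 p a2 q"
    using neighbours_exist(1)[OF C X(1,5)] by blast
  obtain m0' m1' m2' where m': "m0' \<in> X" "m1' \<in> X" "m2' \<in> X" "C m0 m0' m2 m2'" "A m0' p a1 m1'" "B m1' b1 m2' q"
    using triangle_moveD[OF tm, OF _ rel(1,2) pq(3)] X pq by (simp, blast)
  have "m0' = b0 \<and> m2' = b2"
    using neighbours_unique[OF C m'(4) rel(3)] X m' by simp
  note eqs = this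
  show "\<exists>m0'\<in>X. \<exists>m1'\<in>X. \<exists>m2'\<in>X. C a0 m0' a2 m2' \<and> A b0 m0' a1 m1' \<and> B m1' b1 b2 m2'"
    by (rule bexI[of _ p], rule bexI[of _ m1'], rule bexI[of _ q]) (use m' pq eqs in auto)
qed

text \<open>The same trick with a bigon of the strands 1 and 2 at the ends where they leave.\<close>

lemma triangle_move_flip0:
  assumes tm: "triangle_move X A B C" and B: "determined_by_neighbours X B"
  shows "triangle_move X (\<lambda>a b c d. A a b d c) B (\<lambda>a b c d. C a b d c)"
  unfolding triangle_move_def
proof (intro ballI impI)
  fix a0 b0 a1 b1 a2 b2 m0 m1 m2
  assume X: "a0 \<in> X" "b0 \<in> X" "a1 \<in> X" "b1 \<in> X" "a2 \<in> X" "b2 \<in> X" "m0 \<in> X" "m1 \<in> X" "m2 \<in> X"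
    and rel: "A a0 m0 b1 m1" "B a1 m1 a2 m2" "C m0 b0 b2 m2"
  obtain p q where pq: "p \<in> X" "q \<in> X" "B p b1 q b2"
    using neighbours_exist(4)[OF B X(4,6)] by blast
  obtain m0' m1' m2' where m': "m0' \<in> X" "m1' \<in> X" "m2' \<in> X" "C a0 m0' q m2'" "A m0' b0 p m1'" "B m1' m1 m2' m2"
    using triangle_moveD[OF tm, OF _ rel(1) pq(3) rel(3)] X pq by (simp, blast)
  have "m1' = a1 \<and> m2' = a2"
    using neighbours_unique[OF B m'(6) rel(2)] X m' by simp
  note eqs = this
  show "\<exists>m0'\<in>X. \<exists>m1'\<in>X. \<exists>m2'\<in>X. C a0 m0' m2' a2 \<and> A m0' b0 m1' a1 \<and> B m1' b1 m2' b2"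
    by (rule bexI[of _ m0'], rule bexI[of _ p], rule bexI[of _ q]) (use m' pq eqs in auto)
qed

text \<open>Reading all three strands backwards turns the picture after the move into the one before
  it, with entering and leaving colors exchanged. So the converse is the move itself for reversed
  strands.\<close>

lemma triangle_move_converse:
  assumes tm: "triangle_move X (\<lambda>a b c d. A b a d c) (\<lambda>a b c d. B b a d c) (\<lambda>a b c d. C b a d c)"
    and "{a0, b0, a1, b1, a2, b2, m0', m1', m2'} \<subseteq> X"
    "C a0 m0' a2 m2'" "A m0' b0 a1 m1'" "B m1' b1 m2' b2"
  shows "\<exists>m0\<in>X. \<exists>m1\<in>X. \<exists>m2\<in>X. A a0 m0 m1 b1 \<and> B a1 m1 a2 m2 \<and> C m0 b0 m2 b2"
proof -
  obtain m0 m1 m2 where "m0 \<in> X" "m1 \<in> X" "m2 \<in> X" "C m0 b0 m2 b2" "A a0 m0 m1 b1" "B a1 m1 a2 m2"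
    using triangle_moveD[OF tm, of b0 a0 b1 a1 b2 a2 m0' m1' m2'] assms(2-5) by auto
  then show ?thesis by blast
qed

text \<open>Allows the strands of a crossing to be listed in a fixed order whichever of them is on
  top; listing them the other way round negates the sign.\<close>

definition height_crossing ::
  "('x \<Rightarrow> 'x \<Rightarrow> 'x) \<Rightarrow> ('x \<Rightarrow> 'x \<Rightarrow> 'x) \<Rightarrow> bool \<Rightarrow> bool \<Rightarrow> bool \<Rightarrow> bool \<Rightarrow> 'x \<Rightarrow> 'x \<Rightarrow> 'x \<Rightarrow> 'x \<Rightarrow> bool" where
  "height_crossing ut ot iover c ei ej li ri lj rj \<longleftrightarrow>
     (if iover then strand_crossing ut ot c ei ej li ri lj rj
      else strand_crossing ut ot (\<not> c) ej ei lj rj li ri)"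

lemma height_crossing_flip:
  "height_crossing ut ot io c (\<not> ei) ej = (\<lambda>li ri lj rj. height_crossing ut ot io c ei ej li ri rj lj)"
  "height_crossing ut ot io c ei (\<not> ej) = (\<lambda>li ri lj rj. height_crossing ut ot io c ei ej ri li lj rj)"
  by (simp_all add: fun_eq_iff height_crossing_def strand_crossing_flip_over strand_crossing_flip_under)

lemma height_crossing_flip_sign:
  "height_crossing ut ot io (\<not> c) ei ej li ri lj rj = height_crossing ut ot io c ei ej ri li rj lj"
  unfolding height_crossing_def strand_crossing_flip_sign by simp

context finite_biquandle
begin

lemma determined_by_neighbours_height: "determined_by_neighbours X (height_crossing ut ot io c ei ej)"
proof -
  have "height_crossing ut ot io c ei ej = (if io then strand_crossing ut ot c ei ej
      else (\<lambda>li ri lj rj. strand_crossing ut ot (\<not> c) ej ei lj rj li ri))"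
    by (simp add: fun_eq_iff height_crossing_def)
  then show ?thesis
    using determined_by_neighbours_crossing determined_by_neighbours_swap(3)[OF determined_by_neighbours_crossing]
    by (cases io) simp_all
qed

text \<open>With these orientations the middle triangle lies to the right of all three strands, so that the
  colors of its sides determine all others, and the exchange laws apply directly.\<close>

lemma triangle_move_base:
  fixes h :: "nat \<Rightarrow> nat"
  assumes "inj_on h {..<3}"
  shows "triangle_move X (height_crossing ut ot (h 0 > h 1) False False False)
     (height_crossing ut ot (h 1 > h 2) True False True) (height_crossing ut ot (h 0 > h 2) False False True)"
  unfolding triangle_move_def
proof (intro ballI impI)
  fix a0 b0 a1 b1 a2 b2 m0 m1 m2
  assume X: "a0 \<in> X" "b0 \<in> X" "a1 \<in> X" "b1 \<in> X" "a2 \<in> X" "b2 \<in> X" "m0 \<in> X" "m1 \<in> X" "m2 \<in> X"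
    and rel: "height_crossing ut ot (h 0 > h 1) False False False a0 m0 m1 b1"
      "height_crossing ut ot (h 1 > h 2) True False True a1 m1 a2 m2"
      "height_crossing ut ot (h 0 > h 2) False False True m0 b0 m2 b2"
  have d: "h 0 \<noteq> h 1" "h 1 \<noteq> h 2" "h 0 \<noteq> h 2" using inj_onD[OF assms, of 0 1] inj_onD[OF assms, of 1 2] inj_onD[OF assms, of 0 2] by auto
  let ?o01 = "\<lambda>f g. if h 0 > h 1 then f else g" and ?o12 = "\<lambda>f g. if h 1 > h 2 then f else g"
    and ?o02 = "\<lambda>f g. if h 0 > h 2 then f else g"
  have eqs: "a0 = ?o01 (ot m0 m1) (ut m0 m1)" "b1 = ?o01 (ut m1 m0) (ot m1 m0)"
    "a1 = ?o12 (ot m1 m2) (ut m1 m2)" "a2 = ?o12 (ut m2 m1) (ot m2 m1)"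
    "b0 = ?o02 (ot m0 m2) (ut m0 m2)" "b2 = ?o02 (ut m2 m0) (ot m2 m0)"
    using rel by (auto simp: height_crossing_def strand_crossing_def crossing_relation_def)
  \<comment> \<open>Each new middle color is read off at one of its two crossings. That the other
    crossing gives the same value is one exchange law per strand: the first for the lowest strand,
    the second for the middle one, the third for the top one.\<close>
  let ?m0 = "?o01 (ot b0 a1) (ut b0 a1)" and ?m1 = "?o01 (ut a1 b0) (ot a1 b0)" and ?m2 = "?o02 (ut a2 a0) (ot a2 a0)"
  have mem: "?m0 \<in> X" "?m1 \<in> X" "?m2 \<in> X" using X closed by auto
  have "height_crossing ut ot (h 0 > h 2) False False True a0 ?m0 a2 ?m2 \<and>
      height_crossing ut ot (h 0 > h 1) False False False ?m0 b0 a1 ?m1 \<and>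
      height_crossing ut ot (h 1 > h 2) True False True ?m1 b1 ?m2 b2"
    unfolding eqs height_crossing_def strand_crossing_def crossing_relation_def
    using d X(7-9) by (auto simp: exchange)
  with mem show "\<exists>m0'\<in>X. \<exists>m1'\<in>X. \<exists>m2'\<in>X. height_crossing ut ot (h 0 > h 2) False False True a0 m0' a2 m2' \<and>
      height_crossing ut ot (h 0 > h 1) False False False m0' b0 a1 m1' \<and>
      height_crossing ut ot (h 1 > h 2) True False True m1' b1 m2' b2"
    by blast
qed

text \<open>All orders of heights are already covered by the base case; the eight choices of
  orientations are reached from it by reversing one strand at a time.\<close>

lemma triangle_move_heights:
  fixes h :: "nat \<Rightarrow> nat"
  assumes "inj_on h {..<3}"
  shows "triangle_move X (height_crossing ut ot (h 0 > h 1) False e0 e1)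
     (height_crossing ut ot (h 1 > h 2) True e1 e2) (height_crossing ut ot (h 0 > h 2) False e0 e2)"
proof -
  let ?P = "\<lambda>e0 e1 e2. triangle_move X (height_crossing ut ot (h 0 > h 1) False e0 e1)
     (height_crossing ut ot (h 1 > h 2) True e1 e2) (height_crossing ut ot (h 0 > h 2) False e0 e2)"
  note det = determined_by_neighbours_height
  have flip0: "?P e0 e1 e2 \<Longrightarrow> ?P (\<not> e0) e1 e2" for e0 e1 e2
    unfolding height_crossing_flip(1) by (rule triangle_move_flip0[OF _ det])
  have flip1: "?P e0 e1 e2 \<Longrightarrow> ?P e0 (\<not> e1) e2" for e0 e1 e2
    unfolding height_crossing_flip by (rule triangle_move_flip1[OF _ det])
  have flip2: "?P e0 e1 e2 \<Longrightarrow> ?P e0 e1 (\<not> e2)" for e0 e1 e2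
    unfolding height_crossing_flip(2) by (rule triangle_move_flip2[OF _ det])
  have base: "?P False False True" by (rule triangle_move_base[OF assms])
  show "?P e0 e1 e2"
    using base flip0[OF base] flip1[OF base] flip2[OF base] flip1[OF flip0[OF base]] flip2[OF flip0[OF base]]
      flip2[OF flip1[OF base]] flip2[OF flip1[OF flip0[OF base]]]
    by (cases e0; cases e1; cases e2) simp_all
qed

lemma triangle_move_heights_converse:
  fixes h :: "nat \<Rightarrow> nat"
  assumes "inj_on h {..<3}" "{a0, b0, a1, b1, a2, b2, m0', m1', m2'} \<subseteq> X"
    "height_crossing ut ot (h 0 > h 2) False e0 e2 a0 m0' a2 m2'"
    "height_crossing ut ot (h 0 > h 1) False e0 e1 m0' b0 a1 m1'"
    "height_crossing ut ot (h 1 > h 2) True e1 e2 m1' b1 m2' b2"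
  shows "\<exists>m0\<in>X. \<exists>m1\<in>X. \<exists>m2\<in>X. height_crossing ut ot (h 0 > h 1) False e0 e1 a0 m0 m1 b1 \<and>
    height_crossing ut ot (h 1 > h 2) True e1 e2 a1 m1 a2 m2 \<and>
    height_crossing ut ot (h 0 > h 2) False e0 e2 m0 b0 m2 b2"
proof -
  have "triangle_move X (\<lambda>a b c d. height_crossing ut ot (h 0 > h 1) False e0 e1 b a d c)
     (\<lambda>a b c d. height_crossing ut ot (h 1 > h 2) True e1 e2 b a d c)
     (\<lambda>a b c d. height_crossing ut ot (h 0 > h 2) False e0 e2 b a d c)"
    using triangle_move_heights[OF assms(1), of "\<not> e0" "\<not> e1" "\<not> e2"]
    unfolding height_crossing_flip by simp
  from triangle_move_converse[of X "height_crossing ut ot (h 0 > h 1) False e0 e1"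
      "height_crossing ut ot (h 1 > h 2) True e1 e2" "height_crossing ut ot (h 0 > h 2) False e0 e2", OF this assms(2-5)]
  show ?thesis .
qed

end

section \<open>Local changes\<close>

lemma before_same_param:
  assumes "\<And>p q. same_param p q \<Longrightarrow> F p = F q" "same_param p q" "before F p x"
  shows "before F q x"
proof -
  obtain m where q: "q = (fst p, snd p + of_int m)" using assms(2) by (rule same_paramE)
  have F: "F (fst p, s + of_int (- m)) = F (fst p, s)" for s
    by (rule assms(1)) (rule same_param_shift)
  have mono: "strict_mono (\<lambda>s::real. s + of_int (- m))" by (auto simp: strict_mono_def)
  have surj: "surj (\<lambda>s::real. s + of_int (- m))" by (rule surjI[of _ "\<lambda>s. s + of_int m"]) simp
  have "\<forall>\<^sub>F s in at_left (snd q + of_int (- m)). F (fst p, s) = x"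
    using assms(3) by (simp add: before_def q)
  from eventually_at_left_strict_mono[OF mono surj this] show ?thesis
    by (simp only: before_def q F fst_conv snd_conv)
qed

lemma after_same_param:
  assumes "\<And>p q. same_param p q \<Longrightarrow> F p = F q" "same_param p q" "after F p x"
  shows "after F q x"
proof -
  obtain m where q: "q = (fst p, snd p + of_int m)" using assms(2) by (rule same_paramE)
  have F: "F (fst p, s + of_int (- m)) = F (fst p, s)" for s
    by (rule assms(1)) (rule same_param_shift)
  have mono: "strict_mono (\<lambda>s::real. s + of_int (- m))" by (auto simp: strict_mono_def)
  have surj: "surj (\<lambda>s::real. s + of_int (- m))" by (rule surjI[of _ "\<lambda>s. s + of_int m"]) simp
  have "\<forall>\<^sub>F s in at_right (snd q + of_int (- m)). F (fst p, s) = x"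
    using assms(3) by (simp add: after_def q)
  from eventually_at_right_strict_mono[OF mono surj this] show ?thesis
    by (simp only: after_def q F fst_conv snd_conv)
qed

lemma locally_constant_iff:
  "(\<forall>\<^sub>F s in nhds (snd p). F (fst p, s) = F p) \<longleftrightarrow> before F p (F p) \<and> after F p (F p)"
  by (simp add: eventually_nhds_real_split before_def after_def)

text \<open>Strand coordinates run against the orientation when \<open>r < 0\<close>; then left and
  right limits trade places.\<close>

lemma eventually_affine:
  fixes c r u :: real
  assumes "r \<noteq> 0"
  shows "r > 0 \<Longrightarrow> eventually P (at_left u) \<Longrightarrow> \<forall>\<^sub>F s in at_left (c + r * u). P ((s - c) / r)"
    "r > 0 \<Longrightarrow> eventually P (at_right u) \<Longrightarrow> \<forall>\<^sub>F s in at_right (c + r * u). P ((s - c) / r)"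
    "r < 0 \<Longrightarrow> eventually P (at_left u) \<Longrightarrow> \<forall>\<^sub>F s in at_right (c + r * u). P ((s - c) / r)"
    "r < 0 \<Longrightarrow> eventually P (at_right u) \<Longrightarrow> \<forall>\<^sub>F s in at_left (c + r * u). P ((s - c) / r)"
proof -
  have surj: "surj (\<lambda>s. (s - c) / r)" "surj (\<lambda>s. - ((s - c) / r))"
    using assms by (intro surjI[of _ "\<lambda>y. c + r * y"], simp) (intro surjI[of _ "\<lambda>y. c - r * y"], use assms in simp)
  { assume r: "r > 0"
    have mono: "strict_mono (\<lambda>s. (s - c) / r)"
      using r by (auto simp: strict_mono_def divide_strict_right_mono)
    show "eventually P (at_left u) \<Longrightarrow> \<forall>\<^sub>F s in at_left (c + r * u). P ((s - c) / r)"
      using r by (intro eventually_at_left_strict_mono[OF mono surj(1)]) simp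
    show "eventually P (at_right u) \<Longrightarrow> \<forall>\<^sub>F s in at_right (c + r * u). P ((s - c) / r)"
      using r by (intro eventually_at_right_strict_mono[OF mono surj(1)]) simp }
  { assume r: "r < 0"
    have mono: "strict_mono (\<lambda>s. - ((s - c) / r))"
      using r by (auto simp: strict_mono_def divide_strict_right_mono_neg)
    have l: "eventually P (at_left u) \<Longrightarrow> \<forall>\<^sub>F y in at_right (- u). P (- y)"
      by (subst (asm) at_left_minus) (simp add: eventually_filtermap)
    have ri: "eventually P (at_right u) \<Longrightarrow> \<forall>\<^sub>F y in at_left (- u). P (- y)"
      by (subst (asm) at_right_minus) (simp add: eventually_filtermap)
    show "eventually P (at_left u) \<Longrightarrow> \<forall>\<^sub>F s in at_right (c + r * u). P ((s - c) / r)"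
      using r eventually_at_right_strict_mono[OF mono surj(2), of "\<lambda>y. P (- y)" "c + r * u"] l by simp
    show "eventually P (at_right u) \<Longrightarrow> \<forall>\<^sub>F s in at_left (c + r * u). P ((s - c) / r)"
      using r eventually_at_left_strict_mono[OF mono surj(2), of "\<lambda>y. P (- y)" "c + r * u"] ri by simp }
qed

definition step_color :: "real \<Rightarrow> real \<Rightarrow> 'x \<Rightarrow> 'x \<Rightarrow> 'x \<Rightarrow> real \<Rightarrow> 'x" where
  "step_color b b' x y z u = (if u < b then x else if u < b' then y else z)"

text \<open>The left limit of \<open>step_color\<close>; the right limit is \<open>step_color\<close> itself.\<close>

definition step_color_left :: "real \<Rightarrow> real \<Rightarrow> 'x \<Rightarrow> 'x \<Rightarrow> 'x \<Rightarrow> real \<Rightarrow> 'x" where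
  "step_color_left b b' x y z u = (if u \<le> b then x else if u \<le> b' then y else z)"

lemma eventually_step_color:
  "\<forall>\<^sub>F w in at_left u. step_color b b' x y z w = step_color_left b b' x y z u"
  "\<forall>\<^sub>F w in at_right u. step_color b b' x y z w = step_color b b' x y z u"
proof -
  have l: "\<forall>\<^sub>F w in at_left u. (w < b \<longleftrightarrow> u \<le> b)" for b
  proof (cases "u \<le> b")
    case True
    then show ?thesis using eventually_at_left_real[of "u - 1" u] by (auto elim: eventually_mono)
  next
    case False
    then show ?thesis using eventually_at_left_real[of b u] by (auto elim: eventually_mono)
  qed
  show "\<forall>\<^sub>F w in at_left u. step_color b b' x y z w = step_color_left b b' x y z u"
    using l[of b] l[of b'] by eventually_elim (simp add: step_color_def step_color_left_def)
  have r: "\<forall>\<^sub>F w in at_right u. (w < b \<longleftrightarrow> u < b)" for b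
  proof (cases "u < b")
    case True
    then show ?thesis using eventually_at_right_real[of u b] by (auto elim: eventually_mono)
  next
    case False
    then show ?thesis using eventually_at_right_real[of u "u + 1"] by (auto elim: eventually_mono)
  qed
  show "\<forall>\<^sub>F w in at_right u. step_color b b' x y z w = step_color b b' x y z u"
    using r[of b] r[of b'] by eventually_elim (simp add: step_color_def)
qed

section \<open>One diagram inside the disc, in strand coordinates\<close>

locale tangle = link_diagram D for D +
  fixes ss :: "strand list" and fs fs' :: "(real \<Rightarrow> complex) list" and \<phi> :: "complex \<Rightarrow> complex"
  assumes len: "length ss = length fs"
    and strands: "\<And>k c r. (k, c, r) \<in> set ss \<Longrightarrow> k < ncomp D \<and> r \<noteq> 0 \<and> \<bar>r\<bar> < 1/2"
    and disjoint: "\<And>i j. i < length ss \<Longrightarrow> j < length ss \<Longrightarrow> i \<noteq> j \<Longrightarrow> on_strand (ss ! i) \<inter> on_strand (ss ! j) = {}"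
    and diffeo: "plane_diffeo \<phi>" and jac: "\<And>z. jacobian \<phi> z > 0"
    and arcs: "\<And>i u. i < length ss \<Longrightarrow> \<bar>u\<bar> \<le> 1 \<Longrightarrow> point D (strand_param (ss ! i) u) = \<phi> ((fs ! i) u)"
    and outside: "\<And>p. p \<in> params D \<Longrightarrow> (\<forall>s \<in> set ss. p \<notin> on_strand s) \<Longrightarrow> point D p \<notin> \<phi> ` cball 0 1"
    and proper: "\<And>i u. i < length ss \<Longrightarrow> \<bar>u\<bar> \<le> 1 \<Longrightarrow> norm ((fs ! i) u) \<le> 1"
    and arcs': "\<And>i u. i < length ss \<Longrightarrow> ((fs ! i) has_vector_derivative (fs' ! i) u) (at u)"
begin

abbreviation sp :: "nat \<Rightarrow> real \<Rightarrow> param" where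
  "sp i u \<equiv> strand_param (ss ! i) u"

definition component :: "nat \<Rightarrow> nat" where "component i = fst (ss ! i)"
definition centre :: "nat \<Rightarrow> real" where "centre i = fst (snd (ss ! i))"
definition radius :: "nat \<Rightarrow> real" where "radius i = snd (snd (ss ! i))"

lemma sp_eq: "sp i u = (component i, centre i + radius i * u)"
  by (simp add: strand_param_def component_def centre_def radius_def split: prod.splits)

lemma strand_props:
  assumes "i < length ss"
  shows "component i < ncomp D" "radius i \<noteq> 0" "\<bar>radius i\<bar> < 1/2"
proof -
  have "(component i, centre i, radius i) \<in> set ss"
    using nth_mem[OF assms] by (simp add: component_def centre_def radius_def)
  then show "component i < ncomp D" "radius i \<noteq> 0" "\<bar>radius i\<bar> < 1/2" using strands by blast+
qed

lemma sp_params: "i < length ss \<Longrightarrow> sp i u \<in> params D"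
  using strand_props by (simp add: sp_eq params_iff)

lemma on_strand_iff: "p \<in> on_strand (ss ! i) \<longleftrightarrow> (\<exists>u. \<bar>u\<bar> \<le> 1 \<and> same_param p (sp i u))"
  by (auto simp: on_strand_def abs_le_iff Bex_def)

text \<open>As the radius is below 1/2 in absolute value, a strand is shorter than a full turn: two
  of its parameters differ by less than 1, so only the shift 0 can identify them.\<close>

lemma same_sp_iff:
  assumes "i < length ss" "j < length ss" "\<bar>u\<bar> \<le> 1" "\<bar>v\<bar> \<le> 1"
  shows "same_param (sp i u) (sp j v) \<longleftrightarrow> i = j \<and> u = v"
proof
  assume same: "same_param (sp i u) (sp j v)"
  have "sp i u \<in> on_strand (ss ! i)" "sp i u \<in> on_strand (ss ! j)"
    using assms(3,4) same by (auto simp: on_strand_iff)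
  then have ij: "i = j" using disjoint[OF assms(1,2)] by blast
  obtain m :: int where m: "radius i * (u - v) = of_int m"
    using same unfolding ij by (auto simp: same_param_def sp_eq algebra_simps elim: Ints_cases)
  have "\<bar>radius i * (u - v)\<bar> \<le> \<bar>radius i\<bar> * 2"
    using assms(3,4) by (auto simp: abs_mult intro!: mult_left_mono)
  also have "\<dots> < 1" using strand_props[OF assms(1)] by simp
  finally have "m = 0" unfolding m by linarith
  then show "i = j \<and> u = v" using ij m strand_props[OF assms(1)] by simp
qed simp

lemma inj_phi: "inj \<phi>"
  using diffeo by (simp add: plane_diffeo_def bij_def)

lemma crossing_sp_iff:
  assumes "i < length ss" "j < length ss" "\<bar>u\<bar> \<le> 1" "\<bar>v\<bar> \<le> 1"
  shows "crossing D (sp i u) (sp j v) \<longleftrightarrow> \<not> (i = j \<and> u = v) \<and> (fs ! i) u = (fs ! j) v"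
  using assms sp_params same_sp_iff[OF assms] arcs inj_phi by (auto simp: crossing_def inj_eq)

text \<open>The model arcs stay in the closed unit disc, and nothing but the strands enters its
  image, so both branches of a crossing there belong to strands.\<close>

lemma crossing_strand:
  assumes "crossing D p q" "i < length ss" "p \<in> on_strand (ss ! i)"
  shows "\<exists>j<length ss. q \<in> on_strand (ss ! j)"
proof (rule ccontr)
  assume "\<not> ?thesis"
  then have "\<forall>s\<in>set ss. q \<notin> on_strand s" by (metis in_set_conv_nth)
  then have "point D q \<notin> \<phi> ` cball 0 1" using assms(1) by (intro outside) (auto simp: crossing_def)
  moreover obtain u where u: "\<bar>u\<bar> \<le> 1" "same_param p (sp i u)" using assms(3) by (auto simp: on_strand_iff)
  have "point D q = \<phi> ((fs ! i) u)"
    using point_same[OF _ u(2)] assms(1,2) arcs[OF assms(2) u(1)] by (simp add: crossing_def)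
  ultimately show False using proper[OF assms(2) u(1)] by simp
qed

text \<open>The chain rule for the two descriptions of a strand, through the curve and through the
  model arc. These agree only on the strand, so \<open>u\<close> has to be interior. The factor
  \<open>radius i\<close> records the direction of travel.\<close>

lemma velocity_sp:
  assumes "i < length ss" "\<bar>u\<bar> < 1"
  shows "radius i *\<^sub>R velocity D (sp i u) = frechet_derivative \<phi> (at ((fs ! i) u)) ((fs' ! i) u)"
proof -
  have "(curve D (component i) has_vector_derivative velocity D (sp i u)) (at (centre i + radius i * u))"
    using differentiable strand_props[OF assms(1)]
    by (simp add: velocity_def sp_eq vector_derivative_works[symmetric])
  moreover have "((\<lambda>u. centre i + radius i * u) has_vector_derivative radius i) (at u)"
    by (auto intro!: derivative_eq_intros simp: has_real_derivative_iff_has_vector_derivative[symmetric])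
  ultimately have "(curve D (component i) \<circ> (\<lambda>u. centre i + radius i * u) has_vector_derivative
      radius i *\<^sub>R velocity D (sp i u)) (at u)"
    by (rule vector_diff_chain_at[rotated])
  moreover have "((\<lambda>u. \<phi> ((fs ! i) u)) has_vector_derivative
      frechet_derivative \<phi> (at ((fs ! i) u)) ((fs' ! i) u)) (at u)"
    using diffeo by (intro has_vector_derivative_diffeo arcs' assms(1)) (simp add: plane_diffeo_def)
  then have "(curve D (component i) \<circ> (\<lambda>u. centre i + radius i * u) has_vector_derivative
      frechet_derivative \<phi> (at ((fs ! i) u)) ((fs' ! i) u)) (at u)"
  proof (rule has_vector_derivative_transform_within_open[of _ _ _ "{-1<..<1}"])
    fix w :: real assume "w \<in> {-1<..<1}"
    then have "point D (sp i w) = \<phi> ((fs ! i) w)" by (intro arcs assms(1)) auto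
    then show "\<phi> ((fs ! i) w) = (curve D (component i) \<circ> (\<lambda>u. centre i + radius i * u)) w"
      by (simp add: point_def sp_eq)
  qed (use assms(2) in auto)
  ultimately show ?thesis by (rule vector_derivative_unique_at)
qed

definition orient :: "nat \<Rightarrow> bool" where "orient i \<longleftrightarrow> radius i > 0"

text \<open>The Jacobian of \<phi> is positive and the radii contribute their signs, so the sign of
  a crossing is that of the model picture, corrected by whether the two orientations agree.\<close>

lemma positive_at_sp:
  assumes "i < length ss" "j < length ss" "\<bar>u\<bar> < 1" "\<bar>v\<bar> < 1" "crossing D (sp i u) (sp j v)"
  shows "positive_at D (sp i u) (sp j v) \<longleftrightarrow> (cross ((fs' ! i) u) ((fs' ! j) v) > 0) = (orient i = orient j)"
    "cross ((fs' ! i) u) ((fs' ! j) v) \<noteq> 0"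
proof -
  have eq: "(fs ! i) u = (fs ! j) v" using crossing_sp_iff[of i j u v] assms by auto
  have "radius i * radius j * cross (velocity D (sp i u)) (velocity D (sp j v)) =
    cross (radius i *\<^sub>R velocity D (sp i u)) (radius j *\<^sub>R velocity D (sp j v))"
    by (simp add: cross_def algebra_simps)
  also have "\<dots> = jacobian \<phi> ((fs ! j) v) * cross ((fs' ! i) u) ((fs' ! j) v)"
    unfolding velocity_sp[OF assms(1,3)] velocity_sp[OF assms(2,4)] eq
    using diffeo by (intro cross_frechet) (simp add: plane_diffeo_def)
  finally have *: "radius i * radius j * cross (velocity D (sp i u)) (velocity D (sp j v)) =
    jacobian \<phi> ((fs ! j) v) * cross ((fs' ! i) u) ((fs' ! j) v)" .
  have nz: "radius i \<noteq> 0" "radius j \<noteq> 0" "cross (velocity D (sp i u)) (velocity D (sp j v)) \<noteq> 0"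
    using strand_props(2)[OF assms(1)] strand_props(2)[OF assms(2)] cross_nonzero[OF assms(5)] .
  have J: "jacobian \<phi> ((fs ! j) v) > 0" by (rule jac)
  show "cross ((fs' ! i) u) ((fs' ! j) v) \<noteq> 0" using * nz by auto
  have "cross ((fs' ! i) u) ((fs' ! j) v) > 0 \<longleftrightarrow>
      radius i * radius j * cross (velocity D (sp i u)) (velocity D (sp j v)) > 0"
    unfolding * using J by (simp add: zero_less_mult_iff)
  also have "\<dots> \<longleftrightarrow> (cross (velocity D (sp i u)) (velocity D (sp j v)) > 0) = (orient i = orient j)"
    using nz unfolding orient_def by (auto simp: zero_less_mult_iff mult_less_0_iff)
  finally show "positive_at D (sp i u) (sp j v) \<longleftrightarrow> (cross ((fs' ! i) u) ((fs' ! j) v) > 0) = (orient i = orient j)"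
    by (auto simp: positive_at_def)
qed

lemma before_after_sp:
  assumes "i < length ss" "\<forall>\<^sub>F w in at_left u. F (sp i w) = l" "\<forall>\<^sub>F w in at_right u. F (sp i w) = r"
  shows "before F (sp i u) (if orient i then l else r)" "after F (sp i u) (if orient i then r else l)"
proof -
  have inv: "centre i + radius i * ((s - centre i) / radius i) = s" for s
    using strand_props[OF assms(1)] by simp
  note ev = eventually_affine[OF strand_props(2)[OF assms(1)], where c = "centre i" and u = u]
  show "before F (sp i u) (if orient i then l else r)"
    using ev(1)[OF _ assms(2)] ev(4)[OF _ assms(3)] strand_props(2)[OF assms(1)]
    unfolding before_def sp_eq orient_def by (auto simp: inv)
  show "after F (sp i u) (if orient i then r else l)"
    using ev(2)[OF _ assms(3)] ev(3)[OF _ assms(2)] strand_props(2)[OF assms(1)]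
    unfolding after_def sp_eq orient_def by (auto simp: inv)
qed

lemma diagram_coloring_const_sp:
  assumes "diagram_coloring X ut ot D F" "i < length ss"
    "\<And>w. u \<le> w \<Longrightarrow> w \<le> v \<Longrightarrow> sp i w \<notin> classical_params D" "u \<le> v"
  shows "F (sp i u) = F (sp i v)"
  unfolding sp_eq
proof (rule diagram_coloring_const[OF assms(1)])
  show "component i < ncomp D" using strand_props assms(2) by simp
  show "arc_free (component i) (centre i + radius i * u) (centre i + radius i * v)"
    unfolding arc_free_def
  proof
    fix s assume s: "s \<in> {min (centre i + radius i * u) (centre i + radius i * v)..
        max (centre i + radius i * u) (centre i + radius i * v)}"
    define w where "w = (s - centre i) / radius i"
    have s_eq: "s = centre i + radius i * w" using strand_props(2)[OF assms(2)] by (simp add: w_def)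
    have "u \<le> w \<and> w \<le> v"
    proof (cases "radius i > 0")
      case True
      then have "radius i * u \<le> radius i * v" using assms(4) by simp
      then show ?thesis using s True unfolding s_eq by auto
    next
      case False
      then have r: "radius i < 0" using strand_props(2)[OF assms(2)] by simp
      then have "radius i * v \<le> radius i * u" using assms(4) by simp
      then show ?thesis using s r unfolding s_eq by auto
    qed
    then have "sp i w \<notin> classical_params D" using assms(3) by blast
    then show "(component i, s) \<notin> classical_params D" by (simp add: sp_eq s_eq)
  qed
qed

end

text \<open>Two cuts suffice, because in every picture a strand runs through at most two classical
  crossings; cuts at other parameters are harmless dummies.\<close>

locale cut_tangle = tangle D ss fs fs' \<phi> for D ss fs fs' \<phi> +
  fixes b b' :: "nat \<Rightarrow> real"
  assumes cuts: "\<And>i. i < length ss \<Longrightarrow> - 1 < b i \<and> b i < b' i \<and> b' i < 1"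
    and classical_cuts: "\<And>i u. i < length ss \<Longrightarrow> \<bar>u\<bar> \<le> 1 \<Longrightarrow> strand_param (ss ! i) u \<in> classical_params D \<Longrightarrow>
      u = b i \<or> u = b' i"
begin

text \<open>The colors of strand \<open>i\<close> before \<open>b i\<close>, between \<open>b i\<close> and \<open>b' i\<close>, and after \<open>b' i\<close> are \<open>x i\<close>, \<open>y i\<close>
  and \<open>z i\<close>. The cuts need not be classical crossings.\<close>

definition solution :: "'x set \<Rightarrow> ('x \<Rightarrow> 'x \<Rightarrow> 'x) \<Rightarrow> ('x \<Rightarrow> 'x \<Rightarrow> 'x) \<Rightarrow> (nat \<Rightarrow> 'x) \<Rightarrow> (nat \<Rightarrow> 'x) \<Rightarrow> (nat \<Rightarrow> 'x) \<Rightarrow> bool" where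
  "solution X ut ot x y z \<longleftrightarrow>
    (\<forall>i<length ss. x i \<in> X \<and> y i \<in> X \<and> z i \<in> X \<and>
      (sp i (b i) \<notin> classical_params D \<longrightarrow> x i = y i) \<and> (sp i (b' i) \<notin> classical_params D \<longrightarrow> y i = z i)) \<and>
    (\<forall>i<length ss. \<forall>j<length ss. \<forall>u v. \<bar>u\<bar> < 1 \<longrightarrow> \<bar>v\<bar> < 1 \<longrightarrow> over_at D (sp i u) (sp j v) \<longrightarrow>
      strand_crossing ut ot (cross ((fs' ! i) u) ((fs' ! j) v) > 0) (orient i) (orient j)
        (step_color_left (b i) (b' i) (x i) (y i) (z i) u) (step_color (b i) (b' i) (x i) (y i) (z i) u)
        (step_color_left (b j) (b' j) (x j) (y j) (z j) v) (step_color (b j) (b' j) (x j) (y j) (z j) v))"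

lemma diagram_coloring_step:
  assumes F: "diagram_coloring X ut ot D F" and i: "i < length ss" and u: "\<bar>u\<bar> \<le> 1" "sp i u \<notin> classical_params D"
  shows "F (sp i u) = step_color (b i) (b' i) (F (sp i (-1))) (F (sp i ((b i + b' i) / 2))) (F (sp i 1)) u"
proof -
  have cut: "- 1 < b i" "b i < b' i" "b' i < 1" using cuts[OF i] by auto
  have const: "F (sp i v) = F (sp i w)" if "v \<le> w" "- 1 \<le> v" "w \<le> 1"
    "b i \<in> {v..w} \<Longrightarrow> sp i (b i) \<notin> classical_params D" "b' i \<in> {v..w} \<Longrightarrow> sp i (b' i) \<notin> classical_params D" for v w
    by (rule diagram_coloring_const_sp[OF F i]) (use that classical_cuts[OF i] in force)+
  consider "u < b i" | "b i \<le> u" "u < b' i" | "b' i \<le> u" by linarith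
  then show ?thesis
  proof cases
    case 1
    then show ?thesis using const[of "-1" u] cut u by (auto simp: step_color_def)
  next
    case 2
    have "F (sp i u) = F (sp i ((b i + b' i) / 2))"
    proof (cases "u \<le> (b i + b' i) / 2")
      case True
      then show ?thesis using 2 cut u by (intro const) (auto dest: order.antisym)
    next
      case False
      then show ?thesis using 2 cut u by (intro const[symmetric]) auto
    qed
    then show ?thesis using 2 by (simp add: step_color_def)
  next
    case 3
    then have "F (sp i u) = F (sp i 1)" using cut u by (intro const) (auto dest: order.antisym)
    then show ?thesis using 3 cut by (simp add: step_color_def)
  qed
qed

lemma eventually_sp_not_classical:
  assumes "i < length ss" "\<bar>u\<bar> < 1"
  shows "\<forall>\<^sub>F w in at u. \<bar>w\<bar> < 1 \<and> sp i w \<notin> classical_params D"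
proof -
  have "\<forall>\<^sub>F w in at u. w \<in> - ({b i, b' i} - {u}) - {u}"
    by (rule eventually_at_in_open[OF open_Compl[OF finite_imp_closed]]) auto
  moreover have "\<forall>\<^sub>F w in at u. w \<in> {-1<..<1} - {u}" using assms by (intro eventually_at_in_open) auto
  ultimately show ?thesis
  proof eventually_elim
    case (elim w)
    then have "\<bar>w\<bar> < 1" by auto
    then show ?case using classical_cuts[OF assms(1), of w] elim by auto
  qed
qed

lemma diagram_coloring_sp_sides:
  assumes F: "diagram_coloring X ut ot D F" and i: "i < length ss" and u: "\<bar>u\<bar> < 1"
  defines "x \<equiv> F (sp i (-1))" and "y \<equiv> F (sp i ((b i + b' i) / 2))" and "z \<equiv> F (sp i 1)"
  shows "\<forall>\<^sub>F w in at_left u. F (sp i w) = step_color_left (b i) (b' i) x y z u"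
    "\<forall>\<^sub>F w in at_right u. F (sp i w) = step_color (b i) (b' i) x y z u"
proof -
  note nc = eventually_sp_not_classical[OF i u, unfolded eventually_at_split]
  show "\<forall>\<^sub>F w in at_left u. F (sp i w) = step_color_left (b i) (b' i) x y z u"
    using nc[THEN conjunct1] eventually_step_color(1)[of "b i" "b' i" x y z u]
    by eventually_elim (use diagram_coloring_step[OF F i] in \<open>simp add: x_def y_def z_def\<close>)
  show "\<forall>\<^sub>F w in at_right u. F (sp i w) = step_color (b i) (b' i) x y z u"
    using nc[THEN conjunct2] eventually_step_color(2)[of "b i" "b' i" x y z u]
    by eventually_elim (use diagram_coloring_step[OF F i] in \<open>simp add: x_def y_def z_def\<close>)
qed

lemma sp_ends_not_classical: "i < length ss \<Longrightarrow> sp i (-1) \<notin> classical_params D"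
  "i < length ss \<Longrightarrow> sp i 1 \<notin> classical_params D"
  "i < length ss \<Longrightarrow> sp i ((b i + b' i) / 2) \<notin> classical_params D"
  using classical_cuts[of i "-1"] classical_cuts[of i 1] classical_cuts[of i "(b i + b' i) / 2"] cuts[of i]
  by (auto simp: abs_le_iff field_simps)

lemma diagram_coloring_solution:
  assumes F: "diagram_coloring X ut ot D F"
  shows "solution X ut ot (\<lambda>i. F (sp i (-1))) (\<lambda>i. F (sp i ((b i + b' i) / 2))) (\<lambda>i. F (sp i 1))"
  unfolding solution_def
proof (intro conjI allI impI)
  fix i assume i: "i < length ss"
  have X: "F (sp i u) \<in> X" if "sp i u \<notin> classical_params D" for u
    using param_coloring_in[OF F] sp_params[OF i, of u] that by (simp add: params_iff classical_params_eq)
  show "F (sp i (-1)) \<in> X" "F (sp i ((b i + b' i) / 2)) \<in> X" "F (sp i 1) \<in> X"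
    using sp_ends_not_classical[OF i] X by auto
  have cut: "- 1 < b i" "b i < b' i" "b' i < 1" using cuts[OF i] by auto
  { assume "sp i (b i) \<notin> classical_params D"
    then show "F (sp i (-1)) = F (sp i ((b i + b' i) / 2))"
      by (intro diagram_coloring_const_sp[OF F i]) (use cut classical_cuts[OF i] in force)+ }
  { assume "sp i (b' i) \<notin> classical_params D"
    then show "F (sp i ((b i + b' i) / 2)) = F (sp i 1)"
      by (intro diagram_coloring_const_sp[OF F i]) (use cut classical_cuts[OF i] in force)+ }
next
  fix i j u v assume ij: "i < length ss" "j < length ss" and uv: "\<bar>u\<bar> < 1" "\<bar>v\<bar> < 1"
    and ov: "over_at D (sp i u) (sp j v)"
  obtain ob oa ub ua where col: "before F (sp i u) ob" "after F (sp i u) oa" "before F (sp j v) ub" "after F (sp j v) ua"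
    "crossing_relation ut ot (positive_at D (sp i u) (sp j v)) ob oa ub ua"
    using param_coloring_crossing[OF F ov] by blast
  note si = before_after_sp[OF ij(1) diagram_coloring_sp_sides[OF F ij(1) uv(1)]]
  note sj = before_after_sp[OF ij(2) diagram_coloring_sp_sides[OF F ij(2) uv(2)]]
  have "crossing D (sp i u) (sp j v)" using ov by (simp add: over_at_def)
  from positive_at_sp(1)[OF ij uv this] col(5)
    before_unique[OF col(1) si(1)] after_unique[OF col(2) si(2)] before_unique[OF col(3) sj(1)] after_unique[OF col(4) sj(2)]
  show "strand_crossing ut ot (cross ((fs' ! i) u) ((fs' ! j) v) > 0) (orient i) (orient j)
      (step_color_left (b i) (b' i) (F (sp i (-1))) (F (sp i ((b i + b' i) / 2))) (F (sp i 1)) u)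
      (step_color (b i) (b' i) (F (sp i (-1))) (F (sp i ((b i + b' i) / 2))) (F (sp i 1)) u)
      (step_color_left (b j) (b' j) (F (sp j (-1))) (F (sp j ((b j + b' j) / 2))) (F (sp j 1)) v)
      (step_color (b j) (b' j) (F (sp j (-1))) (F (sp j ((b j + b' j) / 2))) (F (sp j 1)) v)"
    unfolding strand_crossing_def by simp
qed

text \<open>These are the open strands, whereas \<open>on_strand\<close> is closed. The end points
  thus count as outside, and the outer colors belong to the data shared by both diagrams.\<close>

definition inside :: "param \<Rightarrow> bool" where
  "inside p \<longleftrightarrow> (\<exists>i u. i < length ss \<and> \<bar>u\<bar> < 1 \<and> same_param p (sp i u))"

text \<open>The end colors are values outside, the hypothesis on solutions yields the middle colors,
  and every unclassical parameter inside carries one of these three colors.\<close>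

lemma diagram_coloring_unique:
  assumes F: "diagram_coloring X ut ot D F" and F': "diagram_coloring X ut ot D F'"
    and agree: "\<And>p. p \<in> params D \<Longrightarrow> p \<notin> classical_params D \<Longrightarrow> \<not> inside p \<Longrightarrow> F p = F' p"
    and uniq: "\<And>x y z x' y' z' i. solution X ut ot x y z \<Longrightarrow> solution X ut ot x' y' z' \<Longrightarrow>
      \<forall>j<length ss. x j = x' j \<and> z j = z' j \<Longrightarrow> i < length ss \<Longrightarrow> y i = y' i"
    and p: "p \<in> params D" "p \<notin> classical_params D"
  shows "F p = F' p"
proof (cases "inside p")
  case True
  then obtain i u where iu: "i < length ss" "\<bar>u\<bar> < 1" "same_param p (sp i u)" by (auto simp: inside_def)
  have ends: "F (sp j (-1)) = F' (sp j (-1))" "F (sp j 1) = F' (sp j 1)" if "j < length ss" for j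
  proof -
    have "\<not> inside (sp j w)" if "\<bar>w\<bar> = 1" for w
      using same_sp_iff[OF \<open>j < length ss\<close>, of _ w] that by (force simp: inside_def)
    then show "F (sp j (-1)) = F' (sp j (-1))" "F (sp j 1) = F' (sp j 1)"
      using that sp_ends_not_classical sp_params by (simp_all add: agree)
  qed
  have mid: "F (sp i ((b i + b' i) / 2)) = F' (sp i ((b i + b' i) / 2))"
    using uniq[OF diagram_coloring_solution[OF F] diagram_coloring_solution[OF F'] _ iu(1)] ends by blast
  have "sp i u \<notin> classical_params D" using p(2) classical_same[OF iu(3)] by simp
  then have "F (sp i u) = F' (sp i u)"
    using diagram_coloring_step[OF F iu(1) less_imp_le[OF iu(2)]] diagram_coloring_step[OF F' iu(1) less_imp_le[OF iu(2)]]
      mid ends[OF iu(1)] by presburger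
  then show ?thesis
    using param_coloring_same[OF F iu(3)] param_coloring_same[OF F' iu(3)] by simp
qed (use agree p in blast)

end

text \<open>The sum of a compact segment and the closed set of integers is closed. Being away from a
  closed part of a strand is therefore an open condition on the parameter.\<close>

lemma closed_integer_translates:
  fixes c r :: real
  shows "closed {s. \<exists>m::int. \<exists>u. \<bar>u\<bar> \<le> \<rho> \<and> s + of_int m = c + r * u}"
proof -
  have "{s. \<exists>m::int. \<exists>u. \<bar>u\<bar> \<le> \<rho> \<and> s + of_int m = c + r * u} =
      (\<Union>x\<in>(\<lambda>u. c + r * u) ` {-\<rho>..\<rho>}. \<Union>y\<in>\<int>. {x + y})" (is "?L = ?R")
  proof (rule equalityI; rule subsetI)
    fix s assume "s \<in> ?L"
    then obtain m :: int and u where "\<bar>u\<bar> \<le> \<rho>" "s + of_int m = c + r * u" by blast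
    then have "u \<in> {-\<rho>..\<rho>}" "s = (c + r * u) + of_int (- m)" by (auto simp: abs_le_iff)
    then show "s \<in> ?R" by (blast intro: Ints_of_int)
  next
    fix s assume "s \<in> ?R"
    then obtain u y where "u \<in> {-\<rho>..\<rho>}" "y \<in> \<int>" "s = c + r * u + y" by blast
    moreover from \<open>y \<in> \<int>\<close> obtain m :: int where "y = of_int m" by (auto elim: Ints_cases)
    ultimately have "\<bar>u\<bar> \<le> \<rho>" "s + of_int (- m) = c + r * u" by (auto simp: abs_le_iff)
    then show "s \<in> ?L" by blast
  qed
  moreover have "closed ?R"
    by (intro compact_closed_sums compact_continuous_image continuous_intros closed_Ints) auto
  ultimately show ?thesis by simp
qed

context tangle
begin

lemma closed_core: "closed {s. \<exists>u. \<bar>u\<bar> \<le> \<rho> \<and> same_param (k, s) (sp i u)}"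
proof (cases "k = component i")
  case True
  have "same_param (k, s) (sp i u) \<longleftrightarrow> (\<exists>m::int. s + of_int m = centre i + radius i * u)" for s u
  proof
    assume "same_param (k, s) (sp i u)"
    then obtain m :: int where "sp i u = (k, s + of_int m)" by (auto elim: same_paramE)
    then show "\<exists>m::int. s + of_int m = centre i + radius i * u"
      by (auto simp: sp_eq intro!: exI[of _ m])
  next
    assume "\<exists>m::int. s + of_int m = centre i + radius i * u"
    then obtain m :: int where "s + of_int m = centre i + radius i * u" by blast
    then have "sp i u = (k, s + of_int m)" by (simp add: sp_eq True)
    then show "same_param (k, s) (sp i u)" by simp
  qed
  then have "{s. \<exists>u. \<bar>u\<bar> \<le> \<rho> \<and> same_param (k, s) (sp i u)} =
      {s. \<exists>m::int. \<exists>u. \<bar>u\<bar> \<le> \<rho> \<and> s + of_int m = centre i + radius i * u}" by blast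
  then show ?thesis by (simp only: closed_integer_translates)
next
  case False
  then have "{s. \<exists>u. \<bar>u\<bar> \<le> \<rho> \<and> same_param (k, s) (sp i u)} = {}"
    by (auto simp: same_param_def sp_eq)
  then show ?thesis by (simp only: closed_empty)
qed

lemma eventually_not_core:
  assumes "\<And>i u. i < length ss \<Longrightarrow> \<bar>u\<bar> \<le> \<rho> i \<Longrightarrow> \<not> same_param (k, t) (sp i u)"
  shows "\<forall>\<^sub>F s in nhds t. \<forall>i<length ss. \<forall>u. \<bar>u\<bar> \<le> \<rho> i \<longrightarrow> \<not> same_param (k, s) (sp i u)"
proof -
  have "\<forall>\<^sub>F s in nhds t. \<forall>u. \<bar>u\<bar> \<le> \<rho> i \<longrightarrow> \<not> same_param (k, s) (sp i u)" if "i < length ss" for i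
  proof -
    have "\<forall>\<^sub>F s in nhds t. s \<in> - {s. \<exists>u. \<bar>u\<bar> \<le> \<rho> i \<and> same_param (k, s) (sp i u)}"
      using closed_core assms[OF that] by (intro eventually_nhds_in_open) (auto simp: open_Compl)
    then show ?thesis by eventually_elim blast
  qed
  then have "\<forall>\<^sub>F s in nhds t. \<forall>i\<in>{..<length ss}. \<forall>u. \<bar>u\<bar> \<le> \<rho> i \<longrightarrow> \<not> same_param (k, s) (sp i u)"
    by (intro eventually_ball_finite) auto
  then show ?thesis by (rule eventually_mono) auto
qed

end

section \<open>Two diagrams that differ in a disc, and extension of colorings over it\<close>

locale tangle_pair =
  D: tangle D ss fs fs' \<phi> + E: tangle E ss gs gs' \<phi> for D E ss fs fs' gs gs' \<phi> +
  assumes ncomp_eq: "ncomp E = ncomp D"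
    and agree: "\<And>p. p \<in> params D \<Longrightarrow> (\<forall>s\<in>set ss. p \<notin> on_strand s) \<Longrightarrow>
      point E p = point D p \<and> (p \<in> over E \<longleftrightarrow> p \<in> over D)"

locale disc_change = tangle_pair D E ss fs fs' gs gs' \<phi> +
  D: cut_tangle D ss fs fs' \<phi> b b' + E: cut_tangle E ss gs gs' \<phi> c c'
  for D E ss fs fs' gs gs' \<phi> b b' c c'
begin

lemma params_eq: "params E = params D"
  by (simp add: params_def ncomp_eq)

definition out :: "param \<Rightarrow> bool" where
  "out p \<longleftrightarrow> p \<in> params D \<and> (\<forall>s\<in>set ss. p \<notin> on_strand s)"

lemma not_out: "p \<in> params D \<Longrightarrow> \<not> out p \<Longrightarrow> \<exists>i u. i < length ss \<and> \<bar>u\<bar> \<le> 1 \<and> same_param p (D.sp i u)"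
  unfolding out_def using D.on_strand_iff by (metis in_set_conv_nth)

lemma outD: "out p \<Longrightarrow> i < length ss \<Longrightarrow> \<bar>u\<bar> \<le> 1 \<Longrightarrow> \<not> same_param p (D.sp i u)"
  unfolding out_def using D.on_strand_iff nth_mem by blast

lemma out_crossing:
  assumes "out p" "crossing D p q \<or> crossing E p q"
  shows "out q"
proof (rule ccontr)
  assume "\<not> out q"
  moreover have "q \<in> params D" using assms(2) params_eq by (auto simp: crossing_def)
  ultimately obtain i where i: "i < length ss" "q \<in> on_strand (ss ! i)"
    unfolding out_def by (metis in_set_conv_nth)
  have "\<exists>j<length ss. p \<in> on_strand (ss ! j)"
    using assms(2) D.crossing_strand[OF _ i] E.crossing_strand[OF _ i] crossing_sym by blast
  then show False using assms(1) by (auto simp: out_def)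
qed

lemma over_at_out: "out p \<Longrightarrow> over_at E p q \<longleftrightarrow> over_at D p q"
proof (cases "out q")
  case True
  assume "out p"
  with True show ?thesis
    using agree[of p] agree[of q] params_eq by (auto simp: out_def over_at_def crossing_def)
next
  case False
  assume "out p"
  with False show ?thesis using out_crossing unfolding over_at_def by blast
qed

text \<open>Agreement at one parameter says nothing about derivatives; but the complement of the
  closed strands is open, so the two curves agree in a neighbourhood.\<close>

lemma velocity_out:
  assumes "out p"
  shows "velocity E p = velocity D p"
proof -
  obtain k t where kt: "p = (k, t)" by force
  have k: "k < ncomp D" using assms by (simp add: out_def D.params_iff kt)
  have "\<forall>\<^sub>F s in nhds t. \<forall>i<length ss. \<forall>u. \<bar>u\<bar> \<le> 1 \<longrightarrow> \<not> same_param (k, s) (D.sp i u)"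
    using assms outD by (intro D.eventually_not_core) (auto simp: kt)
  then have "\<forall>\<^sub>F s in nhds t. curve E k s = curve D k s"
  proof eventually_elim
    case (elim s)
    then have "out (k, s)" using not_out[of "(k, s)"] k by (auto simp: D.params_iff)
    then show ?case using agree[of "(k, s)"] by (simp add: out_def point_def)
  qed
  then show ?thesis
    by (auto simp: velocity_def kt intro!: vector_derivative_cong_eq elim: eventually_mono)
qed

lemma positive_at_out: "out p \<Longrightarrow> over_at D p q \<Longrightarrow> positive_at E p q \<longleftrightarrow> positive_at D p q"
  using velocity_out out_crossing by (auto simp: positive_at_def over_at_def)

lemma classical_out: "out p \<Longrightarrow> p \<in> classical_params E \<longleftrightarrow> p \<in> classical_params D"
  unfolding classical_params_eq classical_of_def mem_Collect_eq
  using over_at_out out_crossing crossing_sym over_at_def by metis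

lemma classical_not_inside:
  assumes "p \<in> params D" "\<not> D.inside p"
  shows "p \<in> classical_params E \<longleftrightarrow> p \<in> classical_params D"
proof (cases "out p")
  case False
  then obtain i u where iu: "i < length ss" "\<bar>u\<bar> \<le> 1" "same_param p (D.sp i u)" using not_out assms by blast
  then have "u = 1 \<or> u = - 1" using assms(2) by (force simp: D.inside_def)
  then have "D.sp i u \<notin> classical_params D" "D.sp i u \<notin> classical_params E"
    using D.sp_ends_not_classical[OF iu(1)] E.sp_ends_not_classical[OF iu(1)] by auto
  then show ?thesis using D.classical_same[OF iu(3)] E.classical_same[OF iu(3)] by simp
qed (rule classical_out)

text \<open>Glues \<open>F\<close> outside with the step functions of the solution inside. Near the
  ends of the strands the two agree, which carries local constancy and one-sided limits of
  \<open>F\<close> over to \<open>G\<close>.\<close>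

lemma extend_coloring:
  assumes F: "diagram_coloring X ut ot D F" and sol: "E.solution X ut ot x y z"
    and ends: "\<And>i. i < length ss \<Longrightarrow> x i = F (D.sp i (-1)) \<and> z i = F (D.sp i 1)"
  shows "\<exists>G. diagram_coloring X ut ot E G \<and> (\<forall>p. \<not> D.inside p \<longrightarrow> F p = G p)"
proof -
  define st where "st i = step_color (c i) (c' i) (x i) (y i) (z i)" for i
  \<comment> \<open>The strand and its coordinate are unique for an inside parameter, so only one
    value can be chosen.\<close>
  define G where "G p = (if D.inside p then (SOME w. \<exists>i u. i < length ss \<and> \<bar>u\<bar> < 1 \<and> same_param p (D.sp i u) \<and> w = st i u) else F p)" for p
  have G_in: "G p = st i u" if "i < length ss" "\<bar>u\<bar> < 1" "same_param p (D.sp i u)" for p i u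
  proof -
    have "w = st i u" if w: "\<exists>i u. i < length ss \<and> \<bar>u\<bar> < 1 \<and> same_param p (D.sp i u) \<and> w = st i u" for w
    proof -
      obtain j v where jv: "j < length ss" "\<bar>v\<bar> < 1" "same_param p (D.sp j v)" "w = st j v" using w by blast
      have "same_param (D.sp i u) (D.sp j v)"
        using same_param_trans[OF same_param_sym[OF \<open>same_param p (D.sp i u)\<close>] jv(3)] .
      then show ?thesis using D.same_sp_iff[of i j u v] jv \<open>i < length ss\<close> \<open>\<bar>u\<bar> < 1\<close> by auto
    qed
    moreover have "\<exists>j v. j < length ss \<and> \<bar>v\<bar> < 1 \<and> same_param p (D.sp j v) \<and> st i u = st j v"
      using that by blast
    ultimately have "(SOME w. \<exists>i u. i < length ss \<and> \<bar>u\<bar> < 1 \<and> same_param p (D.sp i u) \<and> w = st i u) = st i u"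
      by (intro some_equality) blast+
    moreover have "D.inside p" using that by (auto simp: D.inside_def)
    ultimately show ?thesis by (simp add: G_def)
  qed
  have G_out: "G p = F p" if "\<not> D.inside p" for p using that by (simp add: G_def)
  have inside_same: "D.inside p \<longleftrightarrow> D.inside q" if "same_param p q" for p q
    unfolding D.inside_def using same_param_trans[OF that] same_param_trans[OF same_param_sym[OF that]] by blast
  have G_same: "G p = G q" if "same_param p q" for p q
  proof (cases "D.inside p")
    case True
    then obtain i u where "i < length ss" "\<bar>u\<bar> < 1" "same_param p (D.sp i u)" by (auto simp: D.inside_def)
    moreover from this have "same_param q (D.sp i u)" using same_param_trans[OF same_param_sym[OF that]] by blast
    ultimately show ?thesis by (simp only: G_in)
  next
    case False
    then show ?thesis using G_out inside_same[OF that] param_coloring_same[OF F that] by simp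
  qed
  \<comment> \<open>The smallest symmetric core containing the cuts of both diagrams. Beyond it,
    \<open>F\<close> and the new step function both have the color of the nearer end.\<close>
  define \<rho> where "\<rho> i = Max {- b i, b' i, - c i, c' i}" for i
  have \<rho>: "\<rho> i < 1" if "i < length ss" for i
    using D.cuts[OF that] E.cuts[OF that] by (simp add: \<rho>_def)
  have G_noncore: "G p = F p" if "\<forall>i<length ss. \<forall>u. \<bar>u\<bar> \<le> \<rho> i \<longrightarrow> \<not> same_param p (D.sp i u)" for p
  proof (cases "D.inside p")
    case True
    then obtain i u where iu: "i < length ss" "\<bar>u\<bar> < 1" "same_param p (D.sp i u)" by (auto simp: D.inside_def)
    then have "\<rho> i < \<bar>u\<bar>" using that by force
    then have u: "- b i < \<bar>u\<bar>" "b' i < \<bar>u\<bar>" "- c i < \<bar>u\<bar>" "c' i < \<bar>u\<bar>" by (simp_all add: \<rho>_def)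
    have cut: "b i < b' i" "c i < c' i" using D.cuts[OF iu(1)] E.cuts[OF iu(1)] by auto
    have "u \<noteq> b i" "u \<noteq> b' i" using u cut by (auto simp: abs_if split: if_splits)
    then have "D.sp i u \<notin> classical_params D" using D.classical_cuts[OF iu(1)] iu(2) by force
    then have Fu: "F (D.sp i u) = step_color (b i) (b' i) (x i) (F (D.sp i ((b i + b' i) / 2))) (z i) u"
      using D.diagram_coloring_step[OF F iu(1) less_imp_le[OF iu(2)]] ends[OF iu(1)] by simp
    have "F (D.sp i u) = st i u"
      unfolding Fu st_def step_color_def using u cut by (auto simp: abs_if split: if_splits)
    then show ?thesis using G_in[OF iu] param_coloring_same[OF F iu(3)] by simp
  qed (rule G_out)
  \<comment> \<open>The core is closed and lies in the open strands, so a parameter that is not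
    inside, even an end point, has a neighbourhood avoiding it.\<close>
  have near: "\<forall>\<^sub>F s in nhds (snd p). G (fst p, s) = F (fst p, s)" if "\<not> D.inside p" for p
  proof -
    have "\<forall>\<^sub>F s in nhds (snd p). \<forall>i<length ss. \<forall>u. \<bar>u\<bar> \<le> \<rho> i \<longrightarrow> \<not> same_param (fst p, s) (D.sp i u)"
    proof (rule D.eventually_not_core)
      fix i u assume "i < length ss" "\<bar>u\<bar> \<le> \<rho> i"
      then show "\<not> same_param (fst p, snd p) (D.sp i u)"
        using that \<rho>[of i] by (auto simp: D.inside_def)
    qed
    then show ?thesis by eventually_elim (rule G_noncore)
  qed
  have before_out: "before F p w \<Longrightarrow> before G p w" and after_out: "after F p w \<Longrightarrow> after G p w"
    if "\<not> D.inside p" for p w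
  proof -
    have l: "\<forall>\<^sub>F s in at_left (snd p). G (fst p, s) = F (fst p, s)"
      and r: "\<forall>\<^sub>F s in at_right (snd p). G (fst p, s) = F (fst p, s)"
      using near[OF that] by (simp_all add: eventually_nhds_real_split)
    show "before G p w" if "before F p w"
      using l that unfolding before_def by eventually_elim simp
    show "after G p w" if "after F p w"
      using r that unfolding after_def by eventually_elim simp
  qed
  define le where "le i = step_color_left (c i) (c' i) (x i) (y i) (z i)" for i
  have sides: "before G (D.sp i u) (if D.orient i then le i u else st i u)"
      "after G (D.sp i u) (if D.orient i then st i u else le i u)" if i: "i < length ss" and u: "\<bar>u\<bar> < 1" for i u
  proof -
    have "\<forall>\<^sub>F w in at u. w \<in> {-1<..<1} - {u}" using u by (intro eventually_at_in_open) auto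
    then have "\<forall>\<^sub>F w in at u. G (D.sp i w) = st i w"
      by eventually_elim (auto intro!: G_in i)
    then have at: "\<forall>\<^sub>F w in at_left u. G (D.sp i w) = st i w" "\<forall>\<^sub>F w in at_right u. G (D.sp i w) = st i w"
      by (auto simp: eventually_at_split)
    have l: "\<forall>\<^sub>F w in at_left u. G (D.sp i w) = le i u"
      using at(1) eventually_step_color(1)[of "c i" "c' i" "x i" "y i" "z i" u]
      by eventually_elim (simp add: st_def le_def)
    have r: "\<forall>\<^sub>F w in at_right u. G (D.sp i w) = st i u"
      using at(2) eventually_step_color(2)[of "c i" "c' i" "x i" "y i" "z i" u]
      by eventually_elim (simp add: st_def)
    show "before G (D.sp i u) (if D.orient i then le i u else st i u)"
      "after G (D.sp i u) (if D.orient i then st i u else le i u)"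
      by (rule D.before_after_sp[OF i l r])+
  qed
  have xyz: "x i \<in> X" "y i \<in> X" "z i \<in> X" "D.sp i (c i) \<notin> classical_params E \<Longrightarrow> x i = y i"
      "D.sp i (c' i) \<notin> classical_params E \<Longrightarrow> y i = z i" if "i < length ss" for i
    using sol that by (auto simp: E.solution_def)
  have "diagram_coloring X ut ot E G"
    unfolding param_coloring_def classical_params_eq[symmetric] locally_constant_iff
  proof (intro conjI allI impI)
    fix p :: param assume p: "fst p < ncomp E" "p \<notin> classical_params E"
    have pD: "p \<in> params D" using p(1) by (simp add: D.params_iff ncomp_eq)
    have "G p \<in> X \<and> before G p (G p) \<and> after G p (G p)"
    proof (cases "D.inside p")
      case True
      then obtain i u where iu: "i < length ss" "\<bar>u\<bar> < 1" "same_param p (D.sp i u)" by (auto simp: D.inside_def)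
      have nc: "D.sp i u \<notin> classical_params E" using p(2) E.classical_same[OF iu(3)] by simp
      have "le i u = st i u"
        using xyz[OF iu(1)] E.cuts[OF iu(1)] nc by (auto simp: le_def st_def step_color_left_def step_color_def)
      then have "before G (D.sp i u) (G p)" "after G (D.sp i u) (G p)"
        using sides[OF iu(1,2)] G_in[OF iu] by (auto split: if_splits)
      moreover have "G p \<in> X" using G_in[OF iu] xyz[OF iu(1)] by (simp add: st_def step_color_def)
      ultimately show ?thesis
        using before_same_param[of G, OF G_same same_param_sym[OF iu(3)]]
          after_same_param[of G, OF G_same same_param_sym[OF iu(3)]] by blast
    next
      case False
      then have "p \<notin> classical_params D" using p(2) classical_not_inside[OF pD] by simp
      then have "F p \<in> X" "before F p (F p) \<and> after F p (F p)"
        using param_coloring_in[OF F] param_coloring_local[OF F, of p] pD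
        by (simp_all add: D.params_iff classical_params_eq locally_constant_iff)
      then show ?thesis using before_out[OF False] after_out[OF False] G_out[OF False] by simp
    qed
    then show "G p \<in> X" "before G p (G p)" "after G p (G p)" by auto
  next
    fix p q assume ov: "over_at E p q"
    then have pq: "p \<in> params D" "q \<in> params D" using E.over_at_params params_eq by auto
    show "\<exists>ob oa ub ua. before G p ob \<and> after G p oa \<and> before G q ub \<and> after G q ua \<and>
        crossing_relation ut ot (positive_at E p q) ob oa ub ua"
    proof (cases "out p")
      case True
      then have oq: "out q" using out_crossing ov by (auto simp: over_at_def)
      have ovD: "over_at D p q" using over_at_out[OF True] ov by simp
      have "\<not> D.inside p" "\<not> D.inside q"
        using outD[OF True] outD[OF oq] by (force simp: D.inside_def)+
      then show ?thesis
        unfolding positive_at_out[OF True ovD]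
        using param_coloring_crossing[OF F ovD] before_out after_out by blast
    next
      case False
      then have oq: "\<not> out q" using out_crossing[of q p] ov crossing_sym[of E p q] by (auto simp: over_at_def)
      obtain i u where iu: "i < length ss" "\<bar>u\<bar> \<le> 1" "same_param p (D.sp i u)" using not_out[OF pq(1) False] by blast
      obtain j v where jv: "j < length ss" "\<bar>v\<bar> \<le> 1" "same_param q (D.sp j v)" using not_out[OF pq(2) oq] by blast
      have ov': "over_at E (D.sp i u) (D.sp j v)" using E.over_at_same[OF iu(3) jv(3) ov] .
      have u: "\<bar>u\<bar> < 1" using over_at_classical[OF ov'] E.classical_cuts[OF iu(1,2)] E.cuts[OF iu(1)] by auto
      have v: "\<bar>v\<bar> < 1" using over_at_classical[OF ov'] E.classical_cuts[OF jv(1,2)] E.cuts[OF jv(1)] by auto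
      have pos: "positive_at E p q \<longleftrightarrow> (cross ((gs' ! i) u) ((gs' ! j) v) > 0) = (D.orient i = D.orient j)"
        using E.positive_at_sp(1)[OF iu(1) jv(1) u v] ov' E.velocity_same[OF _ iu(3)] E.velocity_same[OF _ jv(3)] pq params_eq
        by (simp add: over_at_def positive_at_def)
      have "strand_crossing ut ot (cross ((gs' ! i) u) ((gs' ! j) v) > 0) (D.orient i) (D.orient j)
          (le i u) (st i u) (le j v) (st j v)"
        using sol ov' iu(1) jv(1) u v by (simp add: E.solution_def le_def st_def)
      then have "crossing_relation ut ot (positive_at E p q) (if D.orient i then le i u else st i u)
          (if D.orient i then st i u else le i u) (if D.orient j then le j v else st j v)
          (if D.orient j then st j v else le j v)"
        unfolding pos strand_crossing_def .
      moreover note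
        before_same_param[of G, OF G_same same_param_sym[OF iu(3)] sides(1)[OF iu(1) u]]
        after_same_param[of G, OF G_same same_param_sym[OF iu(3)] sides(2)[OF iu(1) u]]
        before_same_param[of G, OF G_same same_param_sym[OF jv(3)] sides(1)[OF jv(1) v]]
        after_same_param[of G, OF G_same same_param_sym[OF jv(3)] sides(2)[OF jv(1) v]]
      ultimately show ?thesis by blast
    qed
  qed (rule G_same)
  with G_out show ?thesis by (intro exI[of _ G]) simp
qed

end

lemma disc_change_sym:
  assumes "disc_change D E ss fs fs' gs gs' \<phi> b b' c c'"
  shows "disc_change E D ss gs gs' fs fs' \<phi> c c' b b'"
proof -
  interpret disc_change D E ss fs fs' gs gs' \<phi> b b' c c' by fact
  show ?thesis
    by unfold_locales (use agree params_eq ncomp_eq in auto)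
qed

context disc_change
begin

text \<open>Reduces a move to algebra: the systems of the two pictures must be solvable for the same
  outer colors, and in each of them the outer colors must determine the middle ones.\<close>

theorem coloring_equivalent_disc_change:
  assumes ex1: "\<And>x y z. D.solution X ut ot x y z \<Longrightarrow> \<exists>y'. E.solution X ut ot x y' z"
    and ex2: "\<And>x y z. E.solution X ut ot x y z \<Longrightarrow> \<exists>y'. D.solution X ut ot x y' z"
    and uniq1: "\<And>x y z x' y' z' i. D.solution X ut ot x y z \<Longrightarrow> D.solution X ut ot x' y' z' \<Longrightarrow>
      \<forall>j<length ss. x j = x' j \<and> z j = z' j \<Longrightarrow> i < length ss \<Longrightarrow> y i = y' i"
    and uniq2: "\<And>x y z x' y' z' i. E.solution X ut ot x y z \<Longrightarrow> E.solution X ut ot x' y' z' \<Longrightarrow>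
      \<forall>j<length ss. x j = x' j \<and> z j = z' j \<Longrightarrow> i < length ss \<Longrightarrow> y i = y' i"
  shows "coloring_equivalent X ut ot D E"
proof -
  interpret S: disc_change E D ss gs gs' fs fs' \<phi> c c' b b'
    by (rule disc_change_sym) unfold_locales
  let ?A = "{(p, p) | p. p \<in> params D \<and> p \<notin> classical_params D \<and> \<not> D.inside p}"
  show ?thesis
  proof (rule coloring_equivalent_transfer[OF D.vld E.vld, where A = ?A])
    show "?A \<subseteq> (params D - classical_params D) \<times> (params E - classical_params E)"
      using classical_not_inside params_eq by auto
  next
    fix F assume F: "diagram_coloring X ut ot D F"
    obtain y where "E.solution X ut ot (\<lambda>i. F (D.sp i (-1))) y (\<lambda>i. F (D.sp i 1))"
      using ex1[OF D.diagram_coloring_solution[OF F]] by blast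
    from extend_coloring[OF F this] show "\<exists>G. diagram_coloring X ut ot E G \<and> (\<forall>(p, q)\<in>?A. F p = G q)"
      by auto
  next
    fix G assume G: "diagram_coloring X ut ot E G"
    obtain y where "D.solution X ut ot (\<lambda>i. G (D.sp i (-1))) y (\<lambda>i. G (D.sp i 1))"
      using ex2[OF E.diagram_coloring_solution[OF G]] by blast
    from S.extend_coloring[OF G this] show "\<exists>F. diagram_coloring X ut ot D F \<and> (\<forall>(p, q)\<in>?A. F p = G q)"
      by fastforce
  next
    fix F F' p assume F: "diagram_coloring X ut ot D F" "diagram_coloring X ut ot D F'"
      "\<forall>(p, q)\<in>?A. F p = F' p" and p: "p \<in> params D" "p \<notin> classical_params D"
    show "F p = F' p"
    proof (rule D.diagram_coloring_unique[OF F(1,2) _ _ p])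
      fix q assume "q \<in> params D" "q \<notin> classical_params D" "\<not> D.inside q"
      then show "F q = F' q" using F(3) by blast
    qed (fact uniq1)
  next
    fix F F' p assume F: "diagram_coloring X ut ot E F" "diagram_coloring X ut ot E F'"
      "\<forall>(p, q)\<in>?A. F q = F' q" and p: "p \<in> params E" "p \<notin> classical_params E"
    show "F p = F' p"
    proof (rule E.diagram_coloring_unique[OF F(1,2) _ _ p])
      fix q assume "q \<in> params E" "q \<notin> classical_params E" "\<not> D.inside q"
      then show "F q = F' q" using F(3) classical_not_inside params_eq by blast
    qed (fact uniq2)
  qed
qed

end

section \<open>The arcs of the moves\<close>

lemma has_vector_derivative_Complex:
  assumes "(f has_real_derivative f') (at u)" "(g has_real_derivative g') (at u)"
  shows "((\<lambda>u. Complex (f u) (g u)) has_vector_derivative Complex f' g') (at u)"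
  using assms by (simp add: has_vector_derivative_complex_iff)

definition curl_arc' :: "real \<Rightarrow> complex" where
  "curl_arc' u = Complex (1 - 16/9 * (1 - u\<^sup>2)\<^sup>2 + 64/9 * u\<^sup>2 * (1 - u\<^sup>2)) (- 2 * u * (1 - u\<^sup>2))"

definition dipping_arc' :: "real \<Rightarrow> complex" where
  "dipping_arc' u = Complex (4/5) (64/15 * u * (1 - u\<^sup>2))"

definition above_arc' :: "real \<Rightarrow> complex" where
  "above_arc' u = Complex 1 (- 8/3 * u * (1 - u\<^sup>2))"

definition below_arc' :: "real \<Rightarrow> complex" where
  "below_arc' u = Complex 1 (8/3 * u * (1 - u\<^sup>2))"

lemma arc_derivatives:
  "(straight_arc has_vector_derivative 1) (at u)"
  "(high_arc has_vector_derivative Complex (4/5) 0) (at u)"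
  "(rising_arc has_vector_derivative Complex (4/5) (3/5)) (at u)"
  "(falling_arc has_vector_derivative Complex (4/5) (- 3/5)) (at u)"
  "(curl_arc has_vector_derivative curl_arc' u) (at u)"
  "(dipping_arc has_vector_derivative dipping_arc' u) (at u)"
  "(above_arc has_vector_derivative above_arc' u) (at u)"
  "(below_arc has_vector_derivative below_arc' u) (at u)"
  unfolding straight_arc_def[abs_def] high_arc_def[abs_def] rising_arc_def[abs_def] falling_arc_def[abs_def]
    curl_arc_def[abs_def] dipping_arc_def[abs_def] above_arc_def[abs_def] below_arc_def[abs_def]
    curl_arc'_def dipping_arc'_def above_arc'_def below_arc'_def one_complex.code
  by (rule has_vector_derivative_Complex;
      (auto intro!: derivative_eq_intros simp: power2_eq_square field_simps))+

lemma norm_Complex_le_1: "a\<^sup>2 + c\<^sup>2 \<le> 1 \<Longrightarrow> norm (Complex a c) \<le> 1"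
  by (simp add: cmod_def)

lemma unit_square_bounds:
  fixes u :: real
  assumes "\<bar>u\<bar> \<le> 1"
  shows "0 \<le> 1 - u\<^sup>2" "1 - u\<^sup>2 \<le> 1" "(1 - u\<^sup>2)\<^sup>2 \<le> 1 - u\<^sup>2" "((1 - u\<^sup>2)\<^sup>2)\<^sup>2 \<le> 1 - u\<^sup>2"
proof -
  show s: "0 \<le> 1 - u\<^sup>2" "1 - u\<^sup>2 \<le> 1" using assms by (auto simp: abs_square_le_1)
  have sq: "x\<^sup>2 \<le> x" if "0 \<le> x" "x \<le> 1" for x :: real
    using mult_left_mono[OF that(2,1)] by (simp add: power2_eq_square)
  show 1: "(1 - u\<^sup>2)\<^sup>2 \<le> 1 - u\<^sup>2" using sq[OF s] .
  show "((1 - u\<^sup>2)\<^sup>2)\<^sup>2 \<le> 1 - u\<^sup>2" using sq[of "(1 - u\<^sup>2)\<^sup>2"] 1 s by simp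
qed

lemma norm_arcs:
  fixes u :: real
  assumes "\<bar>u\<bar> \<le> 1"
  shows "norm (straight_arc u) \<le> 1" "norm (high_arc u) \<le> 1" "norm (rising_arc u) \<le> 1" "norm (falling_arc u) \<le> 1"
    "norm (curl_arc u) \<le> 1" "norm (dipping_arc u) \<le> 1" "norm (above_arc u) \<le> 1" "norm (below_arc u) \<le> 1"
proof -
  note b = unit_square_bounds[OF assms]
  define s where "s = 1 - u\<^sup>2"
  have u2: "u\<^sup>2 = 1 - s" by (simp add: s_def)
  note b' = b[folded s_def]
  show "norm (straight_arc u) \<le> 1" "norm (high_arc u) \<le> 1" "norm (rising_arc u) \<le> 1" "norm (falling_arc u) \<le> 1"
    unfolding straight_arc_def high_arc_def rising_arc_def falling_arc_def
    using b by (intro norm_Complex_le_1; simp add: power_mult_distrib power_divide)+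
  show "norm (above_arc u) \<le> 1" "norm (below_arc u) \<le> 1"
    unfolding above_arc_def below_arc_def s_def[symmetric]
    using b' by (intro norm_Complex_le_1; simp add: power_mult_distrib power_divide u2)+
  \<comment> \<open>Bounds the real part of the curl by \<open>\<bar>u\<bar>\<close>; the squared
    norm is then at most \<open>(1 - s) + s/4\<close>.\<close>
  have "- 1 \<le> 1 - 16/9 * s\<^sup>2" "1 - 16/9 * s\<^sup>2 \<le> 1" using b' by auto
  then have "\<bar>1 - 16/9 * s\<^sup>2\<bar> \<le> 1" by linarith
  then have "(1 - 16/9 * s\<^sup>2)\<^sup>2 \<le> 1" by (simp only: abs_square_le_1)
  then have "(1 - s) * (1 - 16/9 * s\<^sup>2)\<^sup>2 \<le> 1 - s" using b' by (simp add: mult_left_le)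
  then show "norm (curl_arc u) \<le> 1"
    unfolding curl_arc_def s_def[symmetric]
    using b' by (intro norm_Complex_le_1) (simp add: power_mult_distrib power_divide u2)
  have "\<bar>3/5 - 16/15 * s\<^sup>2\<bar> \<le> 3/5" using b' zero_le_power2[of s] by linarith
  then have "(3/5 - 16/15 * s\<^sup>2)\<^sup>2 \<le> (3/5)\<^sup>2" by (rule abs_le_square_iff[THEN iffD1, OF order_trans]) simp
  moreover have "(4/5 * u)\<^sup>2 \<le> 16/25" using b' by (simp add: power_mult_distrib power_divide u2)
  moreover have "(3/5 :: real)\<^sup>2 = 9/25" by (simp add: power_divide)
  ultimately show "norm (dipping_arc u) \<le> 1"
    unfolding dipping_arc_def s_def[symmetric] by (intro norm_Complex_le_1) linarith
qed

lemma square_eq_quarter: "(v::real)\<^sup>2 = 1/4 \<longleftrightarrow> v = 1/2 \<or> v = -1/2"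
proof -
  have "v\<^sup>2 = 1/4 \<longleftrightarrow> v\<^sup>2 = (1/2)\<^sup>2" by (simp add: power_divide)
  then show ?thesis unfolding power2_eq_iff by auto
qed

text \<open>The bump \<open>(1 - v\<^sup>2)\<^sup>2\<close> takes the value 9/16 exactly at the two
  points 1/2 and -1/2. The coefficients 16/9 of the curl and 16/15, which is 3/5 times 16/9, of the
  dipping arc put the zeros of the respective coordinate there.\<close>

lemma square_eq_nine_sixteenths:
  assumes "(1 - (v::real)\<^sup>2)\<^sup>2 = 9/16" "\<bar>v\<bar> \<le> 1"
  shows "v = 1/2 \<or> v = -1/2"
proof -
  have "(1 - v\<^sup>2)\<^sup>2 = (3/4)\<^sup>2" using assms(1) by (simp add: power_divide)
  then have "1 - v\<^sup>2 = 3/4" using unit_square_bounds(1)[OF assms(2)] by (simp add: power2_eq_iff_nonneg)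
  then show ?thesis using square_eq_quarter[of v] by simp
qed

text \<open>On the interval from 0 to 1 the left side increases and the right side decreases, and
  both are 3/8 at 1/2; negative \<open>v\<close> is excluded by sign. The slope 3/4 is that of the
  rising line, where real part 1/2 means \<open>u = 5/8\<close>.\<close>

lemma bump_eq_iff:
  fixes v :: real
  assumes "\<bar>v\<bar> \<le> 1"
  shows "3/4 * v = 2/3 * (1 - v\<^sup>2)\<^sup>2 \<longleftrightarrow> v = 1/2"
proof
  assume eq: "3/4 * v = 2/3 * (1 - v\<^sup>2)\<^sup>2"
  have v0: "0 \<le> v" using eq zero_le_power2[of "1 - v\<^sup>2"] by linarith
  show "v = 1/2"
  proof (cases "v < 1/2")
    case True
    then have "v\<^sup>2 < (1/2)\<^sup>2" using v0 by (intro power_strict_mono) auto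
    then have "(3/4)\<^sup>2 < (1 - v\<^sup>2)\<^sup>2" by (intro power_strict_mono) (auto simp: power_divide)
    then show ?thesis using eq True by (simp add: power_divide)
  next
    case False
    then have "(1/2)\<^sup>2 \<le> v\<^sup>2" by (intro power_mono) auto
    then have "(1 - v\<^sup>2)\<^sup>2 \<le> (3/4)\<^sup>2"
      using unit_square_bounds(1)[OF assms] by (intro power_mono) (auto simp: power_divide)
    then show ?thesis using eq False by (simp add: power_divide)
  qed
next
  assume v: "v = 1/2"
  show "3/4 * v = 2/3 * (1 - v\<^sup>2)\<^sup>2" unfolding v by (simp add: power_divide)
qed

lemma arc_intersections:
  fixes u v :: real
  assumes "\<bar>u\<bar> \<le> 1" "\<bar>v\<bar> \<le> 1"
  shows "rising_arc u = falling_arc v \<longleftrightarrow> u = 0 \<and> v = 0"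
    "rising_arc u = above_arc v \<longleftrightarrow> u = 5/8 \<and> v = 1/2"
    "falling_arc u = above_arc v \<longleftrightarrow> u = -5/8 \<and> v = -1/2"
    "rising_arc u = below_arc v \<longleftrightarrow> u = -5/8 \<and> v = -1/2"
    "falling_arc u = below_arc v \<longleftrightarrow> u = 5/8 \<and> v = 1/2"
    "straight_arc u \<noteq> high_arc v"
    "straight_arc u = dipping_arc v \<longleftrightarrow> u = -2/5 \<and> v = -1/2 \<or> u = 2/5 \<and> v = 1/2"
    "curl_arc u = curl_arc v \<longleftrightarrow> u = v \<or> u = -1/2 \<and> v = 1/2 \<or> u = 1/2 \<and> v = -1/2"
proof -
  show "rising_arc u = falling_arc v \<longleftrightarrow> u = 0 \<and> v = 0"
    by (auto simp: rising_arc_def falling_arc_def)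
  have p: "3/4 * v = 2/3 * (1 - v\<^sup>2)\<^sup>2 \<longleftrightarrow> v = 1/2" by (rule bump_eq_iff[OF assms(2)])
  have m: "- 3/4 * v = 2/3 * (1 - v\<^sup>2)\<^sup>2 \<longleftrightarrow> v = - 1/2"
    using bump_eq_iff[of "- v"] assms(2) by auto
  have "rising_arc u = above_arc v \<longleftrightarrow> v = 4/5 * u \<and> 3/4 * v = 2/3 * (1 - v\<^sup>2)\<^sup>2"
    by (auto simp: rising_arc_def above_arc_def)
  then show "rising_arc u = above_arc v \<longleftrightarrow> u = 5/8 \<and> v = 1/2" unfolding p by auto
  have "falling_arc u = below_arc v \<longleftrightarrow> v = 4/5 * u \<and> 3/4 * v = 2/3 * (1 - v\<^sup>2)\<^sup>2"
    by (auto simp: falling_arc_def below_arc_def)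
  then show "falling_arc u = below_arc v \<longleftrightarrow> u = 5/8 \<and> v = 1/2" unfolding p by auto
  have "falling_arc u = above_arc v \<longleftrightarrow> v = 4/5 * u \<and> - 3/4 * v = 2/3 * (1 - v\<^sup>2)\<^sup>2"
    by (auto simp: falling_arc_def above_arc_def)
  then show "falling_arc u = above_arc v \<longleftrightarrow> u = -5/8 \<and> v = -1/2" unfolding m by auto
  have "rising_arc u = below_arc v \<longleftrightarrow> v = 4/5 * u \<and> - 3/4 * v = 2/3 * (1 - v\<^sup>2)\<^sup>2"
    by (auto simp: rising_arc_def below_arc_def)
  then show "rising_arc u = below_arc v \<longleftrightarrow> u = -5/8 \<and> v = -1/2" unfolding m by auto
  show "straight_arc u \<noteq> high_arc v" by (simp add: straight_arc_def high_arc_def)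
  show "straight_arc u = dipping_arc v \<longleftrightarrow> u = -2/5 \<and> v = -1/2 \<or> u = 2/5 \<and> v = 1/2"
  proof
    assume "straight_arc u = dipping_arc v"
    then have "u = 4/5 * v" "(1 - v\<^sup>2)\<^sup>2 = 9/16" by (auto simp: straight_arc_def dipping_arc_def)
    then show "u = -2/5 \<and> v = -1/2 \<or> u = 2/5 \<and> v = 1/2"
      using square_eq_nine_sixteenths[OF _ assms(2)] by auto
  next
    assume "u = -2/5 \<and> v = -1/2 \<or> u = 2/5 \<and> v = 1/2"
    then have uv: "u = 4/5 * v" "v\<^sup>2 = 1/4" unfolding square_eq_quarter by auto
    have "3/5 - 16/15 * (1 - v\<^sup>2)\<^sup>2 = 0" unfolding uv(2) by (simp add: power_divide)
    then show "straight_arc u = dipping_arc v" by (simp only: straight_arc_def dipping_arc_def uv(1))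
  qed
  show "curl_arc u = curl_arc v \<longleftrightarrow> u = v \<or> u = -1/2 \<and> v = 1/2 \<or> u = 1/2 \<and> v = -1/2"
  proof
    assume eq: "curl_arc u = curl_arc v"
    then have "(1 - u\<^sup>2)\<^sup>2 = (1 - v\<^sup>2)\<^sup>2" by (simp add: curl_arc_def)
    then have "u\<^sup>2 = v\<^sup>2"
      using unit_square_bounds(1)[OF assms(1)] unit_square_bounds(1)[OF assms(2)] by (simp add: power2_eq_iff_nonneg)
    then have "u = v \<or> u = - v" by (simp add: power2_eq_iff)
    \<comment> \<open>The real part of the curl is odd in \<open>u\<close>, so it must vanish when
      it agrees at \<open>u\<close> and \<open>- u\<close>.\<close>
    moreover have "u = 1/2 \<or> u = -1/2" if "u = - v" "u \<noteq> v"
    proof -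
      have "u * (1 - 16/9 * (1 - u\<^sup>2)\<^sup>2) = 0" using eq that by (simp add: curl_arc_def)
      then have "(1 - u\<^sup>2)\<^sup>2 = 9/16" using that by auto
      then show ?thesis using square_eq_nine_sixteenths assms(1) by blast
    qed
    ultimately show "u = v \<or> u = -1/2 \<and> v = 1/2 \<or> u = 1/2 \<and> v = -1/2" by auto
  next
    assume "u = v \<or> u = -1/2 \<and> v = 1/2 \<or> u = 1/2 \<and> v = -1/2"
    moreover have "curl_arc (1/2) = curl_arc (-1/2)" by (simp add: curl_arc_def power_divide)
    ultimately show "curl_arc u = curl_arc v" by metis
  qed
qed

lemma arcs_simple:
  "straight_arc u = straight_arc v \<longleftrightarrow> u = v" "high_arc u = high_arc v \<longleftrightarrow> u = v"
  "rising_arc u = rising_arc v \<longleftrightarrow> u = v" "falling_arc u = falling_arc v \<longleftrightarrow> u = v"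
  "dipping_arc u = dipping_arc v \<longleftrightarrow> u = v" "above_arc u = above_arc v \<longleftrightarrow> u = v" "below_arc u = below_arc v \<longleftrightarrow> u = v"
  by (auto simp: straight_arc_def high_arc_def rising_arc_def falling_arc_def dipping_arc_def above_arc_def below_arc_def)

section \<open>Invariance under the moves\<close>

lemma local_change_tangles:
  assumes lc: "local_change D E ss fs gs" and vld: "virtual_link_diagram D" "virtual_link_diagram E"
    and proper: "\<And>i u. i < length fs \<Longrightarrow> \<bar>u\<bar> \<le> 1 \<Longrightarrow> norm ((fs ! i) u) \<le> 1 \<and> norm ((gs ! i) u) \<le> 1"
    and deriv: "\<And>i u. i < length fs \<Longrightarrow> ((fs ! i) has_vector_derivative (fs' ! i) u) (at u) \<and>
      ((gs ! i) has_vector_derivative (gs' ! i) u) (at u)"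
  obtains \<phi> where "tangle_pair D E ss fs fs' gs gs' \<phi>" "length ss = length fs"
proof -
  obtain \<phi> where \<phi>: "plane_diffeo \<phi>" "\<forall>z. jacobian \<phi> z > 0"
    and arcs: "\<forall>i<length ss. \<forall>u\<in>{-1..1}. point D (strand_param (ss ! i) u) = \<phi> ((fs ! i) u) \<and>
           point E (strand_param (ss ! i) u) = \<phi> ((gs ! i) u)"
    and out: "\<forall>p\<in>params D. (\<forall>s\<in>set ss. p \<notin> on_strand s) \<longrightarrow>
           point E p = point D p \<and> point D p \<notin> \<phi> ` cball 0 1 \<and> (p \<in> over E \<longleftrightarrow> p \<in> over D)"
    using lc unfolding local_change_def by (elim conjE exE) (rule that)
  have n: "ncomp E = ncomp D" and len: "length ss = length fs" "length gs = length fs"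
    and strands: "\<forall>(k, c, r)\<in>set ss. k < ncomp D \<and> r \<noteq> 0 \<and> \<bar>r\<bar> < 1/2"
    and disj: "\<forall>i<length ss. \<forall>j<length ss. i \<noteq> j \<longrightarrow> on_strand (ss ! i) \<inter> on_strand (ss ! j) = {}"
    using lc[unfolded local_change_def] by - (elim conjE, assumption)+
  have params: "params E = params D" using n by (simp add: params_def)
  have "tangle D ss fs fs' \<phi>"
  proof
    show "virtual_link_diagram D" "length ss = length fs" "plane_diffeo \<phi>" by fact+
    show "k < ncomp D \<and> r \<noteq> 0 \<and> \<bar>r\<bar> < 1/2" if "(k, c, r) \<in> set ss" for k c r
      using strands that by fastforce
    show "on_strand (ss ! i) \<inter> on_strand (ss ! j) = {}" if "i < length ss" "j < length ss" "i \<noteq> j" for i j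
      using disj that by blast
    show "0 < jacobian \<phi> z" for z using \<phi>(2) by blast
    show "point D (strand_param (ss ! i) u) = \<phi> ((fs ! i) u)" if "i < length ss" "\<bar>u\<bar> \<le> 1" for i u
      using arcs that by (auto simp: abs_le_iff)
    show "point D p \<notin> \<phi> ` cball 0 1" if "p \<in> params D" "\<forall>s\<in>set ss. p \<notin> on_strand s" for p
      using out that by blast
    show "norm ((fs ! i) u) \<le> 1" if "i < length ss" "\<bar>u\<bar> \<le> 1" for i u using proper that len by simp
    show "((fs ! i) has_vector_derivative (fs' ! i) u) (at u)" if "i < length ss" for i u
      using deriv that len by simp
  qed
  moreover have "tangle E ss gs gs' \<phi>"
  proof
    show "virtual_link_diagram E" "plane_diffeo \<phi>" by fact+
    show "length ss = length gs" using len by simp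
    show "k < ncomp E \<and> r \<noteq> 0 \<and> \<bar>r\<bar> < 1/2" if "(k, c, r) \<in> set ss" for k c r
      using strands that n by fastforce
    show "on_strand (ss ! i) \<inter> on_strand (ss ! j) = {}" if "i < length ss" "j < length ss" "i \<noteq> j" for i j
      using disj that by blast
    show "0 < jacobian \<phi> z" for z using \<phi>(2) by blast
    show "point E (strand_param (ss ! i) u) = \<phi> ((gs ! i) u)" if "i < length ss" "\<bar>u\<bar> \<le> 1" for i u
      using arcs that by (auto simp: abs_le_iff)
    show "point E p \<notin> \<phi> ` cball 0 1" if "p \<in> params E" "\<forall>s\<in>set ss. p \<notin> on_strand s" for p
      using out that unfolding params by force
    show "norm ((gs ! i) u) \<le> 1" if "i < length ss" "\<bar>u\<bar> \<le> 1" for i u using proper that len by simp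
    show "((gs ! i) has_vector_derivative (gs' ! i) u) (at u)" if "i < length ss" for i u
      using deriv that len by simp
  qed
  moreover have "tangle_pair_axioms D E ss"
    by unfold_locales (use n out in blast)+
  ultimately show thesis using that len(1) by (simp add: tangle_pair_def)
qed

lemma disc_changeI:
  assumes tp: "tangle_pair D E ss fs fs' gs gs' \<phi>"
    and "\<And>i. i < length ss \<Longrightarrow> - 1 < b i \<and> b i < b' i \<and> b' i < 1 \<and> - 1 < c i \<and> c i < c' i \<and> c' i < 1"
    and "\<And>i u. i < length ss \<Longrightarrow> \<bar>u\<bar> \<le> 1 \<Longrightarrow> strand_param (ss ! i) u \<in> classical_params D \<Longrightarrow> u = b i \<or> u = b' i"
    and "\<And>i u. i < length ss \<Longrightarrow> \<bar>u\<bar> \<le> 1 \<Longrightarrow> strand_param (ss ! i) u \<in> classical_params E \<Longrightarrow> u = c i \<or> u = c' i"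
  shows "disc_change D E ss fs fs' gs gs' \<phi> b b' c c'"
  using assms tangle_pair.axioms[OF tp] by (simp add: disc_change_def cut_tangle_def cut_tangle_axioms_def)

context tangle
begin

lemma classical_sp:
  assumes "i < length ss" "\<bar>u\<bar> \<le> 1" "sp i u \<in> classical_params D"
  obtains j v where "j < length ss" "\<bar>v\<bar> \<le> 1" "over_at D (sp i u) (sp j v) \<or> over_at D (sp j v) (sp i u)"
proof -
  obtain q where q: "over_at D (sp i u) q \<or> over_at D q (sp i u)"
    using assms(3) unfolding classical_params_eq classical_of_def by blast
  then have "crossing D (sp i u) q" using crossing_sym by (auto simp: over_at_def)
  moreover have "sp i u \<in> on_strand (ss ! i)" using assms(2) same_param_refl unfolding on_strand_iff by blast
  ultimately obtain j where j: "j < length ss" "q \<in> on_strand (ss ! j)" using crossing_strand assms(1) by blast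
  then obtain v where "\<bar>v\<bar> \<le> 1" "same_param q (sp j v)" by (auto simp: on_strand_iff)
  then show thesis
    using that[OF j(1)] q over_at_same[OF same_param_refl, of q "sp j v" "sp i u"]
      over_at_same[OF _ same_param_refl, of q "sp j v" "sp i u"] by blast
qed

lemma over_at_sp:
  assumes "i < length ss" "j < length ss" "\<bar>u\<bar> \<le> 1" "\<bar>v\<bar> \<le> 1" "over_at D (sp i u) (sp j v)"
  shows "(fs ! i) u = (fs ! j) v" "\<not> (i = j \<and> u = v)"
  using assms crossing_sp_iff[OF assms(1-4)] by (auto simp: over_at_def)

text \<open>\<open>crossing_types\<close> speaks of different strands only; self-crossings of a
  strand are excluded by injectivity of the model arc.\<close>

lemma over_at_crossing_types:
  assumes inj: "inj (fs ! i)" and ct: "crossing_types D ss ov"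
    and ij: "i < length ss" "j < length ss" "\<bar>u\<bar> \<le> 1" "\<bar>v\<bar> \<le> 1"
  shows "over_at D (sp i u) (sp j v) \<longleftrightarrow> i \<noteq> j \<and> ov i j \<and> (fs ! i) u = (fs ! j) v"
proof (cases "i = j")
  case True
  then show ?thesis using over_at_sp[OF ij] inj by (auto dest: injD)
next
  case False
  have "sp i u \<in> on_strand (ss ! i)" "sp j v \<in> on_strand (ss ! j)"
    using ij(3,4) same_param_refl unfolding on_strand_iff by blast+
  then have "crossing D (sp i u) (sp j v) \<Longrightarrow> sp i u \<in> over D \<longleftrightarrow> ov i j"
    using ct ij(1,2) False unfolding crossing_types_def by blast
  then show ?thesis using crossing_sp_iff[OF ij] False by (auto simp: over_at_def)
qed

end

text \<open>Serves the virtual moves and the mixed move: any classical crossing in the disc sits at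
  the centre of both strands and is the same before and after. The two systems then coincide, so a
  solution of one solves the other.\<close>

lemma (in tangle_pair) coloring_equivalent_same_strand_crossings:
  assumes same: "\<And>i j u v. i < length ss \<Longrightarrow> j < length ss \<Longrightarrow> \<bar>u\<bar> \<le> 1 \<Longrightarrow> \<bar>v\<bar> \<le> 1 \<Longrightarrow>
      over_at E (D.sp i u) (D.sp j v) \<longleftrightarrow> over_at D (D.sp i u) (D.sp j v)"
    and centre: "\<And>i j u v. i < length ss \<Longrightarrow> j < length ss \<Longrightarrow> \<bar>u\<bar> \<le> 1 \<Longrightarrow> \<bar>v\<bar> \<le> 1 \<Longrightarrow> over_at D (D.sp i u) (D.sp j v) \<Longrightarrow>
      u = 0 \<and> v = 0 \<and> cross ((fs' ! i) u) ((fs' ! j) v) = cross ((gs' ! i) u) ((gs' ! j) v)"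
  shows "coloring_equivalent X ut ot D E"
proof -
  have clD: "u = 0" if i: "i < length ss" "\<bar>u\<bar> \<le> 1" "D.sp i u \<in> classical_params D" for i u
    by (rule D.classical_sp[OF i]) (use centre i in blast)
  have clE: "u = 0" if i: "i < length ss" "\<bar>u\<bar> \<le> 1" "D.sp i u \<in> classical_params E" for i u
    by (rule E.classical_sp[OF i]) (use centre same i in blast)
  \<comment> \<open>The cut at 1/2 is a dummy, which forces middle and final color to be
    equal.\<close>
  interpret disc_change D E ss fs fs' gs gs' \<phi> "\<lambda>_. 0" "\<lambda>_. 1/2" "\<lambda>_. 0" "\<lambda>_. 1/2"
    by (rule disc_changeI) (unfold_locales, use clD clE in auto)
  have cl: "D.sp i 0 \<in> classical_params E \<longleftrightarrow> D.sp i 0 \<in> classical_params D" if i: "i < length ss" for i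
  proof
    assume "D.sp i 0 \<in> classical_params E"
    then obtain j v where "j < length ss" "\<bar>v\<bar> \<le> 1" "over_at E (D.sp i 0) (D.sp j v) \<or> over_at E (D.sp j v) (D.sp i 0)"
      by (rule E.classical_sp[OF i, of 0, simplified])
    then have "over_at D (D.sp i 0) (D.sp j v) \<or> over_at D (D.sp j v) (D.sp i 0)" using same i by auto
    then show "D.sp i 0 \<in> classical_params D" using over_at_classical by blast
  next
    assume "D.sp i 0 \<in> classical_params D"
    then obtain j v where "j < length ss" "\<bar>v\<bar> \<le> 1" "over_at D (D.sp i 0) (D.sp j v) \<or> over_at D (D.sp j v) (D.sp i 0)"
      by (rule D.classical_sp[OF i, of 0, simplified])
    then have "over_at E (D.sp i 0) (D.sp j v) \<or> over_at E (D.sp j v) (D.sp i 0)" using same i by auto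
    then show "D.sp i 0 \<in> classical_params E" using over_at_classical by blast
  qed
  have sol: "E.solution X ut ot x y z \<longleftrightarrow> D.solution X ut ot x y z" for x y z
  proof -
    have half: "D.sp i (1/2) \<notin> classical_params D" "D.sp i (1/2) \<notin> classical_params E" if "i < length ss" for i
      using clD[OF that, of "1/2"] clE[OF that, of "1/2"] by auto
    show ?thesis
      unfolding D.solution_def E.solution_def
    proof (rule arg_cong2[where f = "(\<and>)"])
      show "(\<forall>i<length ss. x i \<in> X \<and> y i \<in> X \<and> z i \<in> X \<and> (D.sp i 0 \<notin> classical_params E \<longrightarrow> x i = y i) \<and>
          (D.sp i (1/2) \<notin> classical_params E \<longrightarrow> y i = z i)) =
        (\<forall>i<length ss. x i \<in> X \<and> y i \<in> X \<and> z i \<in> X \<and> (D.sp i 0 \<notin> classical_params D \<longrightarrow> x i = y i) \<and>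
          (D.sp i (1/2) \<notin> classical_params D \<longrightarrow> y i = z i))"
        using cl half by auto
      show "(\<forall>i<length ss. \<forall>j<length ss. \<forall>u v. \<bar>u\<bar> < 1 \<longrightarrow> \<bar>v\<bar> < 1 \<longrightarrow> over_at E (D.sp i u) (D.sp j v) \<longrightarrow>
          strand_crossing ut ot (0 < cross ((gs' ! i) u) ((gs' ! j) v)) (D.orient i) (D.orient j)
          (step_color_left 0 (1/2) (x i) (y i) (z i) u) (step_color 0 (1/2) (x i) (y i) (z i) u)
          (step_color_left 0 (1/2) (x j) (y j) (z j) v) (step_color 0 (1/2) (x j) (y j) (z j) v)) =
        (\<forall>i<length ss. \<forall>j<length ss. \<forall>u v. \<bar>u\<bar> < 1 \<longrightarrow> \<bar>v\<bar> < 1 \<longrightarrow> over_at D (D.sp i u) (D.sp j v) \<longrightarrow>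
          strand_crossing ut ot (0 < cross ((fs' ! i) u) ((fs' ! j) v)) (D.orient i) (D.orient j)
          (step_color_left 0 (1/2) (x i) (y i) (z i) u) (step_color 0 (1/2) (x i) (y i) (z i) u)
          (step_color_left 0 (1/2) (x j) (y j) (z j) v) (step_color 0 (1/2) (x j) (y j) (z j) v))"
        using same centre by (intro all_cong1 imp_cong refl) (auto dest: less_imp_le)
    qed
  qed
  have y: "y i = z i" if "D.solution X ut ot x y z" "i < length ss" for x y z i
  proof -
    have "D.sp i (1/2) \<notin> classical_params D" using clD[OF that(2), of "1/2"] by auto
    then show ?thesis using that by (auto simp: D.solution_def)
  qed
  show ?thesis
  proof (rule coloring_equivalent_disc_change)
    fix x y z x' y' z' i
    assume "D.solution X ut ot x y z" "D.solution X ut ot x' y' z'"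
      "\<forall>j<length ss. x j = x' j \<and> z j = z' j" "i < length ss"
    then show "y i = y' i" using y by metis
  next
    fix x y z x' y' z' i
    assume "E.solution X ut ot x y z" "E.solution X ut ot x' y' z'"
      "\<forall>j<length ss. x j = x' j \<and> z j = z' j" "i < length ss"
    then show "y i = y' i" using y sol by metis
  qed (use sol in blast)+
qed

lemma less_2_cases_nat: "(i::nat) < 2 \<longleftrightarrow> i = 0 \<or> i = 1" by auto

lemma less_3_cases_nat: "(i::nat) < 3 \<longleftrightarrow> i = 0 \<or> i = 1 \<or> i = 2" by auto

abbreviation "parallel_arcs \<equiv> [straight_arc, high_arc]"
abbreviation "parallel_arcs' \<equiv> [\<lambda>_ :: real. 1, \<lambda>_. Complex (4/5) 0]"
abbreviation "bigon_arcs \<equiv> [straight_arc, dipping_arc]"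
abbreviation "bigon_arcs' \<equiv> [\<lambda>_ :: real. 1, dipping_arc']"
abbreviation "triangle_arcs f \<equiv> [rising_arc, falling_arc, f]"
abbreviation "triangle_arcs' f \<equiv> [\<lambda>_ :: real. Complex (4/5) (3/5), \<lambda>_. Complex (4/5) (- 3/5), f]"

lemma change1_tangles:
  assumes "change1 D E [s]" "virtual_link_diagram D" "virtual_link_diagram E"
  obtains \<phi> where "tangle_pair D E [s] [straight_arc] [\<lambda>_. 1] [curl_arc] [curl_arc'] \<phi>"
  using assms(1) unfolding change1_def
  by (rule local_change_tangles[where fs' = "[\<lambda>_. 1]" and gs' = "[curl_arc']"])
    (use assms in \<open>auto intro: norm_arcs arc_derivatives\<close>)

lemma change2_tangles:
  assumes "change2 D E ss" "virtual_link_diagram D" "virtual_link_diagram E"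
  obtains \<phi> where "tangle_pair D E ss parallel_arcs parallel_arcs' bigon_arcs bigon_arcs' \<phi>" "length ss = 2"
  using assms(1) unfolding change2_def
  by (rule local_change_tangles[where fs' = parallel_arcs' and gs' = bigon_arcs'])
    (use assms in \<open>auto simp: less_Suc_eq intro: norm_arcs arc_derivatives\<close>)

lemma change3_tangles:
  assumes "change3 D E ss" "virtual_link_diagram D" "virtual_link_diagram E"
  obtains \<phi> where "tangle_pair D E ss (triangle_arcs above_arc) (triangle_arcs' above_arc')
      (triangle_arcs below_arc) (triangle_arcs' below_arc') \<phi>" "length ss = 3"
  using assms(1) unfolding change3_def
  by (rule local_change_tangles[where fs' = "triangle_arcs' above_arc'" and gs' = "triangle_arcs' below_arc'"])
    (use assms in \<open>auto simp: less_Suc_eq intro: norm_arcs arc_derivatives arc_derivatives[simplified]\<close>)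

text \<open>\<open>(i, j, u, v)\<close> stands for a crossing of the strands \<open>i < j\<close> at the parameters \<open>u\<close> and \<open>v\<close>.\<close>

definition crossing_points :: "(real \<Rightarrow> complex) list \<Rightarrow> (nat \<times> nat \<times> real \<times> real) set \<Rightarrow> bool" where
  "crossing_points fs P \<longleftrightarrow> (\<forall>f\<in>set fs. inj f) \<and>
     P \<subseteq> {(i, j, u, v). i < j \<and> j < length fs \<and> \<bar>u\<bar> < 1 \<and> \<bar>v\<bar> < 1} \<and>
     (\<forall>i j u v. i < j \<longrightarrow> j < length fs \<longrightarrow> \<bar>u\<bar> \<le> 1 \<longrightarrow> \<bar>v\<bar> \<le> 1 \<longrightarrow> (fs ! i) u = (fs ! j) v \<longleftrightarrow> (i, j, u, v) \<in> P)"

lemma inj_arcs: "inj straight_arc" "inj high_arc" "inj dipping_arc" "inj rising_arc" "inj falling_arc"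
    "inj above_arc" "inj below_arc"
  by (simp_all add: inj_def arcs_simple)

lemma crossing_points_parallel: "crossing_points parallel_arcs {}"
  using arc_intersections(6) by (simp add: crossing_points_def inj_arcs less_Suc_eq)

lemma crossing_points_bigon: "crossing_points bigon_arcs {(0, 1, -2/5, -1/2), (0, 1, 2/5, 1/2)}"
  using arc_intersections(7) by (simp add: crossing_points_def inj_arcs less_Suc_eq)

text \<open>The move reverses the order of the two crossings along every strand: strand 0 first
  meets strand 1, then strand 2, and afterwards the other way round. This is the pattern of
  \<open>triangle_move\<close>.\<close>

lemma crossing_points_triangle:
  "crossing_points (triangle_arcs above_arc) {(0, 1, 0, 0), (0, 2, 5/8, 1/2), (1, 2, -5/8, -1/2)}"
  "crossing_points (triangle_arcs below_arc) {(0, 1, 0, 0), (0, 2, -5/8, -1/2), (1, 2, 5/8, 1/2)}"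
proof -
  { fix f :: "real \<Rightarrow> complex" and P :: "(nat \<times> nat \<times> real \<times> real) set"
    assume f: "inj f" and P: "P \<subseteq> {(i, j, u, v). (i < j \<and> j < 3) \<and> \<bar>u\<bar> < 1 \<and> \<bar>v\<bar> < 1}"
      and eq: "\<And>u v. \<bar>u\<bar> \<le> 1 \<Longrightarrow> \<bar>v\<bar> \<le> 1 \<Longrightarrow> rising_arc u = falling_arc v \<longleftrightarrow> (0, 1, u, v) \<in> P"
        "\<And>u v. \<bar>u\<bar> \<le> 1 \<Longrightarrow> \<bar>v\<bar> \<le> 1 \<Longrightarrow> rising_arc u = f v \<longleftrightarrow> (0, 2, u, v) \<in> P"
        "\<And>u v. \<bar>u\<bar> \<le> 1 \<Longrightarrow> \<bar>v\<bar> \<le> 1 \<Longrightarrow> falling_arc u = f v \<longleftrightarrow> (1, 2, u, v) \<in> P"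
    have "crossing_points (triangle_arcs f) P"
      unfolding crossing_points_def
    proof (intro conjI allI impI)
      show "\<forall>f\<in>set (triangle_arcs f). inj f" using f inj_arcs by simp
      show "P \<subseteq> {(i, j, u, v). i < j \<and> j < length (triangle_arcs f) \<and> \<bar>u\<bar> < 1 \<and> \<bar>v\<bar> < 1}"
        using P by auto
      fix i j and u v :: real assume "i < j" "j < length (triangle_arcs f)" and uv: "\<bar>u\<bar> \<le> 1" "\<bar>v\<bar> \<le> 1"
      then have "i = 0 \<and> j = 1 \<or> i = 0 \<and> j = 2 \<or> i = 1 \<and> j = 2" by auto
      then show "(triangle_arcs f ! i) u = (triangle_arcs f ! j) v \<longleftrightarrow> (i, j, u, v) \<in> P"
        by (elim disjE conjE) (simp_all only: nth_Cons_0 nth_Cons_numeral One_nat_def nth_Cons_Suc eq[OF uv] numeral_2_eq_2)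
    qed }
  note * = this
  show "crossing_points (triangle_arcs above_arc) {(0, 1, 0, 0), (0, 2, 5/8, 1/2), (1, 2, -5/8, -1/2)}"
    by (rule *) (simp_all add: inj_arcs arc_intersections(1-3))
  show "crossing_points (triangle_arcs below_arc) {(0, 1, 0, 0), (0, 2, -5/8, -1/2), (1, 2, 5/8, 1/2)}"
    by (rule *) (simp_all add: inj_arcs arc_intersections(1,4,5))
qed

lemma (in tangle) over_at_crossing_points:
  assumes cp: "crossing_points fs P" and ct: "crossing_types D ss ov"
    and ij: "i < length ss" "j < length ss" "\<bar>u\<bar> \<le> 1" "\<bar>v\<bar> \<le> 1"
  shows "over_at D (sp i u) (sp j v) \<longleftrightarrow> ov i j \<and> ((i, j, u, v) \<in> P \<or> (j, i, v, u) \<in> P)"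
proof -
  have P: "(fs ! i) u = (fs ! j) v \<longleftrightarrow> (i, j, u, v) \<in> P" if "i < j" "j < length ss" "\<bar>u\<bar> \<le> 1" "\<bar>v\<bar> \<le> 1" for i j u v
    using cp that len by (simp add: crossing_points_def)
  have Pless: "(i, j, u, v) \<in> P \<Longrightarrow> i < j" for i j u v using cp by (auto simp: crossing_points_def)
  have "inj (fs ! i)" using cp ij(1) len by (simp add: crossing_points_def)
  from over_at_crossing_types[OF this ct ij] show ?thesis
    using P[of i j u v] P[of j i v u] Pless[of i j u v] Pless[of j i v u] ij
    by (cases i j rule: linorder_cases) auto
qed

lemma VR1_coloring_equivalent:
  assumes "VR1 D E" "virtual_link_diagram D" "virtual_link_diagram E"
  shows "coloring_equivalent X ut ot D E"
proof -
  obtain s where s: "change1 D E [s]" "strand_param s (-1/2) \<notin> over E" "strand_param s (1/2) \<notin> over E"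
    using assms(1) by (auto simp: VR1_def)
  obtain \<phi> where "tangle_pair D E [s] [straight_arc] [\<lambda>_. 1] [curl_arc] [curl_arc'] \<phi>"
    by (rule change1_tangles[OF s(1) assms(2,3)])
  then interpret tangle_pair D E "[s]" "[straight_arc]" "[\<lambda>_. 1]" "[curl_arc]" "[curl_arc']" \<phi> .
  have oD: "\<not> over_at D (strand_param s u) (strand_param s v)" if "\<bar>u\<bar> \<le> 1" "\<bar>v\<bar> \<le> 1" for u v
    using D.over_at_sp[of 0 0 u v] that arcs_simple by auto
  have oE: "\<not> over_at E (strand_param s u) (strand_param s v)" if "\<bar>u\<bar> \<le> 1" "\<bar>v\<bar> \<le> 1" for u v
  proof
    assume ov: "over_at E (strand_param s u) (strand_param s v)"
    then have "u = -1/2 \<or> u = 1/2"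
      using E.over_at_sp[of 0 0 u v] that arc_intersections(8)[OF that] by auto
    then show False using ov s(2,3) unfolding over_at_def by metis
  qed
  show ?thesis
    by (rule coloring_equivalent_same_strand_crossings) (use oD oE in auto)
qed

text \<open>Vacuously true; it makes the lemmas on crossing points available for the parallel
  strands before a second Reidemeister move.\<close>

lemma (in tangle) crossing_types_no_crossing_points:
  assumes cp: "crossing_points fs {}"
  shows "crossing_types D ss ov"
  unfolding crossing_types_def
proof (intro allI impI ballI)
  fix i j p q
  assume ij: "i < length ss" "j < length ss" "i \<noteq> j"
    and p: "p \<in> on_strand (ss ! i)" and q: "q \<in> on_strand (ss ! j)" and cr: "crossing D p q"
  obtain u v where uv: "\<bar>u\<bar> \<le> 1" "\<bar>v\<bar> \<le> 1" "same_param p (sp i u)" "same_param q (sp j v)"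
    using p q unfolding on_strand_iff by blast
  have "crossing D (sp i u) (sp j v)" using crossing_same[OF uv(3,4) cr] .
  then have "(fs ! i) u = (fs ! j) v" using crossing_sp_iff[OF ij(1,2) uv(1,2)] by simp
  then have False
    using cp ij uv(1,2) len unfolding crossing_points_def by (metis empty_iff linorder_neqE_nat)
  then show "p \<in> over D \<longleftrightarrow> ov i j" ..
qed

lemma VR2_coloring_equivalent:
  assumes "VR2 D E" "virtual_link_diagram D" "virtual_link_diagram E"
  shows "coloring_equivalent X ut ot D E"
proof -
  obtain ss where ss: "change2 D E ss" "crossing_types E ss (\<lambda>i j. False)" using assms(1) by (auto simp: VR2_def)
  obtain \<phi> where "tangle_pair D E ss parallel_arcs parallel_arcs' bigon_arcs bigon_arcs' \<phi>"
    by (rule change2_tangles[OF ss(1) assms(2,3)])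
  then interpret tangle_pair D E ss parallel_arcs parallel_arcs' bigon_arcs bigon_arcs' \<phi> .
  show ?thesis
    using E.over_at_crossing_points[OF crossing_points_bigon ss(2)]
      D.over_at_crossing_points[OF crossing_points_parallel D.crossing_types_no_crossing_points[OF crossing_points_parallel]]
    by (intro coloring_equivalent_same_strand_crossings) auto
qed

lemma VR3_coloring_equivalent:
  assumes "VR3 D E" "virtual_link_diagram D" "virtual_link_diagram E"
  shows "coloring_equivalent X ut ot D E"
proof -
  obtain ss where ss: "change3 D E ss" "crossing_types D ss (\<lambda>i j. False)" "crossing_types E ss (\<lambda>i j. False)"
    using assms(1) by (auto simp: VR3_def)
  obtain \<phi> where "tangle_pair D E ss (triangle_arcs above_arc) (triangle_arcs' above_arc')
      (triangle_arcs below_arc) (triangle_arcs' below_arc') \<phi>"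
    by (rule change3_tangles[OF ss(1) assms(2,3)])
  then interpret tangle_pair D E ss "triangle_arcs above_arc" "triangle_arcs' above_arc'"
    "triangle_arcs below_arc" "triangle_arcs' below_arc'" \<phi> .
  show ?thesis
    using D.over_at_crossing_points[OF crossing_points_triangle(1) ss(2)]
      E.over_at_crossing_points[OF crossing_points_triangle(2) ss(3)]
    by (intro coloring_equivalent_same_strand_crossings) auto
qed

lemma mixed_move_coloring_equivalent:
  assumes "mixed_move D E" "virtual_link_diagram D" "virtual_link_diagram E"
  shows "coloring_equivalent X ut ot D E"
proof -
  obtain ss and h :: "nat \<Rightarrow> nat" where ss: "change3 D E ss" "crossing_types D ss (\<lambda>i j. i < 2 \<and> j < 2 \<and> h i > h j)"
      "crossing_types E ss (\<lambda>i j. i < 2 \<and> j < 2 \<and> h i > h j)"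
    using assms(1) by (auto simp: mixed_move_def)
  obtain \<phi> where "tangle_pair D E ss (triangle_arcs above_arc) (triangle_arcs' above_arc')
      (triangle_arcs below_arc) (triangle_arcs' below_arc') \<phi>"
    by (rule change3_tangles[OF ss(1) assms(2,3)])
  then interpret tangle_pair D E ss "triangle_arcs above_arc" "triangle_arcs' above_arc'"
    "triangle_arcs below_arc" "triangle_arcs' below_arc'" \<phi> .
  show ?thesis
    using D.over_at_crossing_points[OF crossing_points_triangle(1) ss(2)]
      E.over_at_crossing_points[OF crossing_points_triangle(2) ss(3)]
    by (intro coloring_equivalent_same_strand_crossings) auto
qed

section \<open>Classical moves: one relation per crossing point\<close>

lemma (in tangle) classical_crossing_points:
  fixes h :: "nat \<Rightarrow> nat"
  assumes cp: "crossing_points fs P" and ct: "crossing_types D ss (\<lambda>i j. h i > h j)" and h: "inj_on h {..<length ss}"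
    and i: "i < length ss" "\<bar>u\<bar> \<le> 1"
  shows "sp i u \<in> classical_params D \<longleftrightarrow> (\<exists>j v. (i, j, u, v) \<in> P \<or> (j, i, v, u) \<in> P)"
proof
  assume "sp i u \<in> classical_params D"
  then show "\<exists>j v. (i, j, u, v) \<in> P \<or> (j, i, v, u) \<in> P"
    by (rule classical_sp[OF i]) (use over_at_crossing_points[OF cp ct] i in blast)
next
  assume "\<exists>j v. (i, j, u, v) \<in> P \<or> (j, i, v, u) \<in> P"
  then obtain j v where jv: "(i, j, u, v) \<in> P \<or> (j, i, v, u) \<in> P" by blast
  then have j: "i \<noteq> j" "j < length ss" "\<bar>v\<bar> \<le> 1"
    using cp i(1) len by (auto simp: crossing_points_def)
  \<comment> \<open>Different heights single out an over-strand, so every crossing point is a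
    classical crossing.\<close>
  then have "h i < h j \<or> h j < h i" using h i by (auto simp: inj_on_def neq_iff[symmetric])
  then have "over_at D (sp i u) (sp j v) \<or> over_at D (sp j v) (sp i u)"
    using over_at_crossing_points[OF cp ct i(1) j(2) i(2) j(3)] over_at_crossing_points[OF cp ct j(2) i(1) j(3) i(2)] jv
    by blast
  then show "sp i u \<in> classical_params D" using over_at_classical by blast
qed

lemma (in tangle) classical_crossing_pointsI:
  fixes h :: "nat \<Rightarrow> nat"
  assumes cp: "crossing_points fs P" and "crossing_types D ss (\<lambda>i j. h i > h j)" "inj_on h {..<length ss}"
    and P: "(i, j, u, v) \<in> P"
  shows "sp i u \<in> classical_params D \<and> sp j v \<in> classical_params D"
proof -
  have "i < length ss" "j < length ss" "\<bar>u\<bar> \<le> 1" "\<bar>v\<bar> \<le> 1"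
    using cp P len by (auto simp: crossing_points_def)
  then show ?thesis using classical_crossing_points[OF assms(1-3)] P by blast
qed

lemma (in cut_tangle) solution_crossing_points:
  fixes h :: "nat \<Rightarrow> nat"
  assumes cp: "crossing_points fs P" and ct: "crossing_types D ss (\<lambda>i j. h i > h j)" and h: "inj_on h {..<length ss}"
  shows "solution X ut ot x y z \<longleftrightarrow>
    (\<forall>i<length ss. x i \<in> X \<and> y i \<in> X \<and> z i \<in> X \<and>
      (sp i (b i) \<notin> classical_params D \<longrightarrow> x i = y i) \<and> (sp i (b' i) \<notin> classical_params D \<longrightarrow> y i = z i)) \<and>
    (\<forall>(i, j, u, v)\<in>P.
      height_crossing ut ot (h i > h j) (cross ((fs' ! i) u) ((fs' ! j) v) > 0) (orient i) (orient j)
        (step_color_left (b i) (b' i) (x i) (y i) (z i) u) (step_color (b i) (b' i) (x i) (y i) (z i) u)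
        (step_color_left (b j) (b' j) (x j) (y j) (z j) v) (step_color (b j) (b' j) (x j) (y j) (z j) v))"
proof -
  let ?S = "\<lambda>i j u v. strand_crossing ut ot (cross ((fs' ! i) u) ((fs' ! j) v) > 0) (orient i) (orient j)
        (step_color_left (b i) (b' i) (x i) (y i) (z i) u) (step_color (b i) (b' i) (x i) (y i) (z i) u)
        (step_color_left (b j) (b' j) (x j) (y j) (z j) v) (step_color (b j) (b' j) (x j) (y j) (z j) v)"
  let ?H = "\<lambda>i j u v. height_crossing ut ot (h i > h j) (cross ((fs' ! i) u) ((fs' ! j) v) > 0) (orient i) (orient j)
        (step_color_left (b i) (b' i) (x i) (y i) (z i) u) (step_color (b i) (b' i) (x i) (y i) (z i) u)
        (step_color_left (b j) (b' j) (x j) (y j) (z j) v) (step_color (b j) (b' j) (x j) (y j) (z j) v)"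
  have ov: "over_at D (sp i u) (sp j v) \<longleftrightarrow> h i > h j \<and> ((i, j, u, v) \<in> P \<or> (j, i, v, u) \<in> P)"
    if "i < length ss" "j < length ss" "\<bar>u\<bar> < 1" "\<bar>v\<bar> < 1" for i j u v
    using over_at_crossing_points[OF cp ct that(1,2) less_imp_le[OF that(3)] less_imp_le[OF that(4)]] .
  have PD: "i < j" "i < length ss" "j < length ss" "\<bar>u\<bar> < 1" "\<bar>v\<bar> < 1" "(fs ! i) u = (fs ! j) v" "h i \<noteq> h j"
    if P: "(i, j, u, v) \<in> P" for i j u v
  proof -
    show 1: "i < j" "i < length ss" "j < length ss" "\<bar>u\<bar> < 1" "\<bar>v\<bar> < 1"
      using P cp len by (auto simp: crossing_points_def)
    show "(fs ! i) u = (fs ! j) v" using P 1 cp len by (simp add: crossing_points_def)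
    show "h i \<noteq> h j" using 1 h by (auto simp: inj_on_def)
  qed
  \<comment> \<open>The sign flip built into \<open>height_crossing\<close> is correct because the
    cross product of the derivatives is antisymmetric and, by transversality, nonzero.\<close>
  have HS: "?H i j u v \<longleftrightarrow> (if h i > h j then ?S i j u v else ?S j i v u)" if P: "(i, j, u, v) \<in> P" for i j u v
  proof -
    note P' = PD[OF P]
    have "crossing D (sp i u) (sp j v)" using crossing_sp_iff[of i j u v] P' by simp
    then have "cross ((fs' ! i) u) ((fs' ! j) v) \<noteq> 0" using positive_at_sp(2) P' by blast
    then have "cross ((fs' ! j) v) ((fs' ! i) u) > 0 \<longleftrightarrow> \<not> cross ((fs' ! i) u) ((fs' ! j) v) > 0"
      using cross_antisym[of "(fs' ! j) v" "(fs' ! i) u"] by linarith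
    then show ?thesis by (simp add: height_crossing_def)
  qed
  have "(\<forall>i<length ss. \<forall>j<length ss. \<forall>u v. \<bar>u\<bar> < 1 \<longrightarrow> \<bar>v\<bar> < 1 \<longrightarrow> over_at D (sp i u) (sp j v) \<longrightarrow> ?S i j u v) \<longleftrightarrow>
    (\<forall>(i, j, u, v)\<in>P. ?H i j u v)" (is "?lhs \<longleftrightarrow> ?rhs")
  proof
    assume lhs: ?lhs
    have "?H i j u v" if P: "(i, j, u, v) \<in> P" for i j u v
    proof -
      note P' = PD[OF P]
      have "if h i > h j then over_at D (sp i u) (sp j v) else over_at D (sp j v) (sp i u)"
        using ov[OF P'(2-5)] ov[OF P'(3,2,5,4)] P P'(7) by auto
      then have "if h i > h j then ?S i j u v else ?S j i v u" using lhs P' by (auto split: if_splits)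
      then show ?thesis using HS[OF P] by simp
    qed
    then show ?rhs by blast
  next
    assume rhs: ?rhs
    show ?lhs
    proof (intro allI impI)
      fix i j u v assume a: "i < length ss" "j < length ss" "\<bar>u\<bar> < 1" "\<bar>v\<bar> < 1" "over_at D (sp i u) (sp j v)"
      then have hij: "h i > h j" and "(i, j, u, v) \<in> P \<or> (j, i, v, u) \<in> P" using ov by blast+
      then consider "(i, j, u, v) \<in> P" | "(j, i, v, u) \<in> P" by blast
      then show "?S i j u v"
      proof cases
        case 1
        then have "?H i j u v" using rhs by blast
        then show ?thesis using HS[OF 1] hij by simp
      next
        case 2
        then have "?H j i v u" using rhs by blast
        then show ?thesis using HS[OF 2] hij by simp
      qed
    qed
  qed
  then show ?thesis unfolding solution_def by simp
qed

lemma dipping_cross: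
  "cross 1 (dipping_arc' (1/2)) > 0" "\<not> cross 1 (dipping_arc' (-1/2)) > 0"
  by (simp_all add: cross_def dipping_arc'_def power_divide)

lemma triangle_cross:
  "\<not> cross (Complex (4/5) (3/5)) (Complex (4/5) (- 3/5)) > 0"
  "\<not> cross (Complex (4/5) (3/5)) (above_arc' (1/2)) > 0" "cross (Complex (4/5) (- 3/5)) (above_arc' (-1/2)) > 0"
  "\<not> cross (Complex (4/5) (3/5)) (below_arc' (-1/2)) > 0" "cross (Complex (4/5) (- 3/5)) (below_arc' (1/2)) > 0"
  by (simp_all add: cross_def above_arc'_def below_arc'_def power_divide)

lemma curl_cross:
  "\<not> cross (curl_arc' (-1/2)) (curl_arc' (1/2)) > 0" "cross (curl_arc' (1/2)) (curl_arc' (-1/2)) > 0"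
  by (simp_all add: cross_def curl_arc'_def power_divide)

context finite_biquandle
begin

text \<open>With the cuts placed at the crossings, the systems of \<open>D\<close> and
  \<open>E\<close> are the hypothesis and the conclusion of \<open>triangle_move\<close>.\<close>

lemma R3_coloring_equivalent:
  assumes "R3 D E" "virtual_link_diagram D" "virtual_link_diagram E"
  shows "coloring_equivalent X ut ot D E"
proof -
  obtain ss and h :: "nat \<Rightarrow> nat" where ss: "change3 D E ss" "inj_on h {..<3}"
      "crossing_types D ss (\<lambda>i j. h i > h j)" "crossing_types E ss (\<lambda>i j. h i > h j)"
    using assms(1) by (auto simp: R3_def)
  obtain \<phi> where tp: "tangle_pair D E ss (triangle_arcs above_arc) (triangle_arcs' above_arc')
      (triangle_arcs below_arc) (triangle_arcs' below_arc') \<phi>" and len: "length ss = 3"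
    by (rule change3_tangles[OF ss(1) assms(2,3)])
  interpret tangle_pair D E ss "triangle_arcs above_arc" "triangle_arcs' above_arc'"
    "triangle_arcs below_arc" "triangle_arcs' below_arc'" \<phi> by (fact tp)
  \<comment> \<open>Entry \<open>i\<close> is the first, respectively second, crossing parameter of
    strand \<open>i\<close>; \<open>b\<close>, \<open>b'\<close> belong to the picture before the
    move and \<open>c\<close>, \<open>c'\<close> to the one after it.\<close>
  define b b' c c' :: "nat \<Rightarrow> real" where "b = (!) [0, -5/8, -1/2]" and "b' = (!) [5/8, 0, 1/2]"
    and "c = (!) [-5/8, 0, -1/2]" and "c' = (!) [0, 5/8, 1/2]"
  note bs = b_def b'_def c_def c'_def
  have inj: "inj_on h {..<length ss}" using ss(2) by (simp add: len)
  note clD = D.classical_crossing_points[OF crossing_points_triangle(1) ss(3) inj]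
  note clE = E.classical_crossing_points[OF crossing_points_triangle(2) ss(4) inj]
  interpret disc_change D E ss "triangle_arcs above_arc" "triangle_arcs' above_arc'"
    "triangle_arcs below_arc" "triangle_arcs' below_arc'" \<phi> b b' c c'
    by (rule disc_changeI[OF tp]) (auto simp: clD clE len less_3_cases_nat bs)
  let ?e = "D.orient"
  have clD': "D.sp i (b i) \<in> classical_params D" "D.sp i (b' i) \<in> classical_params D" if "i < length ss" for i
    using that D.classical_crossing_pointsI[OF crossing_points_triangle(1) ss(3) inj, of 0 1 0 0]
      D.classical_crossing_pointsI[OF crossing_points_triangle(1) ss(3) inj, of 0 2 "5/8" "1/2"]
      D.classical_crossing_pointsI[OF crossing_points_triangle(1) ss(3) inj, of 1 2 "-5/8" "-1/2"]
    by (auto simp: len less_3_cases_nat bs)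
  have clE': "D.sp i (c i) \<in> classical_params E" "D.sp i (c' i) \<in> classical_params E" if "i < length ss" for i
    using that E.classical_crossing_pointsI[OF crossing_points_triangle(2) ss(4) inj, of 0 1 0 0]
      E.classical_crossing_pointsI[OF crossing_points_triangle(2) ss(4) inj, of 0 2 "-5/8" "-1/2"]
      E.classical_crossing_pointsI[OF crossing_points_triangle(2) ss(4) inj, of 1 2 "5/8" "1/2"]
    by (auto simp: len less_3_cases_nat bs)
  have solD: "D.solution X ut ot x y z \<longleftrightarrow> (\<forall>i<3. x i \<in> X \<and> y i \<in> X \<and> z i \<in> X) \<and>
      height_crossing ut ot (h 0 > h 1) False (?e 0) (?e 1) (x 0) (y 0) (y 1) (z 1) \<and>
      height_crossing ut ot (h 1 > h 2) True (?e 1) (?e 2) (x 1) (y 1) (x 2) (y 2) \<and>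
      height_crossing ut ot (h 0 > h 2) False (?e 0) (?e 2) (y 0) (z 0) (y 2) (z 2)" for x y z
    unfolding D.solution_crossing_points[OF crossing_points_triangle(1) ss(3) inj]
    using clD' triangle_cross by (simp add: len bs step_color_def step_color_left_def conj_ac)
  have solE: "E.solution X ut ot x y z \<longleftrightarrow> (\<forall>i<3. x i \<in> X \<and> y i \<in> X \<and> z i \<in> X) \<and>
      height_crossing ut ot (h 0 > h 2) False (?e 0) (?e 2) (x 0) (y 0) (x 2) (y 2) \<and>
      height_crossing ut ot (h 0 > h 1) False (?e 0) (?e 1) (y 0) (z 0) (x 1) (y 1) \<and>
      height_crossing ut ot (h 1 > h 2) True (?e 1) (?e 2) (y 1) (z 1) (y 2) (z 2)" for x y z
    unfolding E.solution_crossing_points[OF crossing_points_triangle(2) ss(4) inj]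
    using clE' triangle_cross by (simp add: len bs step_color_def step_color_left_def conj_ac)
  have set3: "{x 0, z 0, x 1, z 1, x 2, z 2, y 0, y 1, y 2} \<subseteq> X" if "\<forall>i<3. x i \<in> X \<and> y i \<in> X \<and> z i \<in> X"
    for x y z :: "nat \<Rightarrow> 'x"
    using that by simp
  note det = determined_by_neighbours_height
  show ?thesis
  proof (rule coloring_equivalent_disc_change)
    fix x y z assume "D.solution X ut ot x y z"
    note sol = this[unfolded solD]
    obtain m0 m1 m2 where m: "m0 \<in> X" "m1 \<in> X" "m2 \<in> X"
      "height_crossing ut ot (h 0 > h 2) False (?e 0) (?e 2) (x 0) m0 (x 2) m2"
      "height_crossing ut ot (h 0 > h 1) False (?e 0) (?e 1) m0 (z 0) (x 1) m1"
      "height_crossing ut ot (h 1 > h 2) True (?e 1) (?e 2) m1 (z 1) m2 (z 2)"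
      using triangle_moveD[OF triangle_move_heights[OF ss(2), of "?e 0" "?e 1" "?e 2"], OF set3] sol by blast
    have "E.solution X ut ot x ((!) [m0, m1, m2]) z"
      unfolding solE using m sol by (auto simp: less_3_cases_nat)
    then show "\<exists>y'. E.solution X ut ot x y' z" by blast
  next
    fix x y z assume "E.solution X ut ot x y z"
    note sol = this[unfolded solE]
    obtain m0 m1 m2 where m: "m0 \<in> X" "m1 \<in> X" "m2 \<in> X"
      "height_crossing ut ot (h 0 > h 1) False (?e 0) (?e 1) (x 0) m0 m1 (z 1)"
      "height_crossing ut ot (h 1 > h 2) True (?e 1) (?e 2) (x 1) m1 (x 2) m2"
      "height_crossing ut ot (h 0 > h 2) False (?e 0) (?e 2) m0 (z 0) m2 (z 2)"
      using triangle_move_heights_converse[OF ss(2) set3, of x y z "?e 0" "?e 2" "?e 1"] sol by blast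
    have "D.solution X ut ot x ((!) [m0, m1, m2]) z"
      unfolding solD using m sol by (auto simp: less_3_cases_nat)
    then show "\<exists>y'. D.solution X ut ot x y' z" by blast
  next
    fix x y z x' y' z' i
    assume "D.solution X ut ot x y z" "D.solution X ut ot x' y' z'"
      and eq: "\<forall>j<length ss. x j = x' j \<and> z j = z' j" and i: "i < length ss"
    note sol = this(1,2)[unfolded solD]
    \<comment> \<open>Two of the three crossings have an outer color on each strand: the crossing of
      0 and 1 knows \<open>x 0\<close> and \<open>z 1\<close>, that of 1 and 2 knows
      \<open>x 1\<close> and \<open>x 2\<close>. Together they determine all middle colors.\<close>
    have "x 0 = x' 0 \<and> y 0 = y' 0 \<and> y 1 = y' 1 \<and> z 1 = z' 1"
      by (rule neighbours_unique[OF det, of "h 0 > h 1" False "?e 0" "?e 1"]) (use sol eq len in auto)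
    moreover have "x 1 = x' 1 \<and> y 1 = y' 1 \<and> x 2 = x' 2 \<and> y 2 = y' 2"
      by (rule neighbours_unique[OF det, of "h 1 > h 2" True "?e 1" "?e 2"]) (use sol eq len in auto)
    ultimately show "y i = y' i" using i by (auto simp: len less_3_cases_nat)
  next
    fix x y z x' y' z' i
    assume "E.solution X ut ot x y z" "E.solution X ut ot x' y' z'"
      and eq: "\<forall>j<length ss. x j = x' j \<and> z j = z' j" and i: "i < length ss"
    note sol = this(1,2)[unfolded solE]
    have "x 0 = x' 0 \<and> y 0 = y' 0 \<and> x 2 = x' 2 \<and> y 2 = y' 2"
      by (rule neighbours_unique[OF det, of "h 0 > h 2" False "?e 0" "?e 2"]) (use sol eq len in auto)
    moreover have "y 1 = y' 1 \<and> z 1 = z' 1 \<and> y 2 = y' 2 \<and> z 2 = z' 2"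
      by (rule neighbours_unique[OF det, of "h 1 > h 2" True "?e 1" "?e 2"]) (use sol eq len in auto)
    ultimately show "y i = y' i" using i by (auto simp: len less_3_cases_nat)
  qed
qed

text \<open>The crossings of the bigon have opposite signs. Read backwards, the second relation is
  the first one, so the pairs of entering and of leaving colors stand in the same relation to the
  middle colors; uniqueness makes the pairs equal, and existence provides the middle colors.\<close>

lemma R2_coloring_equivalent:
  assumes "R2 D E" "virtual_link_diagram D" "virtual_link_diagram E"
  shows "coloring_equivalent X ut ot D E"
proof -
  obtain ss and h :: "nat \<Rightarrow> nat" where ss: "change2 D E ss" "inj_on h {..<2}" "crossing_types E ss (\<lambda>i j. h i > h j)"
    using assms(1) by (auto simp: R2_def)
  obtain \<phi> where tp: "tangle_pair D E ss parallel_arcs parallel_arcs' bigon_arcs bigon_arcs' \<phi>" and len: "length ss = 2"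
    by (rule change2_tangles[OF ss(1) assms(2,3)])
  interpret tangle_pair D E ss parallel_arcs parallel_arcs' bigon_arcs bigon_arcs' \<phi> by (fact tp)
  define b b' :: "nat \<Rightarrow> real" where "b = (!) [-2/5, -1/2]" and "b' = (!) [2/5, 1/2]"
  note bs = b_def b'_def
  have inj: "inj_on h {..<length ss}" using ss(2) by (simp add: len)
  note ctD = D.crossing_types_no_crossing_points[OF crossing_points_parallel, of "\<lambda>i j. h i > h j"]
  note clD = D.classical_crossing_points[OF crossing_points_parallel ctD inj]
  note clE = E.classical_crossing_points[OF crossing_points_bigon ss(3) inj]
  interpret disc_change D E ss parallel_arcs parallel_arcs' bigon_arcs bigon_arcs' \<phi> b b' b b'
    by (rule disc_changeI[OF tp]) (auto simp: clD clE len less_2_cases_nat bs)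
  let ?e = "D.orient"
  have cuts: "D.sp i (b i) \<in> classical_params E" "D.sp i (b' i) \<in> classical_params E" if "i < length ss" for i
    using that E.classical_crossing_pointsI[OF crossing_points_bigon ss(3) inj, of 0 1 "-2/5" "-1/2"]
      E.classical_crossing_pointsI[OF crossing_points_bigon ss(3) inj, of 0 1 "2/5" "1/2"]
    by (auto simp: len less_2_cases_nat bs)
  have no_cuts: "D.sp i (b i) \<notin> classical_params D" "D.sp i (b' i) \<notin> classical_params D" if "i < length ss" for i
  proof -
    have "\<bar>b i\<bar> \<le> 1" "\<bar>b' i\<bar> \<le> 1" using D.cuts[OF that] by linarith+
    then show "D.sp i (b i) \<notin> classical_params D" "D.sp i (b' i) \<notin> classical_params D"
      using clD[OF that] by blast+
  qed
  have solD: "D.solution X ut ot x y z \<longleftrightarrow> (\<forall>i<2. x i \<in> X \<and> y i = x i \<and> z i = x i)" for x y z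
    unfolding D.solution_crossing_points[OF crossing_points_parallel ctD inj] using no_cuts by (auto simp: len)
  have flip: "height_crossing ut ot io True e0 e1 l r l' r' = height_crossing ut ot io False e0 e1 r l r' l'"
    for io e0 e1 l r l' r'
    using height_crossing_flip_sign[of ut ot io False] by simp
  have solE: "E.solution X ut ot x y z \<longleftrightarrow> (\<forall>i<2. x i \<in> X \<and> y i \<in> X \<and> z i \<in> X) \<and>
      height_crossing ut ot (h 0 > h 1) False (?e 0) (?e 1) (x 0) (y 0) (x 1) (y 1) \<and>
      height_crossing ut ot (h 0 > h 1) False (?e 0) (?e 1) (z 0) (y 0) (z 1) (y 1)" for x y z
    unfolding E.solution_crossing_points[OF crossing_points_bigon ss(3) inj]
    using cuts dipping_cross by (auto simp: len bs step_color_def step_color_left_def flip)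
  have det: "determined_by_neighbours X (height_crossing ut ot (h 0 > h 1) False (?e 0) (?e 1))"
    by (rule determined_by_neighbours_height)
  show ?thesis
  proof (rule coloring_equivalent_disc_change)
    fix x y z assume "D.solution X ut ot x y z"
    then have x: "x 0 \<in> X" "x 1 \<in> X" "z 0 = x 0" "z 1 = x 1" by (auto simp: solD)
    obtain m0 m1 where "m0 \<in> X" "m1 \<in> X" "height_crossing ut ot (h 0 > h 1) False (?e 0) (?e 1) (x 0) m0 (x 1) m1"
      using neighbours_exist(1)[OF det x(1,2)] by blast
    then have "E.solution X ut ot x ((!) [m0, m1]) z"
      unfolding solE using x by (auto simp: less_2_cases_nat)
    then show "\<exists>y'. E.solution X ut ot x y' z" by blast
  next
    fix x y z assume "E.solution X ut ot x y z"
    note sol = this[unfolded solE]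
    have "x 0 = z 0 \<and> y 0 = y 0 \<and> x 1 = z 1 \<and> y 1 = y 1"
      by (rule neighbours_unique[OF det]) (use sol in auto)
    then have "D.solution X ut ot x x z" using sol by (auto simp: solD less_2_cases_nat)
    then show "\<exists>y'. D.solution X ut ot x y' z" by blast
  next
    fix x y z x' y' z' i
    assume "D.solution X ut ot x y z" "D.solution X ut ot x' y' z'"
      and "\<forall>j<length ss. x j = x' j \<and> z j = z' j" "i < length ss"
    then show "y i = y' i" by (auto simp: solD len)
  next
    fix x y z x' y' z' i
    assume "E.solution X ut ot x y z" "E.solution X ut ot x' y' z'"
      and eq: "\<forall>j<length ss. x j = x' j \<and> z j = z' j" and i: "i < length ss"
    note sol = this(1,2)[unfolded solE]
    have "x 0 = x' 0 \<and> y 0 = y' 0 \<and> x 1 = x' 1 \<and> y 1 = y' 1"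
      by (rule neighbours_unique[OF det]) (use sol eq len in auto)
    then show "y i = y' i" using i by (auto simp: len less_2_cases_nat)
  qed
qed

text \<open>For either sign of the crossing the curl imposes equality of the outer colors and one
  equation for the loop color: depending on the direction of travel, it is the image or the preimage
  of the outer color under the diagonal map.\<close>

lemma R1_coloring_equivalent:
  assumes "R1 D E" "virtual_link_diagram D" "virtual_link_diagram E"
  shows "coloring_equivalent X ut ot D E"
proof -
  obtain s where s: "change1 D E [s]" "strand_param s (-1/2) \<in> over E \<or> strand_param s (1/2) \<in> over E"
    using assms(1) by (auto simp: R1_def)
  obtain \<phi> where tp: "tangle_pair D E [s] [straight_arc] [\<lambda>_. 1] [curl_arc] [curl_arc'] \<phi>"
    by (rule change1_tangles[OF s(1) assms(2,3)])
  interpret tangle_pair D E "[s]" "[straight_arc]" "[\<lambda>_. 1]" "[curl_arc]" "[curl_arc']" \<phi> by (fact tp)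
  have oD: "\<not> over_at D (strand_param s u) (strand_param s v)" if "\<bar>u\<bar> \<le> 1" "\<bar>v\<bar> \<le> 1" for u v
    using D.over_at_sp[of 0 0 u v] that arcs_simple by auto
  have clD: "strand_param s u \<notin> classical_params D" if "\<bar>u\<bar> \<le> 1" for u
    using D.classical_sp[of 0 u] oD that by (metis length_Cons less_one list.size(3) nth_Cons_0 One_nat_def)
  have cr: "crossing E (strand_param s u) (strand_param s v) \<longleftrightarrow> u = -1/2 \<and> v = 1/2 \<or> u = 1/2 \<and> v = -1/2"
    if "\<bar>u\<bar> \<le> 1" "\<bar>v\<bar> \<le> 1" for u v
    using E.crossing_sp_iff[of 0 0 u v] arc_intersections(8)[OF that] that by auto
  \<comment> \<open>Records which of the two passages through the double point is on top; with
    \<open>?e\<close> it distinguishes the four oriented curls.\<close>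
  define lower where "lower \<longleftrightarrow> strand_param s (-1/2) \<in> over E"
  have "crossing E (strand_param s (-1/2)) (strand_param s (1/2))" using cr[of "-1/2" "1/2"] by simp
  then have "\<not> (strand_param s (-1/2) \<in> over E \<and> strand_param s (1/2) \<in> over E)"
    using assms(3) unfolding virtual_link_diagram_def by blast
  then have upper: "strand_param s (1/2) \<in> over E \<longleftrightarrow> \<not> lower" using s(2) by (auto simp: lower_def)
  have oE: "over_at E (strand_param s u) (strand_param s v) \<longleftrightarrow>
      (if lower then u = -1/2 \<and> v = 1/2 else u = 1/2 \<and> v = -1/2)" if "\<bar>u\<bar> \<le> 1" "\<bar>v\<bar> \<le> 1" for u v
  proof (cases "u = -1/2 \<and> v = 1/2 \<or> u = 1/2 \<and> v = -1/2")
    case True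
    then consider "u = -1/2" "v = 1/2" | "u = 1/2" "v = -1/2" by blast
    then show ?thesis
    proof cases
      case 1
      show ?thesis unfolding 1 using cr[of "-1/2" "1/2"] lower_def by (simp add: over_at_def)
    next
      case 2
      show ?thesis unfolding 2 using cr[of "1/2" "-1/2"] upper by (simp add: over_at_def)
    qed
  next
    case False
    then show ?thesis using cr[OF that] unfolding over_at_def by auto
  qed
  have clE: "strand_param s (-1/2) \<in> classical_params E" "strand_param s (1/2) \<in> classical_params E"
    using oE[of "-1/2" "1/2"] oE[of "1/2" "-1/2"] over_at_classical[of E] by (cases lower; simp)+
  interpret disc_change D E "[s]" "[straight_arc]" "[\<lambda>_. 1]" "[curl_arc]" "[curl_arc']" \<phi>
    "\<lambda>_. -1/2" "\<lambda>_. 1/2" "\<lambda>_. -1/2" "\<lambda>_. 1/2"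
  proof (rule disc_changeI[OF tp])
    fix i u assume i: "i < length [s]" "\<bar>u\<bar> \<le> 1" and cl: "strand_param ([s] ! i) u \<in> classical_params E"
    show "u = -1/2 \<or> u = 1/2"
    proof (rule E.classical_sp[OF i cl])
      fix j v assume "j < length [s]" "\<bar>v\<bar> \<le> 1"
        "over_at E (strand_param ([s] ! i) u) (strand_param ([s] ! j) v) \<or> over_at E (strand_param ([s] ! j) v) (strand_param ([s] ! i) u)"
      then show ?thesis using i oE[OF i(2) \<open>\<bar>v\<bar> \<le> 1\<close>] oE[OF \<open>\<bar>v\<bar> \<le> 1\<close> i(2)] by (auto split: if_splits)
    qed
  qed (use clD in auto)
  let ?e = "D.orient 0"
  have solD: "D.solution X ut ot x y z \<longleftrightarrow> x 0 \<in> X \<and> y 0 = x 0 \<and> z 0 = x 0" for x y z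
    unfolding D.solution_def using oD clD[of "-1/2"] clD[of "1/2"] by (auto dest: less_imp_le)
  have solE: "E.solution X ut ot x y z \<longleftrightarrow> x 0 \<in> X \<and> y 0 \<in> X \<and> z 0 = x 0 \<and>
      (if ?e then y 0 = ut (x 0) (x 0) else x 0 = ut (y 0) (y 0))" for x y z
  proof -
    let ?S = "\<lambda>u v. strand_crossing ut ot (cross (curl_arc' u) (curl_arc' v) > 0) ?e ?e
        (step_color_left (-1/2) (1/2) (x 0) (y 0) (z 0) u) (step_color (-1/2) (1/2) (x 0) (y 0) (z 0) u)
        (step_color_left (-1/2) (1/2) (x 0) (y 0) (z 0) v) (step_color (-1/2) (1/2) (x 0) (y 0) (z 0) v)"
    have "E.solution X ut ot x y z \<longleftrightarrow> (x 0 \<in> X \<and> y 0 \<in> X \<and> z 0 \<in> X) \<and>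
        (\<forall>u v. \<bar>u\<bar> < 1 \<longrightarrow> \<bar>v\<bar> < 1 \<longrightarrow> over_at E (strand_param s u) (strand_param s v) \<longrightarrow> ?S u v)"
      unfolding E.solution_def using clE by simp
    also have "(\<forall>u v. \<bar>u\<bar> < 1 \<longrightarrow> \<bar>v\<bar> < 1 \<longrightarrow> over_at E (strand_param s u) (strand_param s v) \<longrightarrow> ?S u v) \<longleftrightarrow>
        (if lower then ?S (-1/2) (1/2) else ?S (1/2) (-1/2))" (is "?lhs \<longleftrightarrow> ?rhs")
    proof
      assume lhs: ?lhs
      show ?rhs using lhs[rule_format, of "-1/2" "1/2"] lhs[rule_format, of "1/2" "-1/2"] oE[of "-1/2" "1/2"] oE[of "1/2" "-1/2"]
        by (cases lower) simp_all
    next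
      assume rhs: ?rhs
      show ?lhs
      proof (intro allI impI)
        fix u v :: real assume "\<bar>u\<bar> < 1" "\<bar>v\<bar> < 1" "over_at E (strand_param s u) (strand_param s v)"
        then have "if lower then u = -1/2 \<and> v = 1/2 else u = 1/2 \<and> v = -1/2" using oE[of u v] by simp
        then show "?S u v" using rhs by presburger
      qed
    qed
    also have "?rhs \<longleftrightarrow> (if lower then strand_crossing ut ot False ?e ?e (x 0) (y 0) (y 0) (z 0)
        else strand_crossing ut ot True ?e ?e (y 0) (z 0) (x 0) (y 0))"
      using curl_cross by (simp add: step_color_def step_color_left_def)
    \<comment> \<open>If \<open>?e\<close> holds, the loop color equals both a \<open>ut\<close> and
      an \<open>ot\<close> product of the outer colors, so these coincide by
      \<open>ut_eq_ot_iff\<close>. Otherwise the outer colors are \<open>ut (y 0) (y 0)\<close> and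
      \<open>ot (y 0) (y 0)\<close>, equal by axiom (1).\<close>
    also have "(x 0 \<in> X \<and> y 0 \<in> X \<and> z 0 \<in> X) \<and> \<dots> \<longleftrightarrow> x 0 \<in> X \<and> y 0 \<in> X \<and> z 0 = x 0 \<and>
        (if ?e then y 0 = ut (x 0) (x 0) else x 0 = ut (y 0) (y 0))"
      using ut_eq_ot_iff[of "x 0" "z 0"] ut_eq_ot_iff[of "z 0" "x 0"] diagonal[of "x 0"] diagonal[of "y 0"]
      by (cases ?e; cases lower) (auto simp: strand_crossing_def crossing_relation_def)
    finally show ?thesis .
  qed
  show ?thesis
  proof (rule coloring_equivalent_disc_change)
    fix x y z assume "D.solution X ut ot x y z"
    then have x: "x 0 \<in> X" "z 0 = x 0" unfolding solD by auto
    have "\<exists>w\<in>X. if ?e then w = ut (x 0) (x 0) else x 0 = ut w w"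
    proof (cases ?e)
      case True
      then show ?thesis using closed(1)[OF x(1) x(1)] by auto
    next
      case False
      obtain w where "w \<in> X" "x 0 = ut w w" using kink[OF x(1)] by metis
      then show ?thesis using False by (auto intro!: bexI[of _ w])
    qed
    then obtain w where "w \<in> X" "if ?e then w = ut (x 0) (x 0) else x 0 = ut w w" by blast
    then have "E.solution X ut ot x (\<lambda>_. w) z" unfolding solE using x by simp
    then show "\<exists>y'. E.solution X ut ot x y' z" by blast
  next
    fix x y z assume "E.solution X ut ot x y z"
    then have "D.solution X ut ot x x z" unfolding solE solD by simp
    then show "\<exists>y'. D.solution X ut ot x y' z" by blast
  next
    fix x y z x' y' z' i
    assume "D.solution X ut ot x y z" "D.solution X ut ot x' y' z'"
      and "\<forall>j<length [s]. x j = x' j \<and> z j = z' j" "i < length [s]"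
    then show "y i = y' i" unfolding solD by auto
  next
    fix x y z x' y' z' i
    assume "E.solution X ut ot x y z" "E.solution X ut ot x' y' z'"
      and eq: "\<forall>j<length [s]. x j = x' j \<and> z j = z' j" and i: "i < length [s]"
    note sol = this(1,2)[unfolded solE]
    have x: "x' 0 = x 0" "x 0 \<in> X" "y 0 \<in> X" "y' 0 \<in> X" using eq sol by auto
    have "y 0 = y' 0"
    proof (cases ?e)
      case True
      then show ?thesis using sol x(1) by simp
    next
      case False
      then have "ut (y 0) (y 0) = x 0" "ut (y' 0) (y' 0) = x 0" using sol x(1) by auto
      then show ?thesis using kink[OF x(2)] x(3,4) by blast
    qed
    then show "y i = y' i" using i by simp
  qed
qed

lemma elementary_step_coloring_equivalent:
  assumes "elementary_step D E"
  shows "coloring_equivalent X ut ot D E"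
proof -
  have vld: "virtual_link_diagram D" "virtual_link_diagram E"
    using assms by (simp_all add: elementary_step_def)
  show ?thesis
    using assms unfolding elementary_step_def
    by (elim conjE disjE)
      (simp_all add: vld reparametrization_coloring_equivalent planar_isotopic_coloring_equivalent
        R1_coloring_equivalent R2_coloring_equivalent R3_coloring_equivalent VR1_coloring_equivalent
        VR2_coloring_equivalent VR3_coloring_equivalent mixed_move_coloring_equivalent)
qed

lemma virtually_equivalent_coloring_equivalent:
  assumes "virtually_equivalent D E"
  shows "coloring_equivalent X ut ot D E"
  using assms unfolding virtually_equivalent_def
proof (induction rule: equivclp_induct)
  case base
  show ?case by (rule coloring_equivalent_refl)
next
  case (step E F)
  have "coloring_equivalent X ut ot E F"
    using step(2)
  proof
    assume "elementary_step F E"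
    then show ?thesis
      using coloring_equivalent_sym elementary_step_coloring_equivalent elementary_step_def by blast
  qed (rule elementary_step_coloring_equivalent)
  with step(3) show ?case by (rule coloring_equivalent_trans)
qed

end

theorem theorem3p3p2:
  fixes X :: "'x set" and ut ot :: "'x \<Rightarrow> 'x \<Rightarrow> 'x"
    and S :: "nat \<Rightarrow> ('x \<Rightarrow> 'x) set" and m N :: nat
    and L1 L2 :: diagram
  assumes "finite X" and "biquandle X ut ot"
    and "filtration_of S m (End X ut ot)" and "S 0 = {}"
    and "N \<ge> 1"
    and "virtual_link_diagram L1" and "virtual_link_diagram L2"
    and "virtually_equivalent L1 L2"
  shows "stillborn_matrix N L1 X ut ot S m = stillborn_matrix N L2 X ut ot S m"
proof -
  interpret finite_biquandle X ut ot by unfold_locales fact+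
  show ?thesis
    using assms virtually_equivalent_coloring_equivalent by (intro stillborn_matrix_coloring_equivalent)
qed

end
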